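(* Let $n\ge3$ and $0\le k\le n-3$ be integers. Then: (i) For $d<\binom{n-k}2$ the degree $d$ homogeneous component of $\mathcal{I}(\mathrm{Her}(n)_{k+1})\subseteq\mathbb{R}[\mathrm{Her}(n)]$ is zero. (ii) The degree $\binom{n-k}2$ homogeneous component of $\mathcal{I}(\mathrm{Her}(n)_{k+1})$ contains an irreducible real $SU(n)$-submodule isomorphic to $V^{(n-k,1^k)}_{\mathbb{R}}$. (iii) The $k$-subdiscriminant $\mathrm{sDisc}_k\in\mathbb{R}[\mathrm{Her}(n)]$ can be written as a sum of $2\dim_{\mathbb{C}}(V^{(n-k,1^k)})$ squares of elements of $\mathbb{R}[\mathrm{Her}(n)]$.
   Context: $\mathrm{Her}(n)=\{A\in\mathbb{C}^{n\times n}\mid\bar A=A^T\}$ as a real vector space; $SU(n)$ acts on $\mathbb{R}[\mathrm{Her}(n)]$ by $(g\cdot f)(A)=f(g^{-1}Ag)$. $\mathrm{Her}(n)_{k+1}=\{A\in\mathrm{Her}(n)\mid\deg(m_A)\le n-k-1\}$ with $m_A$ the minimal polynomial, and $\mathcal{I}(\cdot)$ is the vanishing ideal. $\mathrm{sDisc}_k(A)=\sum_{1\le i_1<\dots<i_{n-k}\le n}\prod_{1\le s<t\le n-k}(\lambda_{i_s}-\lambda_{i_t})^2$ with $\lambda_i$ the eigenvalues of $A$. Characters of the diagonal torus of $SL(n,\mathbb{C})$ are identified with $\lambda\in\mathbb{Z}^{n-1}$ via $\mathrm{diag}(z_1,\dots,z_{n-1},(z_1\cdots z_{n-1})^{-1})\mapsto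 z_1^{\lambda_1}\cdots z_{n-1}^{\lambda_{n-1}}$; $V^\lambda$ is the irreducible $SL(n,\mathbb{C})$-module with highest weight $\lambda$ ($\lambda_1\ge\dots\ge\lambda_{n-1}\ge0$). $(n-k,1^k)$ denotes $(n-k,1,\dots,1,0,\dots,0)\in\mathbb{Z}^{n-1}$ with $k$ entries equal to $1$. $V^\lambda_{\mathbb{R}}$ is $V^\lambda$ regarded as a real representation of $SU(n)$ (realification). *)

theory Defs
  imports "Jordan_Normal_Form.Schur_Decomposition" "Jordan_Normal_Form.Char_Poly"
begin

definition SLn :: "nat \<Rightarrow> complex mat set" where
  "SLn n = {g \<in> carrier_mat n n. det g = 1}"

definition SUn :: "nat \<Rightarrow> complex mat set" where
  "SUn n = {U \<in> carrier_mat n n. U * mat_adjoint U = 1\<^sub>m n \<and> mat_adjoint U * U = 1\<^sub>m n \<and> det U = 1}"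

definition Her :: "nat \<Rightarrow> complex mat set" where
  "Her n = {A \<in> carrier_mat n n. mat_adjoint A = A}"

definition mat_poly_eval :: "nat \<Rightarrow> complex poly \<Rightarrow> complex mat \<Rightarrow> complex mat" where
  "mat_poly_eval n p A =
     foldr (+) (map (\<lambda>i. coeff p i \<cdot>\<^sub>m (A ^\<^sub>m i)) [0..<Suc (degree p)]) (0\<^sub>m n n)"

definition min_poly_deg :: "nat \<Rightarrow> complex mat \<Rightarrow> nat" where
  "min_poly_deg n A = (LEAST d. \<exists>p. lead_coeff p = 1 \<and> degree p = d \<and> mat_poly_eval n p A = 0\<^sub>m n n)"

definition Her_strat :: "nat \<Rightarrow> nat \<Rightarrow> complex mat set" where
  "Her_strat n k = {A \<in> Her n. min_poly_deg n A \<le> n - k - 1}"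

inductive hpoly :: "nat \<Rightarrow> nat \<Rightarrow> (complex mat \<Rightarrow> real) \<Rightarrow> bool" for n where
  hconst: "hpoly n 0 (\<lambda>A. c)"
| hre: "i < n \<Longrightarrow> j < n \<Longrightarrow> hpoly n 1 (\<lambda>A. Re (A $$ (i, j)))"
| him: "i < n \<Longrightarrow> j < n \<Longrightarrow> hpoly n 1 (\<lambda>A. Im (A $$ (i, j)))"
| hadd: "hpoly n d f \<Longrightarrow> hpoly n d g \<Longrightarrow> hpoly n d (\<lambda>A. f A + g A)"
| hmult: "hpoly n d f \<Longrightarrow> hpoly n e g \<Longrightarrow> hpoly n (d + e) (\<lambda>A. f A * g A)"

inductive rpoly :: "nat \<Rightarrow> (complex mat \<Rightarrow> real) \<Rightarrow> bool" for n where
  rconst: "rpoly n (\<lambda>A. c)"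
| rre: "i < n \<Longrightarrow> j < n \<Longrightarrow> rpoly n (\<lambda>A. Re (A $$ (i, j)))"
| rim: "i < n \<Longrightarrow> j < n \<Longrightarrow> rpoly n (\<lambda>A. Im (A $$ (i, j)))"
| radd: "rpoly n f \<Longrightarrow> rpoly n g \<Longrightarrow> rpoly n (\<lambda>A. f A + g A)"
| rmult: "rpoly n f \<Longrightarrow> rpoly n g \<Longrightarrow> rpoly n (\<lambda>A. f A * g A)"

text \<open>Elements of \<open>R[Her(n)]\<close> are represented as functions on Her(n),
  extended by 0 outside Her(n) (so that equality is equality in \<open>R[Her(n)]\<close>).\<close>
definition hom_comp :: "nat \<Rightarrow> nat \<Rightarrow> (complex mat \<Rightarrow> real) set" where
  "hom_comp n d = {f. (\<exists>p. hpoly n d p \<and> (\<forall>A \<in> Her n. f A = p A)) \<and> (\<forall>A. A \<notin> Her n \<longrightarrow> f A = 0)}"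

definition vanish_comp :: "nat \<Rightarrow> complex mat set \<Rightarrow> nat \<Rightarrow> (complex mat \<Rightarrow> real) set" where
  "vanish_comp n X d = {f \<in> hom_comp n d. \<forall>A \<in> X. f A = 0}"

definition su_act :: "nat \<Rightarrow> complex mat \<Rightarrow> (complex mat \<Rightarrow> real) \<Rightarrow> (complex mat \<Rightarrow> real)" where
  "su_act n g f = (\<lambda>A. if A \<in> Her n then f (mat_adjoint g * A * g) else 0)"

definition real_subspace :: "(complex mat \<Rightarrow> real) set \<Rightarrow> bool" where
  "real_subspace M \<longleftrightarrow> (\<lambda>A. 0) \<in> M \<and> (\<forall>f \<in> M. \<forall>g \<in> M. (\<lambda>A. f A + g A) \<in> M)
     \<and> (\<forall>r. \<forall>f \<in> M. (\<lambda>A. r * f A) \<in> M)"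

definition su_invariant :: "nat \<Rightarrow> (complex mat \<Rightarrow> real) set \<Rightarrow> bool" where
  "su_invariant n M \<longleftrightarrow> (\<forall>g \<in> SUn n. \<forall>f \<in> M. su_act n g f \<in> M)"

definition irreducible_real_submodule :: "nat \<Rightarrow> (complex mat \<Rightarrow> real) set \<Rightarrow> bool" where
  "irreducible_real_submodule n M \<longleftrightarrow> real_subspace M \<and> su_invariant n M \<and> M \<noteq> {\<lambda>A. 0}
     \<and> (\<forall>N \<subseteq> M. real_subspace N \<and> su_invariant n N \<longrightarrow> N = {\<lambda>A. 0} \<or> N = M)"

inductive cpoly :: "nat \<Rightarrow> (complex mat \<Rightarrow> complex) \<Rightarrow> bool" for n where
  cconst: "cpoly n (\<lambda>g. c)"
| centry: "i < n \<Longrightarrow> j < n \<Longrightarrow> cpoly n (\<lambda>g. g $$ (i, j))"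
| cadd: "cpoly n f \<Longrightarrow> cpoly n h \<Longrightarrow> cpoly n (\<lambda>g. f g + h g)"
| cmult: "cpoly n f \<Longrightarrow> cpoly n h \<Longrightarrow> cpoly n (\<lambda>g. f g * h g)"

definition upper_unitriangular :: "nat \<Rightarrow> complex mat \<Rightarrow> bool" where
  "upper_unitriangular n u \<longleftrightarrow> u \<in> carrier_mat n n \<and>
     (\<forall>i < n. \<forall>j < n. (j < i \<longrightarrow> u $$ (i, j) = 0) \<and> (i = j \<longrightarrow> u $$ (i, j) = 1))"

definition torus_char :: "nat \<Rightarrow> (nat \<Rightarrow> nat) \<Rightarrow> complex mat \<Rightarrow> complex" where
  "torus_char n lam t = (\<Prod>i < n - 1. (t $$ (i, i)) ^ lam i)"

text \<open>\<open>is_V_hw n lam m rho\<close>: rho is a (polynomial) representation of SL(n,C) on \<open>C^m\<close>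
  which is irreducible and has highest weight lam (w.r.t. diagonal torus and upper
  triangular Borel); i.e. \<open>(C^m, rho)\<close> is a model of \<open>V^lam\<close>.\<close>
definition is_V_hw :: "nat \<Rightarrow> (nat \<Rightarrow> nat) \<Rightarrow> nat \<Rightarrow> (complex mat \<Rightarrow> complex mat) \<Rightarrow> bool" where
  "is_V_hw n lam m rho \<longleftrightarrow>
     (\<forall>g \<in> SLn n. rho g \<in> carrier_mat m m)
   \<and> rho (1\<^sub>m n) = 1\<^sub>m m
   \<and> (\<forall>g \<in> SLn n. \<forall>h \<in> SLn n. rho (g * h) = rho g * rho h)
   \<and> (\<forall>i < m. \<forall>j < m. \<exists>p. cpoly n p \<and> (\<forall>g \<in> SLn n. rho g $$ (i, j) = p g))
   \<and> (\<forall>v \<in> carrier_vec m. v \<noteq> 0\<^sub>v m \<longrightarrow> (\<forall>w \<in> carrier_vec m.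
        \<exists>(N::nat) (gs :: nat \<Rightarrow> complex mat) (cs :: nat \<Rightarrow> complex). (\<forall>i < N. gs i \<in> SLn n) \<and>
          (\<forall>l < m. w $ l = (\<Sum>i < N. cs i * (rho (gs i) *\<^sub>v v) $ l))))
   \<and> (\<exists>v \<in> carrier_vec m. v \<noteq> 0\<^sub>v m
        \<and> (\<forall>t \<in> SLn n. diagonal_mat t \<longrightarrow> rho t *\<^sub>v v = torus_char n lam t \<cdot>\<^sub>v v)
        \<and> (\<forall>u. upper_unitriangular n u \<longrightarrow> rho u *\<^sub>v v = v))"

definition hook_wt :: "nat \<Rightarrow> nat \<Rightarrow> nat \<Rightarrow> nat" where
  "hook_wt n k i = (if i = 0 then n - k else if i \<le> k then 1 else 0)"

definition iso_realification :: "nat \<Rightarrow> (complex mat \<Rightarrow> real) set \<Rightarrow> nat \<Rightarrow> (complex mat \<Rightarrow> complex mat) \<Rightarrow> bool" where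
  "iso_realification n M m rho \<longleftrightarrow> (\<exists>phi. bij_betw phi M (carrier_vec m)
      \<and> (\<forall>f \<in> M. \<forall>g \<in> M. phi (\<lambda>A. f A + g A) = phi f + phi g)
      \<and> (\<forall>r. \<forall>f \<in> M. phi (\<lambda>A. r * f A) = complex_of_real r \<cdot>\<^sub>v phi f)
      \<and> (\<forall>U \<in> SUn n. \<forall>f \<in> M. phi (su_act n U f) = rho U *\<^sub>v phi f))"

definition sDisc_list :: "nat \<Rightarrow> nat \<Rightarrow> complex list \<Rightarrow> complex" where
  "sDisc_list n k ls = (\<Sum>S \<in> {S. S \<subseteq> {0..<n} \<and> card S = n - k}.
      \<Prod>p \<in> {(s, t). s \<in> S \<and> t \<in> S \<and> s < t}. (ls ! fst p - ls ! snd p)^2)"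

definition sDisc :: "nat \<Rightarrow> nat \<Rightarrow> complex mat \<Rightarrow> complex" where
  "sDisc n k A = sDisc_list n k (SOME ls. length ls = n \<and>
      char_poly A = prod_list (map (\<lambda>l. [:- l, 1:]) ls))"

end

theory Submission
  imports Defs "HOL-Combinatorics.Permutations" "HOL-Library.FuncSet" "Jordan_Normal_Form.Spectral_Radius"
begin

text \<open>
  Put \<open>N = n - k\<close>. The form \<open>w \<mapsto> w \<and> A w \<and> \<dots> \<and> A\<^bsup>N-1\<^esup> w\<close> vanishes exactly when the minimal
  polynomial of \<open>A\<close> has degree below \<open>N\<close>; its coefficients are homogeneous of degree
  \<open>N choose 2\<close> in \<open>A\<close> and span a conjugation invariant space \<open>V\<close> of polynomial functions. For diagonal
  \<open>A\<close> they are Vandermonde products of \<open>N\<close> eigenvalues, so the sum of their squared moduli, which is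
  unitarily invariant, is a multiple of the subdiscriminant. Rewriting it in an orthonormal basis
  turns the subdiscriminant into a sum of \<open>2 dim V\<close> real squares.

  The coefficient \<open>e\<^sub>1\<^sup>* \<and> e\<^sub>k\<^sub>+\<^sub>2\<^sup>* \<and> \<dots> \<and> e\<^sub>n\<^sup>*\<close> at \<open>w = e\<^sub>1\<close> is a highest weight vector of weight
  \<open>(N, 1\<^sup>k)\<close>. It generates \<open>V\<close> under the unitary group and spans an extreme weight space; the opposite
  weight does not occur because \<open>N \<ge> 3\<close>. Hence averaging over a finite cyclic subgroup of the torus with
  real (cosine) coefficients projects onto this line, and together with the invariant inner product this shows
  that \<open>V\<close> is irreducible even as a real representation of \<open>SU(n)\<close>. In particular taking real parts on
  Hermitian matrices is injective.

  For the vanishing in low degrees, a Hermitian matrix with \<open>q \<ge> N\<close> distinct eigenvalues lies on a line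
  that contains \<open>q choose 2\<close> matrices with fewer eigenvalues, and one inducts on \<open>q\<close>.
\<close>

section \<open>Adjoints and unitary matrices\<close>

text \<open>Complex irreducibility alone would not give the second claim: the realification of an
  irreducible module splits when the module has an invariant real structure, and its weights are
  then symmetric under negation. The missing weight \<open>- M\<close> excludes this, so the
  argument rests on one projection with real coefficients; complex irreducibility over SL(n) is
  deduced from real irreducibility, not the other way round. Coordinates are indexed by all pairs of
  maps from N positions to n indices instead of by a basis of exterior power tensor symmetric power.
  The redundancy makes the invariance of the norm immediate, because a unitary matrix acts on full
  tensor powers by a unitary matrix. The price is the constant \<open>(fact N)\<^sup>2\<close> in
  front of the subdiscriminant. The extreme coordinate is not a highest weight vector of the ambient
  tensor space. It becomes one on \<open>V\<close> because the form is divisible by w: the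
  coordinates at w = e with index 0 whose rows omit index 0 vanish identically.\<close>

lemma mult_carrier_square [simp]:
  "A \<in> carrier_mat n n \<Longrightarrow> B \<in> carrier_mat n n \<Longrightarrow> A * B \<in> carrier_mat n n"
  by (rule mult_carrier_mat)

lemma mat_adjoint_carrier [simp]: "A \<in> carrier_mat n m \<Longrightarrow> mat_adjoint A \<in> carrier_mat m n"
  by (auto simp: mat_adjoint_def)

lemma mat_adjoint_dims [simp]: "dim_row (mat_adjoint A) = dim_col A" "dim_col (mat_adjoint A) = dim_row A"
  by (auto simp: mat_adjoint_def)

lemma mat_adjoint_index [simp]:
  fixes A :: "complex mat"
  assumes "i < dim_col A" "j < dim_row A"
  shows "mat_adjoint A $$ (i, j) = cnj (A $$ (j, i))"
  using assms by (simp add: mat_adjoint_def mat_of_rows_index)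

lemma mat_adjoint_adjoint [simp]: "mat_adjoint (mat_adjoint A) = (A :: complex mat)"
  by (rule eq_matI) auto

lemma mat_adjoint_mult:
  fixes A B :: "complex mat"
  assumes "A \<in> carrier_mat n m" "B \<in> carrier_mat m l"
  shows "mat_adjoint (A * B) = mat_adjoint B * mat_adjoint A"
  by (rule eq_matI) (use assms in \<open>auto simp: scalar_prod_def mult.commute intro!: sum.cong\<close>)

lemma mat_adjoint_one [simp]: "mat_adjoint (1\<^sub>m n) = (1\<^sub>m n :: complex mat)"
  by (rule eq_matI) auto

lemma mat_adjoint_four_block:
  fixes A B C D :: "complex mat"
  assumes "A \<in> carrier_mat a a" "B \<in> carrier_mat a d" "C \<in> carrier_mat d a" "D \<in> carrier_mat d d"
  shows "mat_adjoint (four_block_mat A B C D) =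
    four_block_mat (mat_adjoint A) (mat_adjoint C) (mat_adjoint B) (mat_adjoint D)"
  by (rule eq_matI) (use assms in auto)

lemma det_mat_adjoint:
  assumes "A \<in> carrier_mat n n"
  shows "det (mat_adjoint A) = cnj (det A)"
proof -
  have "det (mat_adjoint A) = (\<Sum>p | p permutes {0..<n}. of_int (sign p) * (\<Prod>j<n. mat_adjoint A $$ (p j, j)))"
    by (rule det_col) (use assms in simp)
  also have "\<dots> = (\<Sum>p | p permutes {0..<n}. cnj (of_int (sign p) * (\<Prod>j<n. A $$ (j, p j))))"
  proof (rule sum.cong[OF refl])
    fix p assume "p \<in> {p. p permutes {0..<n}}"
    hence p: "p j < n" if "j < n" for j using that permutes_in_image[of p "{0..<n}" j] by auto
    show "of_int (sign p) * (\<Prod>j<n. mat_adjoint A $$ (p j, j)) =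
      cnj (of_int (sign p) * (\<Prod>j<n. A $$ (j, p j)))"
      using assms p by (auto intro!: prod.cong)
  qed
  also have "\<dots> = cnj (det A)"
    by (simp add: det_def'[OF assms] atLeast0LessThan)
  finally show ?thesis .
qed

definition unitaries :: "nat \<Rightarrow> complex mat set" where
  "unitaries n = {U \<in> carrier_mat n n. U * mat_adjoint U = 1\<^sub>m n \<and> mat_adjoint U * U = 1\<^sub>m n}"

lemma unitariesI:
  assumes "U \<in> carrier_mat n n" "mat_adjoint U * U = 1\<^sub>m n"
  shows "U \<in> unitaries n"
  using assms mat_mult_left_right_inverse[of "mat_adjoint U" n U] by (auto simp: unitaries_def)

lemma unitariesD:
  assumes "U \<in> unitaries n"
  shows "U \<in> carrier_mat n n" "U * mat_adjoint U = 1\<^sub>m n" "mat_adjoint U * U = 1\<^sub>m n"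
  using assms by (auto simp: unitaries_def)

lemma SUn_unitaries: "U \<in> SUn n \<Longrightarrow> U \<in> unitaries n"
  by (auto simp: unitaries_def SUn_def)

lemma unitaries_adjoint: "U \<in> unitaries n \<Longrightarrow> mat_adjoint U \<in> unitaries n"
  by (auto simp: unitaries_def)

lemma SUn_adjoint: "U \<in> SUn n \<Longrightarrow> mat_adjoint U \<in> SUn n"
  by (auto simp: SUn_def det_mat_adjoint)

lemma SUn_SLn: "U \<in> SUn n \<Longrightarrow> U \<in> SLn n"
  by (auto simp: SUn_def SLn_def)

lemma mult_inverse_mult:
  fixes U V U' V' :: "'a :: comm_ring_1 mat"
  assumes "U \<in> carrier_mat n n" "V \<in> carrier_mat n n" "V' \<in> carrier_mat n n" "U' \<in> carrier_mat n n"
    and "U * U' = 1\<^sub>m n" "V * V' = 1\<^sub>m n"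
  shows "(U * V) * (V' * U') = 1\<^sub>m n"
proof -
  have "(U * V) * (V' * U') = U * ((V * V') * U')"
    using assms(1-4) by (simp add: assoc_mult_mat[of _ n n _ n _ n])
  thus ?thesis using assms by simp
qed

lemma unitaries_mult: "U \<in> unitaries n \<Longrightarrow> V \<in> unitaries n \<Longrightarrow> U * V \<in> unitaries n"
  using mult_inverse_mult[of "mat_adjoint V" n "mat_adjoint U" U V]
  by (intro unitariesI) (auto simp: mat_adjoint_mult[of U n n V n] unitariesD)

lemma SUn_mult: "U \<in> SUn n \<Longrightarrow> V \<in> SUn n \<Longrightarrow> U * V \<in> SUn n"
  using unitaries_mult[of U n V] det_mult[of U n V] by (auto simp: SUn_def unitaries_def)

text \<open>The determinant has modulus one, so dividing by an n-th root of it lands in SU(n).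
  Conjugation is blind to the scalar (\<open>smult_unitary_conj\<close>), which lets arbitrary
  unitary matrices stand in for special ones.\<close>

lemma unitary_to_SU:
  assumes U: "U \<in> unitaries n" and n: "n > 0"
  obtains c where "cmod c = 1" "c \<cdot>\<^sub>m U \<in> SUn n"
proof -
  note unitariesD[OF U]
  have "det U * cnj (det U) = 1"
    using det_mult[of U n "mat_adjoint U"] \<open>U \<in> carrier_mat n n\<close> \<open>U * mat_adjoint U = 1\<^sub>m n\<close>
    by (simp add: det_mat_adjoint)
  hence "cmod (det U) = 1"
    by (metis complex_mod_sqrt_Re_mult_cnj one_complex.sel(1) real_sqrt_one)
  then obtain t where t: "det U = cis t"
    by (metis cis_Arg norm_zero sgn_eq zero_neq_one div_by_1 of_real_1)
  define c where "c = cis (- t / real n)"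
  have c: "cmod c = 1" by (simp add: c_def)
  have cn: "c ^ n = cis (- t)" using n by (simp add: c_def DeMoivre)
  have cc: "c * cnj c = 1" "cnj c * c = 1" by (simp_all add: c_def cis_cnj cis_mult)
  have adj: "mat_adjoint (c \<cdot>\<^sub>m U) = cnj c \<cdot>\<^sub>m mat_adjoint U"
    by (rule eq_matI) auto
  have "mat_adjoint (c \<cdot>\<^sub>m U) * (c \<cdot>\<^sub>m U) = (cnj c * c) \<cdot>\<^sub>m (mat_adjoint U * U)"
    unfolding adj using unitariesD(1)[OF U]
    by (intro eq_matI) (auto simp: scalar_prod_def sum_distrib_left ac_simps intro!: sum.cong)
  hence "c \<cdot>\<^sub>m U \<in> unitaries n"
    using unitariesD[OF U] cc by (intro unitariesI) (auto)
  moreover have "det (c \<cdot>\<^sub>m U) = 1"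
    using unitariesD(1)[OF U] by (simp add: det_smult cn t cis_mult)
  ultimately have "c \<cdot>\<^sub>m U \<in> SUn n" by (auto simp: SUn_def unitaries_def)
  thus thesis using c that by blast
qed

section \<open>Orthonormal families of functions on a finite set\<close>

definition ip :: "'k set \<Rightarrow> ('k \<Rightarrow> complex) \<Rightarrow> ('k \<Rightarrow> complex) \<Rightarrow> complex" where
  "ip K x y = (\<Sum>k\<in>K. x k * cnj (y k))"

definition orthonormal :: "'k set \<Rightarrow> nat \<Rightarrow> (nat \<Rightarrow> 'k \<Rightarrow> complex) \<Rightarrow> bool" where
  "orthonormal K m u \<longleftrightarrow> (\<forall>i<m. \<forall>j<m. ip K (u i) (u j) = (if i = j then 1 else 0))"

lemma ip_diff_left: "ip K (\<lambda>k. x k - y k) z = ip K x z - ip K y z"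
  by (simp add: ip_def algebra_simps sum_subtractf)

lemma ip_diff_right: "ip K z (\<lambda>k. x k - y k) = ip K z x - ip K z y"
  by (simp add: ip_def algebra_simps sum_subtractf)

lemma ip_scale_left: "ip K (\<lambda>k. c * x k) z = c * ip K x z"
  by (simp add: ip_def sum_distrib_left mult.assoc)

lemma ip_scale_right: "ip K z (\<lambda>k. c * x k) = cnj c * ip K z x"
  by (simp add: ip_def sum_distrib_left ac_simps)

lemma ip_sum_left: "ip K (\<lambda>k. \<Sum>i\<in>I. x i k) z = (\<Sum>i\<in>I. ip K (x i) z)"
  by (simp add: ip_def sum_distrib_right sum.swap[of _ K])

lemma ip_sum_right: "ip K z (\<lambda>k. \<Sum>i\<in>I. x i k) = (\<Sum>i\<in>I. ip K z (x i))"
  by (simp add: ip_def sum_distrib_left sum.swap[of _ K])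

lemma ip_commute: "ip K y x = cnj (ip K x y)"
  by (simp add: ip_def mult.commute)

lemma ip_self: "ip K x x = of_real (\<Sum>k\<in>K. (cmod (x k))\<^sup>2)"
  by (simp only: ip_def complex_norm_square of_real_sum)

lemma ip_self_eq_0: "finite K \<Longrightarrow> ip K x x = 0 \<longleftrightarrow> (\<forall>k\<in>K. x k = 0)"
  by (simp add: ip_self del: of_real_sum) (simp add: sum_nonneg_eq_0_iff)

lemma ip_cong: "(\<And>k. k \<in> K \<Longrightarrow> x k = x' k) \<Longrightarrow> (\<And>k. k \<in> K \<Longrightarrow> y k = y' k) \<Longrightarrow> ip K x y = ip K x' y'"
  by (simp add: ip_def)

lemma orthonormal_residual:
  assumes "orthonormal K m u" "i < m"
  shows "ip K (\<lambda>k. x k - (\<Sum>j<m. ip K x (u j) * u j k)) (u i) = 0"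
proof -
  have "ip K (\<lambda>k. \<Sum>j<m. ip K x (u j) * u j k) (u i) = (\<Sum>j<m. if j = i then ip K x (u i) else 0)"
    unfolding ip_sum_left ip_scale_left
    by (intro sum.cong refl) (use assms in \<open>auto simp: orthonormal_def\<close>)
  thus ?thesis using assms by (simp add: ip_diff_left)
qed

text \<open>Bessel's inequality for the indicator function of a point \<open>k\<close> bounds the
  sum over i of the squared moduli at \<open>k\<close> by one. Summing over \<open>k\<close> counts
  the members of the family.\<close>

lemma orthonormal_bound:
  assumes on: "orthonormal K m u" and K: "finite K"
  shows "m \<le> card K"
proof -
  have bessel: "(\<Sum>i<m. (cmod (u i k))\<^sup>2) \<le> 1" if k: "k \<in> K" for k
  proof -
    define e :: "'a \<Rightarrow> complex" where "e = (\<lambda>l. if l = k then 1 else 0)"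
    define y where "y = (\<lambda>l. e l - (\<Sum>j<m. ip K e (u j) * u j l))"
    have eu: "ip K e z = cnj (z k)" for z
    proof -
      have "ip K e z = (\<Sum>l\<in>K. if l = k then cnj (z l) else 0)"
        unfolding ip_def e_def by (intro sum.cong refl) auto
      thus ?thesis using K k by simp
    qed
    have "ip K y y = ip K y e - ip K y (\<lambda>l. \<Sum>j<m. ip K e (u j) * u j l)"
      by (subst (2) y_def) (rule ip_diff_right)
    also have "ip K y (\<lambda>l. \<Sum>j<m. ip K e (u j) * u j l) = 0"
      unfolding ip_sum_right ip_scale_right
      using orthonormal_residual[OF on, of _ e] by (simp add: y_def)
    also have "ip K y e = y k" using eu[of y] by (subst ip_commute) simp
    also have "y k = 1 - (\<Sum>j<m. u j k * cnj (u j k))"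
      unfolding y_def eu by (simp add: e_def mult.commute)
    finally have "ip K y y = of_real (1 - (\<Sum>i<m. (cmod (u i k))\<^sup>2))"
      by (simp add: complex_norm_square del: of_real_power)
    hence "1 - (\<Sum>i<m. (cmod (u i k))\<^sup>2) = (\<Sum>k\<in>K. (cmod (y k))\<^sup>2)"
      unfolding ip_self of_real_eq_iff ..
    also have "\<dots> \<ge> 0" by (intro sum_nonneg) auto
    finally show ?thesis by simp
  qed
  have "(\<Sum>k\<in>K. (cmod (u i k))\<^sup>2) = 1" if "i < m" for i
  proof -
    have "ip K (u i) (u i) = of_real 1" using on that by (simp add: orthonormal_def)
    thus ?thesis unfolding ip_self of_real_eq_iff .
  qed
  hence "real m = (\<Sum>i<m. \<Sum>k\<in>K. (cmod (u i k))\<^sup>2)" by simp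
  also have "\<dots> = (\<Sum>k\<in>K. \<Sum>i<m. (cmod (u i k))\<^sup>2)" by (rule sum.swap)
  also have "\<dots> \<le> (\<Sum>k\<in>K. 1)" by (intro sum_mono bessel)
  finally show ?thesis by simp
qed

text \<open>A family of maximal length exists by \<open>orthonormal_bound\<close>; a nonzero
  residual of some element of \<open>S\<close>, once normalised, would lengthen it. With
  \<open>r = 0\<close> this yields a basis of a given space, with \<open>r = 1\<close> a basis with
  prescribed first vector. Functions are compared on \<open>K\<close> only.\<close>

lemma orthonormal_basis_extend:
  assumes K: "finite K" and on: "orthonormal K r u" and uS: "\<And>i. i < r \<Longrightarrow> u i \<in> S"
    and S: "\<And>x y c. x \<in> S \<Longrightarrow> y \<in> S \<Longrightarrow> (\<lambda>k. x k + c * y k) \<in> S"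
  obtains m v where "r \<le> m" "orthonormal K m v" "\<And>i. i < r \<Longrightarrow> v i = u i" "\<And>i. i < m \<Longrightarrow> v i \<in> S"
    "\<And>x k. x \<in> S \<Longrightarrow> k \<in> K \<Longrightarrow> x k = (\<Sum>i<m. ip K x (v i) * v i k)"
proof -
  define P where "P m \<longleftrightarrow> r \<le> m \<and> (\<exists>v. orthonormal K m v \<and> (\<forall>i<r. v i = u i) \<and> (\<forall>i<m. v i \<in> S))" for m
  have P0: "P r" unfolding P_def using on uS by blast
  have bd: "m \<le> card K" if "P m" for m
    using that K orthonormal_bound unfolding P_def by blast
  define m where "m = (GREATEST m. P m)"
  have Pm: "P m" unfolding m_def by (rule GreatestI_nat[of P r "card K"]) (use P0 bd in auto)
  have mx: "\<not> P (Suc m)"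
    using Greatest_le_nat[of P "Suc m" "card K"] bd unfolding m_def by fastforce
  obtain v where v: "orthonormal K m v" "\<forall>i<r. v i = u i" "\<forall>i<m. v i \<in> S" and rm: "r \<le> m"
    using Pm unfolding P_def by blast
  have "x k = (\<Sum>i<m. ip K x (v i) * v i k)" if x: "x \<in> S" and k: "k \<in> K" for x k
  proof -
    define y where "y = (\<lambda>k. x k - (\<Sum>j<m. ip K x (v j) * v j k))"
    have yS: "(\<lambda>k. x k - (\<Sum>j<l. ip K x (v j) * v j k)) \<in> S" if "l \<le> m" for l
      using that
    proof (induction l)
      case 0
      show ?case using x by simp
    next
      case (Suc l)
      from S[OF Suc.IH, of "v l" "- ip K x (v l)"] Suc.prems v(3) show ?case
        by (simp add: algebra_simps)
    qed
    have yv: "ip K y (v i) = 0" if "i < m" for i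
      unfolding y_def by (rule orthonormal_residual[OF v(1) that])
    have "ip K y y = 0"
    proof (rule ccontr)
      assume nz: "ip K y y \<noteq> 0"
      define s where "s = (\<Sum>k\<in>K. (cmod (y k))\<^sup>2)"
      have s: "ip K y y = of_real s" by (simp only: s_def ip_self)
      have "s \<ge> 0" unfolding s_def by (intro sum_nonneg) auto
      with nz s have sp: "s > 0" by (cases "s = 0") auto
      define z where "z = (\<lambda>k. of_real (1 / sqrt s) * y k)"
      have zz: "ip K z z = 1"
      proof -
        have "ip K z z = of_real (1 / sqrt s) * (cnj (of_real (1 / sqrt s)) * of_real s)"
          unfolding z_def ip_scale_left ip_scale_right s ..
        also have "\<dots> = of_real (1 / sqrt s * (1 / sqrt s * s))"
          by (simp only: complex_cnj_complex_of_real of_real_mult)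
        also have "1 / sqrt s * (1 / sqrt s * s) = 1" using sp by (simp add: field_simps)
        finally show ?thesis by simp
      qed
      have zv: "ip K z (v i) = 0" "ip K (v i) z = 0" if "i < m" for i
      proof -
        show a: "ip K z (v i) = 0" unfolding z_def ip_scale_left using yv[OF that] by simp
        show "ip K (v i) z = 0" using a by (subst ip_commute) simp
      qed
      \<comment> \<open>Closure of \<open>S\<close> is available only for \<open>x + c * y\<close>,
        so the multiple of \<open>y\<close> by 1 / sqrt s is written as \<open>y\<close> plus (1 /
        sqrt s - 1) times \<open>y\<close>.\<close>
      have zS: "z \<in> S"
        using S[of y y "of_real (1 / sqrt s) - 1"] yS[OF order.refl]
        unfolding z_def y_def[symmetric] by (simp add: algebra_simps)
      have "orthonormal K (Suc m) (v(m := z))"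
        using v(1) zz zv by (auto simp: orthonormal_def less_Suc_eq)
      hence "P (Suc m)" unfolding P_def using v zS rm
        by (intro conjI exI[of _ "v(m := z)"]) (auto simp: less_Suc_eq)
      thus False using mx by simp
    qed
    hence "y k = 0" using K k by (simp add: ip_self_eq_0)
    thus ?thesis by (simp add: y_def)
  qed
  thus thesis using that[of m v] v rm by blast
qed

section \<open>Spectral theorem for Hermitian matrices\<close>

text \<open>The unit vector is completed to an orthonormal basis of all functions on the index set,
  and the basis vectors become the columns.\<close>

lemma unitary_first_column:
  assumes w: "(\<Sum>a<n. (cmod (w a))\<^sup>2) = 1"
  obtains U where "U \<in> unitaries n" "\<And>a. a < n \<Longrightarrow> U $$ (a, 0) = w a"
proof -
  have n: "n > 0" using w by (cases n) auto
  have "orthonormal {..<n} 1 (\<lambda>_. w)"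
    unfolding orthonormal_def ip_self w by simp
  then obtain m v where v: "1 \<le> m" "orthonormal {..<n} m v" "\<And>i. i < 1 \<Longrightarrow> v i = w"
    "\<And>x k. k \<in> {..<n} \<Longrightarrow> x k = (\<Sum>i<m. ip {..<n} x (v i) * v i k)"
    using orthonormal_basis_extend[of "{..<n}" 1 "\<lambda>_. w" UNIV] by (auto simp del: less_one)
  have complete: "(\<Sum>i<m. v i a * cnj (v i b)) = (if a = b then 1 else 0)" if "a < n" "b < n" for a b
  proof -
    have "ip {..<n} (\<lambda>l. if l = b then 1 else 0) z = cnj (z b)" for z
    proof -
      have "ip {..<n} (\<lambda>l. if l = b then 1 else 0) z = (\<Sum>l<n. if l = b then cnj (z l) else 0)"
        unfolding ip_def by (intro sum.cong refl) auto
      thus ?thesis using that by simp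
    qed
    with v(4)[of a "\<lambda>l. if l = b then 1 else 0"] that show ?thesis by (simp add: mult.commute)
  qed
  \<comment> \<open>The trace of the completeness relation, summed in both orders, shows that the
    basis has exactly \<open>n\<close> members.\<close>
  have "of_nat n = (\<Sum>a<n. \<Sum>i<m. v i a * cnj (v i a))"
    using complete by simp
  also have "\<dots> = (\<Sum>i<m. ip {..<n} (v i) (v i))" unfolding ip_def by (rule sum.swap)
  also have "\<dots> = of_nat m" using v(2) by (simp add: orthonormal_def)
  finally have mn: "m = n" by simp
  define U where "U = mat n n (\<lambda>(a, i). v i a)"
  have "mat_adjoint U * U = 1\<^sub>m n"
  proof (rule eq_matI)
    fix i j assume ij: "i < dim_row (1\<^sub>m n)" "j < dim_col (1\<^sub>m n)"
    hence "(mat_adjoint U * U) $$ (i, j) = (\<Sum>a<n. cnj (v i a) * v j a)"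
      by (simp add: scalar_prod_def U_def atLeast0LessThan)
    also have "\<dots> = ip {..<n} (v j) (v i)" by (simp add: ip_def mult.commute)
    also have "\<dots> = (if j = i then 1 else 0)"
      using v(2) ij mn by (simp add: orthonormal_def)
    finally show "(mat_adjoint U * U) $$ (i, j) = 1\<^sub>m n $$ (i, j)" using ij by simp
  qed (auto simp: U_def)
  hence "U \<in> unitaries n" by (intro unitariesI) (auto simp: U_def)
  moreover have "U $$ (a, 0) = w a" if "a < n" for a
    using that n v(3)[of 0] by (simp add: U_def)
  ultimately show thesis using that by blast
qed

definition diag_of :: "nat \<Rightarrow> (nat \<Rightarrow> complex) \<Rightarrow> complex mat" where
  "diag_of n a = mat n n (\<lambda>(i, j). if i = j then a i else 0)"

lemma diag_of_carrier [simp]: "diag_of n a \<in> carrier_mat n n"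
  by (simp add: diag_of_def)

lemma diag_of_dims [simp]: "dim_row (diag_of n a) = n" "dim_col (diag_of n a) = n"
  by (simp_all add: diag_of_def)

lemma diag_of_index [simp]: "i < n \<Longrightarrow> j < n \<Longrightarrow> diag_of n a $$ (i, j) = (if i = j then a i else 0)"
  by (simp add: diag_of_def)

lemma mult_block_diag:
  fixes P Q X Y :: "'a :: comm_ring_1 mat"
  assumes "P \<in> carrier_mat a a" "Q \<in> carrier_mat a a" "X \<in> carrier_mat b b" "Y \<in> carrier_mat b b"
  shows "four_block_mat P (0\<^sub>m a b) (0\<^sub>m b a) X * four_block_mat Q (0\<^sub>m a b) (0\<^sub>m b a) Y =
    four_block_mat (P * Q) (0\<^sub>m a b) (0\<^sub>m b a) (X * Y)"
  using mult_four_block_mat[OF assms(1) zero_carrier_mat zero_carrier_mat assms(3)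
      assms(2) zero_carrier_mat zero_carrier_mat assms(4), of] assms
  by simp

text \<open>Induction on the size. A unitary matrix whose first column is a unit eigenvector clears
  the first column of the conjugate, Hermitian symmetry clears the first row, and the remaining
  block is again Hermitian.\<close>

lemma spectral_exists:
  assumes "A \<in> Her n"
  shows "\<exists>U a. U \<in> unitaries n \<and> mat_adjoint U * A * U = diag_of n a"
  using assms
proof (induction n arbitrary: A)
  case 0
  show ?case
    by (intro exI[of _ "1\<^sub>m 0"] exI[of _ "\<lambda>_. 0"]) (use 0 in \<open>auto simp: unitaries_def Her_def\<close>)
next
  case (Suc n)
  have A: "A \<in> carrier_mat (Suc n) (Suc n)" and herm: "mat_adjoint A = A"
    using Suc.prems by (auto simp: Her_def)
  obtain e where "eigenvalue A e"
    using spectrum_non_empty[OF A] by (auto simp: spectrum_def)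
  then obtain v where v: "v \<in> carrier_vec (Suc n)" "v \<noteq> 0\<^sub>v (Suc n)" "A *\<^sub>v v = e \<cdot>\<^sub>v v"
    using A by (auto simp: eigenvalue_def eigenvector_def)
  define s where "s = (\<Sum>a<Suc n. (cmod (v $ a))\<^sup>2)"
  have "s \<noteq> 0"
  proof
    assume "s = 0"
    hence "\<forall>a\<in>{..<Suc n}. (cmod (v $ a))\<^sup>2 = 0"
      unfolding s_def by (subst (asm) sum_nonneg_eq_0_iff) auto
    hence "v = 0\<^sub>v (Suc n)" using v(1) by (intro eq_vecI) auto
    thus False using v by simp
  qed
  moreover have "s \<ge> 0" unfolding s_def by (intro sum_nonneg) auto
  ultimately have s: "s > 0" by simp
  define w where "w = (\<lambda>a. of_real (1 / sqrt s) * v $ a)"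
  have "(\<Sum>a<Suc n. (cmod (w a))\<^sup>2) = (\<Sum>a<Suc n. (cmod (v $ a))\<^sup>2 / s)"
    unfolding w_def using s
    by (intro sum.cong refl) (simp add: norm_mult power_mult_distrib norm_divide power_divide)
  also have "\<dots> = 1" using s unfolding sum_divide_distrib[symmetric] s_def by simp
  finally obtain U where U: "U \<in> unitaries (Suc n)" and Uw: "\<And>a. a < Suc n \<Longrightarrow> U $$ (a, 0) = w a"
    using unitary_first_column by blast
  note Uc = unitariesD(1)[OF U]
  define B where "B = mat_adjoint U * A * U"
  have Bc: "B \<in> carrier_mat (Suc n) (Suc n)" using A Uc by (simp add: B_def)
  have Bherm: "mat_adjoint B = B"
  proof -
    have "mat_adjoint B = mat_adjoint U * (mat_adjoint A * mat_adjoint (mat_adjoint U))"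
      unfolding B_def using A Uc
      by (simp add: mat_adjoint_mult[of _ "Suc n" "Suc n" _ "Suc n"])
    thus ?thesis using A Uc herm unfolding B_def
      by (simp add: assoc_mult_mat[of _ "Suc n" "Suc n" _ "Suc n" _ "Suc n"])
  qed
  have colAU: "(A * U) $$ (b, 0) = e * U $$ (b, 0)" if "b < Suc n" for b
  proof -
    have "(A * U) $$ (b, 0) = (\<Sum>a<Suc n. A $$ (b, a) * w a)"
      using that A Uc Uw by (simp add: scalar_prod_def atLeast0LessThan)
    also have "\<dots> = of_real (1 / sqrt s) * (A *\<^sub>v v) $ b"
      using that A v(1)
      by (simp add: scalar_prod_def atLeast0LessThan w_def sum_distrib_left mult_ac
          del: sum.lessThan_Suc of_real_divide)
    also have "\<dots> = e * U $$ (b, 0)" using that Uw v by (simp add: w_def)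
    finally show ?thesis .
  qed
  have Bcol: "B $$ (i, 0) = (if i = 0 then e else 0)" if i: "i < Suc n" for i
  proof -
    have "B = mat_adjoint U * (A * U)"
      unfolding B_def using A Uc by (simp add: assoc_mult_mat[of _ "Suc n" "Suc n" _ "Suc n" _ "Suc n"])
    hence "B $$ (i, 0) = (\<Sum>b<Suc n. mat_adjoint U $$ (i, b) * (A * U) $$ (b, 0))"
      using i A Uc by (simp add: scalar_prod_def atLeast0LessThan)
    also have "\<dots> = (\<Sum>b<Suc n. e * (mat_adjoint U $$ (i, b) * U $$ (b, 0)))"
      by (rule sum.cong) (simp_all only: colAU lessThan_iff mult_ac)
    also have "\<dots> = e * (mat_adjoint U * U) $$ (i, 0)"
      using i Uc by (simp add: scalar_prod_def atLeast0LessThan sum_distrib_left del: sum.lessThan_Suc)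
    also have "\<dots> = (if i = 0 then e else 0)" using unitariesD(3)[OF U] i by simp
    finally show ?thesis .
  qed
  have Brow: "B $$ (0, j) = (if j = 0 then cnj e else 0)" if "j < Suc n" for j
  proof -
    have "B $$ (0, j) = mat_adjoint B $$ (0, j)" using Bherm by simp
    also have "\<dots> = cnj (B $$ (j, 0))" using Bc that by simp
    finally show ?thesis using Bcol[OF that] by simp
  qed
  have "cnj e = e" using Bcol[of 0] Brow[of 0] by simp
  define E where "E = mat 1 1 (\<lambda>_. e)"
  define B' where "B' = mat n n (\<lambda>(i, j). B $$ (Suc i, Suc j))"
  have Beq: "B = four_block_mat E (0\<^sub>m 1 n) (0\<^sub>m n 1) B'"
    by (rule eq_matI) (use Bc Bcol Brow \<open>cnj e = e\<close> in \<open>auto simp: E_def B'_def\<close>)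
  have B'H: "B' \<in> Her n"
  proof -
    have "mat_adjoint B' = B'"
    proof (rule eq_matI)
      fix i j assume "i < dim_row B'" "j < dim_col B'"
      hence ij: "i < n" "j < n" by (auto simp: B'_def)
      have "mat_adjoint B' $$ (i, j) = mat_adjoint B $$ (Suc i, Suc j)"
        using ij Bc by (simp add: B'_def)
      thus "mat_adjoint B' $$ (i, j) = B' $$ (i, j)" using ij Bherm by (simp add: B'_def)
    qed (auto simp: B'_def)
    thus ?thesis by (simp add: Her_def B'_def)
  qed
  from Suc.IH[OF this] obtain U' a where U': "U' \<in> unitaries n" and a: "mat_adjoint U' * B' * U' = diag_of n a"
    by blast
  note U'c = unitariesD(1)[OF U']
  have B'c: "B' \<in> carrier_mat n n" by (simp add: B'_def)
  define V where "V = four_block_mat (1\<^sub>m 1) (0\<^sub>m 1 n) (0\<^sub>m n 1) U'"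
  have Vc: "V \<in> carrier_mat (Suc n) (Suc n)"
    using U'c four_block_carrier_mat[of "1\<^sub>m 1" 1 1 U' n n] by (simp add: V_def)
  have adj0: "mat_adjoint (0\<^sub>m p q) = (0\<^sub>m q p :: complex mat)" for p q
    by (rule eq_matI) auto
  have adjV: "mat_adjoint V = four_block_mat (1\<^sub>m 1) (0\<^sub>m 1 n) (0\<^sub>m n 1) (mat_adjoint U')"
    unfolding V_def using U'c by (subst mat_adjoint_four_block[where a = 1 and d = n]) (auto simp: adj0)
  have Ec: "E \<in> carrier_mat 1 1" by (simp add: E_def)
  have "mat_adjoint V * V = four_block_mat (1\<^sub>m 1) (0\<^sub>m 1 n) (0\<^sub>m n 1) (mat_adjoint U' * U')"
    unfolding adjV unfolding V_def
    using U'c by (subst mult_block_diag) auto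
  also have "\<dots> = 1\<^sub>m (Suc n)" using unitariesD(3)[OF U'] by (intro eq_matI) auto
  finally have VU: "V \<in> unitaries (Suc n)" using Vc by (intro unitariesI) auto
  have "mat_adjoint V * B = four_block_mat E (0\<^sub>m 1 n) (0\<^sub>m n 1) (mat_adjoint U' * B')"
    unfolding adjV Beq
    using U'c Ec B'c by (subst mult_block_diag) auto
  moreover have "four_block_mat E (0\<^sub>m 1 n) (0\<^sub>m n 1) (mat_adjoint U' * B') * V =
    four_block_mat E (0\<^sub>m 1 n) (0\<^sub>m n 1) (mat_adjoint U' * B' * U')"
    unfolding V_def using U'c Ec B'c by (subst mult_block_diag) auto
  ultimately have "mat_adjoint V * B * V = four_block_mat E (0\<^sub>m 1 n) (0\<^sub>m n 1) (mat_adjoint U' * B' * U')" by simp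
  also have "\<dots> = diag_of (Suc n) (case_nat e a)"
    unfolding a by (rule eq_matI) (auto simp: E_def split: nat.splits)
  finally have VBV: "mat_adjoint V * B * V = diag_of (Suc n) (case_nat e a)" .
  have "mat_adjoint (U * V) * A * (U * V) = mat_adjoint V * B * V"
    unfolding B_def using Uc Vc A
    by (simp add: mat_adjoint_mult[of U "Suc n" "Suc n" V "Suc n"]
        assoc_mult_mat[of _ "Suc n" "Suc n" _ "Suc n" _ "Suc n"])
  thus ?case using VBV unitaries_mult[OF U VU] by metis
qed

lemma unitary_conj_cancel:
  assumes "U \<in> unitaries n" "A \<in> carrier_mat n n"
  shows "U * (mat_adjoint U * A * U) * mat_adjoint U = A"
proof -
  note U = unitariesD[OF assms(1)]
  have "U * (mat_adjoint U * A * U) * mat_adjoint U = (U * mat_adjoint U) * (A * (U * mat_adjoint U))"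
    using U(1) assms(2) by (simp add: assoc_mult_mat[of _ n n _ n _ n])
  thus ?thesis using U assms by simp
qed

lemma smult_unitary_conj:
  assumes c: "cmod c = 1" and U: "U \<in> carrier_mat n n" and A: "A \<in> carrier_mat n n"
  shows "mat_adjoint (c \<cdot>\<^sub>m U) * A * (c \<cdot>\<^sub>m U) = mat_adjoint U * A * U"
proof -
  have cc: "cnj c * c = 1" using c complex_norm_square[of c] by (simp add: mult.commute)
  have "mat_adjoint (c \<cdot>\<^sub>m U) = cnj c \<cdot>\<^sub>m mat_adjoint U" by (rule eq_matI) auto
  hence "mat_adjoint (c \<cdot>\<^sub>m U) * A * (c \<cdot>\<^sub>m U) = (cnj c * c) \<cdot>\<^sub>m (mat_adjoint U * A * U)"
    using U A
    by (simp add: mult_smult_assoc_mat[of _ n n _ n] mult_smult_distrib[of _ n n _ n])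
       (intro eq_matI; auto simp: mult_ac)
  thus ?thesis using cc by (auto intro!: eq_matI)
qed

theorem Hermitian_diagonalization:
  assumes A: "A \<in> Her n" and n: "n > 0"
  obtains U a where "U \<in> SUn n" "A = U * diag_of n (\<lambda>i. complex_of_real (a i)) * mat_adjoint U"
proof -
  have Ac: "A \<in> carrier_mat n n" "mat_adjoint A = A" using A by (auto simp: Her_def)
  obtain U a where U: "U \<in> unitaries n" and D: "mat_adjoint U * A * U = diag_of n a"
    using spectral_exists[OF A] by blast
  obtain c where c: "cmod c = 1" "c \<cdot>\<^sub>m U \<in> SUn n" using unitary_to_SU[OF U n] by blast
  note Uc = unitariesD(1)[OF U]
  define V where "V = c \<cdot>\<^sub>m U"
  have Vc: "V \<in> carrier_mat n n" using Uc by (simp add: V_def)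
  have VD: "mat_adjoint V * A * V = diag_of n a"
    using smult_unitary_conj[OF c(1) Uc Ac(1)] D unfolding V_def by simp
  have "mat_adjoint (diag_of n a) = diag_of n a"
    unfolding VD[symmetric] using Vc Ac
    by (simp add: mat_adjoint_mult[of _ n n _ n] assoc_mult_mat[of _ n n _ n _ n])
  hence "cnj (a i) = a i" if "i < n" for i
    using that mat_adjoint_index[of i "diag_of n a" i] by simp
  hence re: "complex_of_real (Re (a i)) = a i" if "i < n" for i
    using that by (metis complex_cnj_cancel_iff Reals_cnj_iff of_real_Re)
  have "A = V * diag_of n (\<lambda>i. complex_of_real (Re (a i))) * mat_adjoint V"
  proof -
    have "diag_of n (\<lambda>i. complex_of_real (Re (a i))) = diag_of n a"
      by (rule eq_matI) (use re in auto)
    thus ?thesis using unitary_conj_cancel[OF SUn_unitaries[OF c(2)] Ac(1)] VD unfolding V_def by simp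
  qed
  thus thesis using c(2) that[of V "\<lambda>i. Re (a i)"] unfolding V_def by blast
qed

section \<open>The Krylov covariant and its behaviour under conjugation\<close>

abbreviation Perms :: "nat \<Rightarrow> (nat \<Rightarrow> nat) set" where
  "Perms N \<equiv> {p. p permutes {..<N}}"

definition index_fun :: "nat \<Rightarrow> nat \<Rightarrow> (nat \<Rightarrow> nat) set" where
  "index_fun N n = {..<N} \<rightarrow>\<^sub>E {..<n}"

text \<open>The coordinates of the covariant that sends \<open>A\<close> to the form
  \<open>w \<mapsto> w \<and> A w \<and> \<dots> \<and> A\<^bsup>N-1\<^esup> w\<close>: antisymmetric in \<open>\<tau>\<close> (the exterior part), symmetric in \<open>\<kappa>\<close>
  (the polarised form in \<open>w\<close>).\<close>
definition krylov :: "nat \<Rightarrow> complex mat \<Rightarrow> (nat \<Rightarrow> nat) \<times> (nat \<Rightarrow> nat) \<Rightarrow> complex" where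
  "krylov N A = (\<lambda>(\<tau>, \<kappa>). \<Sum>\<pi>\<in>Perms N. \<Sum>\<sigma>\<in>Perms N.
     of_int (sign \<pi>) * (\<Prod>j<N. (A ^\<^sub>m j) $$ (\<tau> (\<pi> j), \<kappa> (\<sigma> j))))"

text \<open>Matrix entry of the N-th tensor power of \<open>h\<close> tensored with the N-th tensor
  power of the transpose of \<open>g\<close>. With \<open>h\<close> the inverse of \<open>g\<close>
  it describes how conjugation acts on the coordinates.\<close>

definition tensor_act ::
  "nat \<Rightarrow> complex mat \<Rightarrow> complex mat \<Rightarrow> (nat \<Rightarrow> nat) \<times> (nat \<Rightarrow> nat) \<Rightarrow> (nat \<Rightarrow> nat) \<times> (nat \<Rightarrow> nat) \<Rightarrow> complex" where
  "tensor_act N g h = (\<lambda>(\<tau>, \<kappa>) (\<tau>', \<kappa>'). \<Prod>i<N. h $$ (\<tau> i, \<tau>' i) * g $$ (\<kappa>' i, \<kappa> i))"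

lemma finite_index_fun [simp]: "finite (index_fun N n)"
  by (simp add: index_fun_def finite_PiE)

lemma finite_Perms [simp]: "finite (Perms N)"
  by (simp add: finite_permutations)

lemma index_fun_less: "\<tau> \<in> index_fun N n \<Longrightarrow> i < N \<Longrightarrow> \<tau> i < n"
  by (auto simp: index_fun_def)

lemma Perms_less: "\<pi> \<in> Perms N \<Longrightarrow> i < N \<Longrightarrow> \<pi> i < N"
  using permutes_in_image[of \<pi> "{..<N}" i] by auto

lemma index_fun_comp:
  assumes "\<tau> \<in> index_fun N n" "\<pi> \<in> Perms N"
  shows "\<tau> \<circ> \<pi> \<in> index_fun N n"
  using assms Perms_less[OF assms(2)] permutes_not_in[of \<pi> "{..<N}"]
  by (fastforce simp: index_fun_def PiE_def extensional_def)

lemma bij_betw_index_fun_comp: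
  assumes p: "\<pi> \<in> Perms N"
  shows "bij_betw (\<lambda>\<tau>. \<tau> \<circ> \<pi>) (index_fun N n) (index_fun N n)"
proof (rule bij_betwI[where g = "\<lambda>\<tau>. \<tau> \<circ> inv_into UNIV \<pi>"])
  have i: "inv_into UNIV \<pi> \<in> Perms N" using p by (simp add: permutes_inv)
  show "(\<lambda>\<tau>. \<tau> \<circ> \<pi>) \<in> index_fun N n \<rightarrow> index_fun N n" using index_fun_comp p by blast
  show "(\<lambda>\<tau>. \<tau> \<circ> inv_into UNIV \<pi>) \<in> index_fun N n \<rightarrow> index_fun N n" using index_fun_comp i by blast
  show "\<tau> \<circ> \<pi> \<circ> inv_into UNIV \<pi> = \<tau>" for \<tau> :: "nat \<Rightarrow> nat"
    using p permutes_inv_o(1)[of \<pi> "{..<N}"] by (simp add: comp_assoc)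
  show "\<tau> \<circ> inv_into UNIV \<pi> \<circ> \<pi> = \<tau>" for \<tau> :: "nat \<Rightarrow> nat"
    using p permutes_inv_o(2)[of \<pi> "{..<N}"] by (simp add: comp_assoc)
qed

lemma index_fun_eqI:
  assumes "\<tau> \<in> index_fun N n" "\<kappa> \<in> index_fun N n" "\<And>i. i < N \<Longrightarrow> \<tau> i = \<kappa> i"
  shows "\<tau> = \<kappa>"
  using assms unfolding index_fun_def by (intro PiE_ext) auto

lemma pow_conj:
  fixes A g h :: "'a :: field mat"
  assumes A: "A \<in> carrier_mat n n" and g: "g \<in> carrier_mat n n" and h: "h \<in> carrier_mat n n"
    and gh: "g * h = 1\<^sub>m n"
  shows "(h * A * g) ^\<^sub>m j = h * A ^\<^sub>m j * g"
proof (induction j)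
  case 0
  have "h * g = 1\<^sub>m n" using mat_mult_left_right_inverse[OF g h gh] .
  thus ?case using A g h by simp
next
  case (Suc j)
  have "(h * A ^\<^sub>m j * g) * (h * A * g) = h * (A ^\<^sub>m j * ((g * h) * (A * g)))"
    using A g h by (simp add: assoc_mult_mat[of _ n n _ n _ n])
  also have "\<dots> = h * A ^\<^sub>m Suc j * g"
    using A g h gh by (simp add: assoc_mult_mat[of _ n n _ n _ n])
  finally show ?case using Suc by simp
qed

lemma triple_product_index:
  assumes "A \<in> carrier_mat n n" "g \<in> carrier_mat n n" "h \<in> carrier_mat n n" "x < n" "y < n"
  shows "(h * A * g) $$ (x, y) = (\<Sum>a<n. \<Sum>b<n. h $$ (x, a) * A $$ (a, b) * g $$ (b, y))"
  using assms by (simp add: scalar_prod_def atLeast0LessThan sum_distrib_left mult.assoc)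

lemma prod_double_sum:
  fixes Y :: "nat \<Rightarrow> nat \<Rightarrow> nat \<Rightarrow> 'a :: comm_semiring_1"
  shows "(\<Prod>j<N. \<Sum>a<n. \<Sum>b<n. Y j a b) = (\<Sum>\<alpha>\<in>index_fun N n. \<Sum>\<beta>\<in>index_fun N n. \<Prod>j<N. Y j (\<alpha> j) (\<beta> j))"
proof -
  have "(\<Prod>j<N. \<Sum>a<n. \<Sum>b<n. Y j a b) = (\<Sum>\<alpha>\<in>index_fun N n. \<Prod>j<N. \<Sum>b<n. Y j (\<alpha> j) b)"
    unfolding index_fun_def by (rule prod_sum_PiE) auto
  also have "\<dots> = (\<Sum>\<alpha>\<in>index_fun N n. \<Sum>\<beta>\<in>index_fun N n. \<Prod>j<N. Y j (\<alpha> j) (\<beta> j))"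
    unfolding index_fun_def by (intro sum.cong refl prod_sum_PiE) auto
  finally show ?thesis .
qed

text \<open>Powers of the conjugate are conjugates of powers, so each factor is a double sum, and
  the product over \<open>j\<close> expands into a sum over two index functions. Writing these as
  \<tau>' composed with \<pi> and \<kappa>' composed with \<sigma> makes the coefficient independent
  of \<pi> and \<sigma>, and it can leave both permutation sums.\<close>

lemma krylov_conj:
  assumes A: "A \<in> carrier_mat n n" and g: "g \<in> carrier_mat n n" and h: "h \<in> carrier_mat n n"
    and gh: "g * h = 1\<^sub>m n" and x: "x \<in> index_fun N n \<times> index_fun N n"
  shows "krylov N (h * A * g) x =
    (\<Sum>y\<in>index_fun N n \<times> index_fun N n. tensor_act N g h x y * krylov N A y)"
proof -
  obtain \<tau> \<kappa> where xe: "x = (\<tau>, \<kappa>)" and t: "\<tau> \<in> index_fun N n" "\<kappa> \<in> index_fun N n" using x by auto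
  let ?F = "index_fun N n"
  define G where "G \<pi> \<sigma> \<tau>' \<kappa>' = of_int (sign \<pi>) * (tensor_act N g h (\<tau>, \<kappa>) (\<tau>', \<kappa>') *
    (\<Prod>j<N. (A ^\<^sub>m j) $$ (\<tau>' (\<pi> j), \<kappa>' (\<sigma> j))))" for \<pi> \<sigma> \<tau>' \<kappa>'
  have step: "of_int (sign \<pi>) * (\<Prod>j<N. ((h * A * g) ^\<^sub>m j) $$ (\<tau> (\<pi> j), \<kappa> (\<sigma> j))) =
      (\<Sum>\<tau>'\<in>?F. \<Sum>\<kappa>'\<in>?F. G \<pi> \<sigma> \<tau>' \<kappa>')" if p: "\<pi> \<in> Perms N" and s: "\<sigma> \<in> Perms N" for \<pi> \<sigma>
  proof -
    define Y where "Y j a b = h $$ (\<tau> (\<pi> j), a) * (A ^\<^sub>m j) $$ (a, b) * g $$ (b, \<kappa> (\<sigma> j))" for j a b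
    have "(\<Prod>j<N. ((h * A * g) ^\<^sub>m j) $$ (\<tau> (\<pi> j), \<kappa> (\<sigma> j))) = (\<Prod>j<N. \<Sum>a<n. \<Sum>b<n. Y j a b)"
    proof (rule prod.cong[OF refl])
      fix j assume "j \<in> {..<N}"
      hence "\<tau> (\<pi> j) < n" "\<kappa> (\<sigma> j) < n"
        using Perms_less[OF p] Perms_less[OF s] index_fun_less[OF t(1)] index_fun_less[OF t(2)] by auto
      thus "((h * A * g) ^\<^sub>m j) $$ (\<tau> (\<pi> j), \<kappa> (\<sigma> j)) = (\<Sum>a<n. \<Sum>b<n. Y j a b)"
        unfolding pow_conj[OF A g h gh] Y_def
        by (intro triple_product_index) (use A g h in auto)
    qed
    also have "\<dots> = (\<Sum>\<alpha>\<in>?F. \<Sum>\<beta>\<in>?F. \<Prod>j<N. Y j (\<alpha> j) (\<beta> j))" by (rule prod_double_sum)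
    also have "\<dots> = (\<Sum>\<tau>'\<in>?F. \<Sum>\<beta>\<in>?F. \<Prod>j<N. Y j ((\<tau>' \<circ> \<pi>) j) (\<beta> j))"
      by (rule sum.reindex_bij_betw[OF bij_betw_index_fun_comp[OF p], symmetric])
    also have "\<dots> = (\<Sum>\<tau>'\<in>?F. \<Sum>\<kappa>'\<in>?F. \<Prod>j<N. Y j ((\<tau>' \<circ> \<pi>) j) ((\<kappa>' \<circ> \<sigma>) j))"
      by (intro sum.cong refl sum.reindex_bij_betw[OF bij_betw_index_fun_comp[OF s], symmetric])
    finally have 1: "(\<Prod>j<N. ((h * A * g) ^\<^sub>m j) $$ (\<tau> (\<pi> j), \<kappa> (\<sigma> j))) = \<dots>" .
    have 2: "(\<Prod>j<N. Y j ((\<tau>' \<circ> \<pi>) j) ((\<kappa>' \<circ> \<sigma>) j)) =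
      tensor_act N g h (\<tau>, \<kappa>) (\<tau>', \<kappa>') * (\<Prod>j<N. (A ^\<^sub>m j) $$ (\<tau>' (\<pi> j), \<kappa>' (\<sigma> j)))" for \<tau>' \<kappa>'
    proof -
      have a: "(\<Prod>i<N. h $$ (\<tau> i, \<tau>' i)) = (\<Prod>j<N. h $$ (\<tau> (\<pi> j), \<tau>' (\<pi> j)))"
        using prod.permute[of \<pi> "{..<N}" "\<lambda>i. h $$ (\<tau> i, \<tau>' i)"] p by simp
      have b: "(\<Prod>i<N. g $$ (\<kappa>' i, \<kappa> i)) = (\<Prod>j<N. g $$ (\<kappa>' (\<sigma> j), \<kappa> (\<sigma> j)))"
        using prod.permute[of \<sigma> "{..<N}" "\<lambda>i. g $$ (\<kappa>' i, \<kappa> i)"] s by simp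
      show ?thesis unfolding tensor_act_def Y_def split prod.distrib a b by (simp add: mult_ac)
    qed
    show ?thesis unfolding 1 2 G_def by (simp add: sum_distrib_left)
  qed
  have "krylov N (h * A * g) x = (\<Sum>\<pi>\<in>Perms N. \<Sum>\<sigma>\<in>Perms N. \<Sum>\<tau>'\<in>?F. \<Sum>\<kappa>'\<in>?F. G \<pi> \<sigma> \<tau>' \<kappa>')"
    unfolding krylov_def xe split by (intro sum.cong refl step)
  also have "\<dots> = (\<Sum>\<pi>\<in>Perms N. \<Sum>\<sigma>\<in>Perms N. \<Sum>y\<in>?F \<times> ?F. G \<pi> \<sigma> (fst y) (snd y))"
    by (simp add: sum.cartesian_product split_def)
  also have "\<dots> = (\<Sum>\<pi>\<in>Perms N. \<Sum>y\<in>?F \<times> ?F. \<Sum>\<sigma>\<in>Perms N. G \<pi> \<sigma> (fst y) (snd y))"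
    by (intro sum.cong refl sum.swap)
  also have "\<dots> = (\<Sum>y\<in>?F \<times> ?F. \<Sum>\<pi>\<in>Perms N. \<Sum>\<sigma>\<in>Perms N. G \<pi> \<sigma> (fst y) (snd y))"
    by (rule sum.swap)
  also have "\<dots> = (\<Sum>y\<in>?F \<times> ?F. tensor_act N g h x y * krylov N A y)"
    by (intro sum.cong refl) (auto simp: G_def krylov_def xe sum_distrib_left mult_ac)
  finally show ?thesis .
qed

lemma krylov_comp:
  assumes r: "\<rho> \<in> Perms N" and c: "\<chi> \<in> Perms N"
  shows "krylov N A (\<tau> \<circ> \<rho>, \<kappa> \<circ> \<chi>) = of_int (sign \<rho>) * krylov N A (\<tau>, \<kappa>)"
proof -
  define H where "H \<pi> \<sigma> = (\<Prod>j<N. (A ^\<^sub>m j) $$ (\<tau> (\<pi> j), \<kappa> (\<sigma> j)))" for \<pi> \<sigma>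
  have sg: "of_int (sign \<pi>) = (of_int (sign \<rho>) * of_int (sign (\<rho> \<circ> \<pi>)) :: complex)" if "\<pi> \<in> Perms N" for \<pi>
  proof -
    have "sign (\<rho> \<circ> \<pi>) = sign \<rho> * sign \<pi>"
      using r that by (intro sign_compose) (auto intro: permutation_permutes[THEN iffD2])
    thus ?thesis by (simp add: sign_def)
  qed
  have "krylov N A (\<tau> \<circ> \<rho>, \<kappa> \<circ> \<chi>) =
     (\<Sum>\<pi>\<in>Perms N. \<Sum>\<sigma>\<in>Perms N. of_int (sign \<rho>) * (of_int (sign (\<rho> \<circ> \<pi>)) * H (\<rho> \<circ> \<pi>) (\<chi> \<circ> \<sigma>)))"
    unfolding krylov_def split H_def by (intro sum.cong refl) (simp add: sg)
  also have "\<dots> = (\<Sum>\<pi>\<in>Perms N. \<Sum>\<sigma>\<in>Perms N. of_int (sign \<rho>) * (of_int (sign (\<rho> \<circ> \<pi>)) * H (\<rho> \<circ> \<pi>) \<sigma>))"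
  proof (rule sum.cong[OF refl])
    fix \<pi>
    show "(\<Sum>\<sigma>\<in>Perms N. of_int (sign \<rho>) * (of_int (sign (\<rho> \<circ> \<pi>)) * H (\<rho> \<circ> \<pi>) (\<chi> \<circ> \<sigma>))) =
      (\<Sum>\<sigma>\<in>Perms N. of_int (sign \<rho>) * (of_int (sign (\<rho> \<circ> \<pi>)) * H (\<rho> \<circ> \<pi>) \<sigma>))"
      using setum_permutations_compose_left[of \<chi> "{..<N}"
          "\<lambda>\<sigma>. of_int (sign \<rho>) * (of_int (sign (\<rho> \<circ> \<pi>)) * H (\<rho> \<circ> \<pi>) \<sigma>)"] c by simp
  qed
  also have "\<dots> = (\<Sum>\<pi>\<in>Perms N. \<Sum>\<sigma>\<in>Perms N. of_int (sign \<rho>) * (of_int (sign \<pi>) * H \<pi> \<sigma>))"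
    using setum_permutations_compose_left[of \<rho> "{..<N}"
        "\<lambda>\<pi>. \<Sum>\<sigma>\<in>Perms N. of_int (sign \<rho>) * (of_int (sign \<pi>) * H \<pi> \<sigma>)"] r by simp
  finally show ?thesis unfolding krylov_def H_def by (simp add: sum_distrib_left)
qed

lemma krylov_not_inj:
  assumes "\<not> inj_on \<tau> {..<N}"
  shows "krylov N A (\<tau>, \<kappa>) = 0"
proof -
  obtain i j where ij: "i < N" "j < N" "i \<noteq> j" "\<tau> i = \<tau> j" using assms by (auto simp: inj_on_def)
  have p: "transpose i j \<in> Perms N" "id \<in> Perms N"
    using ij by (auto intro: permutes_swap_id permutes_id)
  have "\<tau> \<circ> transpose i j = \<tau>" using ij by (auto simp: transpose_def fun_eq_iff)
  hence "krylov N A (\<tau>, \<kappa>) = - krylov N A (\<tau>, \<kappa>)"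
    using krylov_comp[OF p, of A \<tau> \<kappa>] ij by (simp add: sign_swap_id)
  thus ?thesis by simp
qed

lemma cnj_tensor_act_unitary:
  assumes U: "U \<in> carrier_mat n n"
    and "x \<in> index_fun N n \<times> index_fun N n" "y \<in> index_fun N n \<times> index_fun N n"
  shows "cnj (tensor_act N U (mat_adjoint U) x y) = tensor_act N (mat_adjoint U) U y x"
  using assms by (auto simp: tensor_act_def index_fun_less mult.commute intro!: prod.cong)

text \<open>With \<open>x\<close> the values at \<open>A\<close> and \<open>y\<close> those at the
  conjugate, the tensor matrix of \<open>U\<close> takes \<open>x\<close> to \<open>y\<close> and
  its conjugate transpose takes \<open>y\<close> back to \<open>x\<close>; moving it across the
  inner product turns the norm of \<open>y\<close> into that of \<open>x\<close>.\<close>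

lemma ip_krylov_unitary:
  fixes N :: nat
  assumes U: "U \<in> unitaries n" and A: "A \<in> carrier_mat n n"
  defines "K \<equiv> index_fun N n \<times> index_fun N n"
  shows "ip K (krylov N (mat_adjoint U * A * U)) (krylov N (mat_adjoint U * A * U)) =
         ip K (krylov N A) (krylov N A)"
proof -
  note U' = unitariesD[OF U]
  define x y where "x = krylov N A" and "y = krylov N (mat_adjoint U * A * U)"
  have yx: "y k = (\<Sum>l\<in>K. tensor_act N U (mat_adjoint U) k l * x l)" if "k \<in> K" for k
    unfolding x_def y_def K_def by (rule krylov_conj) (use U' A that K_def in auto)
  have xy: "x k = (\<Sum>l\<in>K. tensor_act N (mat_adjoint U) U k l * y l)" if "k \<in> K" for k
  proof -
    have "x k = krylov N (U * (mat_adjoint U * A * U) * mat_adjoint U) k"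
      unfolding x_def unitary_conj_cancel[OF U A] ..
    thus ?thesis unfolding y_def K_def
      by (subst (asm) krylov_conj) (use U' A that K_def in auto)
  qed
  have "ip K y y = (\<Sum>k\<in>K. \<Sum>l\<in>K. tensor_act N U (mat_adjoint U) k l * x l * cnj (y k))"
    unfolding ip_def by (intro sum.cong refl) (simp add: yx sum_distrib_right)
  also have "\<dots> = (\<Sum>l\<in>K. \<Sum>k\<in>K. x l * cnj (tensor_act N (mat_adjoint U) U l k * y k))"
    by (subst sum.swap, intro sum.cong refl)
       (use cnj_tensor_act_unitary[OF U'(1), of _ N] in \<open>simp add: K_def flip: cnj_tensor_act_unitary[OF U'(1)]\<close>)
  also have "\<dots> = ip K x x"
    unfolding ip_def by (intro sum.cong refl) (simp add: xy sum_distrib_left)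
  finally show ?thesis unfolding x_def y_def .
qed

section \<open>Diagonal matrices and the subdiscriminant\<close>

lemma diag_of_pow:
  "diag_of n a ^\<^sub>m j = diag_of n (\<lambda>i. a i ^ j)"
proof (induction j)
  case 0
  show ?case by (rule eq_matI) auto
next
  case (Suc j)
  have "diag_of n (\<lambda>i. a i ^ j) * diag_of n a = diag_of n (\<lambda>i. a i ^ Suc j)"
  proof (rule eq_matI)
    fix x y assume "x < dim_row (diag_of n (\<lambda>i. a i ^ Suc j))" "y < dim_col (diag_of n (\<lambda>i. a i ^ Suc j))"
    hence xy: "x < n" "y < n" by auto
    have "(diag_of n (\<lambda>i. a i ^ j) * diag_of n a) $$ (x, y) =
      (\<Sum>l<n. diag_of n (\<lambda>i. a i ^ j) $$ (x, l) * diag_of n a $$ (l, y))"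
      using xy by (simp add: scalar_prod_def atLeast0LessThan)
    also have "\<dots> = (\<Sum>l<n. if l = x then a x ^ j * (if x = y then a x else 0) else 0)"
      using xy by (intro sum.cong refl) auto
    finally show "(diag_of n (\<lambda>i. a i ^ j) * diag_of n a) $$ (x, y) = diag_of n (\<lambda>i. a i ^ Suc j) $$ (x, y)"
      using xy by simp
  qed auto
  thus ?case using Suc by simp
qed

text \<open>The Newton polynomial \<open>p j\<close> is monic of degree j and vanishes at the first
  j nodes. Its matrix of values is therefore lower triangular, and it is the Vandermonde matrix
  times a unitriangular matrix of coefficients.\<close>

lemma vandermonde:
  fixes x :: "nat \<Rightarrow> 'a :: field"
  shows "(\<Sum>\<sigma>\<in>Perms N. of_int (sign \<sigma>) * (\<Prod>j<N. x (\<sigma> j) ^ j)) = (\<Prod>j<N. \<Prod>i<j. x j - x i)"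
proof -
  define p where "p j = (\<Prod>i<j. [:- x i, 1:])" for j
  have deg: "degree (p j) = j" for j
    unfolding p_def by (subst degree_prod_eq_sum_degree) auto
  have lead: "coeff (p j) j = 1" for j
    using deg[of j] lead_coeff_prod[of "\<lambda>i. [:- x i, 1:]" "{..<j}"] unfolding p_def by simp
  define X C P where "X = mat N N (\<lambda>(i, j). x i ^ j)" and "C = mat N N (\<lambda>(l, j). coeff (p j) l)"
    and "P = mat N N (\<lambda>(i, j). poly (p j) (x i))"
  have "P = X * C"
  proof (rule eq_matI)
    fix i j assume "i < dim_row (X * C)" "j < dim_col (X * C)"
    hence ij: "i < N" "j < N" by (auto simp: X_def C_def)
    have "poly (p j) (x i) = (\<Sum>l\<le>j. coeff (p j) l * x i ^ l)"
      by (subst poly_altdef) (simp add: deg)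
    also have "\<dots> = (\<Sum>l<N. coeff (p j) l * x i ^ l)"
      using ij deg[of j] by (intro sum.mono_neutral_left) (auto intro: coeff_eq_0)
    finally show "P $$ (i, j) = (X * C) $$ (i, j)"
      using ij by (simp add: P_def X_def C_def scalar_prod_def atLeast0LessThan mult.commute)
  qed (auto simp: P_def X_def C_def)
  hence "det P = det X * det C"
    by (metis (no_types, lifting) C_def X_def det_mult mat_carrier)
  also have "det C = 1"
  proof -
    have "det C = prod_list (diag_mat C)"
      by (rule det_upper_triangular[where n = N]) (auto simp: C_def deg coeff_eq_0 upper_triangular_def)
    also have "diag_mat C = map (\<lambda>_. 1) [0..<N]"
      by (auto simp: diag_mat_def C_def lead)
    finally show ?thesis by (simp add: map_replicate_const)
  qed
  also have "det P = (\<Prod>j<N. \<Prod>i<j. x j - x i)"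
  proof -
    have "poly (p j) (x i) = 0" if "i < j" for i j
      using that by (auto simp: p_def poly_prod)
    hence "det P = prod_list (diag_mat P)"
      by (intro det_lower_triangular[where n = N]) (auto simp: P_def)
    also have "diag_mat P = map (\<lambda>j. \<Prod>i<j. x j - x i) [0..<N]"
      by (auto simp: diag_mat_def P_def p_def poly_prod)
    also have "prod_list \<dots> = (\<Prod>j<N. \<Prod>i<j. x j - x i)"
      by (simp add: prod.list_conv_set_nth atLeast0LessThan)
    finally show ?thesis .
  qed
  also have "det X = (\<Sum>\<sigma>\<in>Perms N. of_int (sign \<sigma>) * (\<Prod>j<N. x (\<sigma> j) ^ j))"
  proof -
    have "det X = (\<Sum>\<sigma>\<in>Perms N. of_int (sign \<sigma>) * (\<Prod>j<N. X $$ (\<sigma> j, j)))"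
      using det_col[of X N] by (simp add: X_def atLeast0LessThan)
    also have "\<dots> = (\<Sum>\<sigma>\<in>Perms N. of_int (sign \<sigma>) * (\<Prod>j<N. x (\<sigma> j) ^ j))"
      using Perms_less by (intro sum.cong refl) (auto simp: X_def intro!: prod.cong)
    finally show ?thesis .
  qed
  finally show ?thesis by simp
qed

definition vdm :: "nat \<Rightarrow> (nat \<Rightarrow> 'a :: field) \<Rightarrow> 'a" where
  "vdm N x = (\<Prod>j<N. \<Prod>i<j. x j - x i)"

lemma vdm_eq_0_iff: "vdm N x = 0 \<longleftrightarrow> \<not> inj_on x {..<N}"
proof -
  have "vdm N x = 0 \<longleftrightarrow> (\<exists>j<N. \<exists>i<j. x j = x i)" by (auto simp: vdm_def)
  also have "\<dots> \<longleftrightarrow> \<not> inj_on x {..<N}"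
  proof
    assume "\<not> inj_on x {..<N}"
    then obtain i j where "i < N" "j < N" "i \<noteq> j" "x i = x j" by (auto simp: inj_on_def)
    thus "\<exists>j<N. \<exists>i<j. x j = x i" by (metis linorder_neqE_nat)
  next
    assume "\<exists>j<N. \<exists>i<j. x j = x i"
    then obtain i j where "j < N" "i < j" "x j = x i" by blast
    moreover from this have "i < N" "i \<noteq> j" by auto
    ultimately show "\<not> inj_on x {..<N}" unfolding inj_on_def by (metis lessThan_iff)
  qed
  finally show ?thesis .
qed

lemma krylov_diag:
  assumes t: "\<tau> \<in> index_fun N n" "\<kappa> \<in> index_fun N n"
  shows "krylov N (diag_of n a) (\<tau>, \<kappa>) = (\<Sum>\<pi>\<in>Perms N. \<Sum>\<sigma>\<in>Perms N.
    if \<tau> \<circ> \<pi> = \<kappa> \<circ> \<sigma> then of_int (sign \<pi>) * (\<Prod>j<N. a (\<kappa> (\<sigma> j)) ^ j) else 0)"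
  unfolding krylov_def split
proof (intro sum.cong refl)
  fix \<pi> \<sigma> assume p: "\<pi> \<in> Perms N" and s: "\<sigma> \<in> Perms N"
  have e: "(diag_of n a ^\<^sub>m j) $$ (\<tau> (\<pi> j), \<kappa> (\<sigma> j)) = (if \<tau> (\<pi> j) = \<kappa> (\<sigma> j) then a (\<kappa> (\<sigma> j)) ^ j else 0)"
    if "j < N" for j
    using that index_fun_less[OF t(1) Perms_less[OF p that]] index_fun_less[OF t(2) Perms_less[OF s that]]
    by (simp add: diag_of_pow)
  show "of_int (sign \<pi>) * (\<Prod>j<N. (diag_of n a ^\<^sub>m j) $$ (\<tau> (\<pi> j), \<kappa> (\<sigma> j))) =
    (if \<tau> \<circ> \<pi> = \<kappa> \<circ> \<sigma> then of_int (sign \<pi>) * (\<Prod>j<N. a (\<kappa> (\<sigma> j)) ^ j) else 0)"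
  proof (cases "\<tau> \<circ> \<pi> = \<kappa> \<circ> \<sigma>")
    case True
    hence "\<tau> (\<pi> j) = \<kappa> (\<sigma> j)" for j by (metis comp_apply)
    hence "(\<Prod>j<N. (diag_of n a ^\<^sub>m j) $$ (\<tau> (\<pi> j), \<kappa> (\<sigma> j))) = (\<Prod>j<N. a (\<kappa> (\<sigma> j)) ^ j)"
      using e by (intro prod.cong) auto
    thus ?thesis using True by simp
  next
    case False
    hence "\<exists>j<N. \<tau> (\<pi> j) \<noteq> \<kappa> (\<sigma> j)"
      using index_fun_eqI[OF index_fun_comp[OF t(1) p] index_fun_comp[OF t(2) s]] by auto
    hence "(\<Prod>j<N. (diag_of n a ^\<^sub>m j) $$ (\<tau> (\<pi> j), \<kappa> (\<sigma> j))) = 0"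
      by (force simp: e)
    thus ?thesis using False by simp
  qed
qed

lemma comp_Perms_inj:
  assumes "inj_on \<kappa> {..<N}" "\<pi> \<in> Perms N" "\<sigma> \<in> Perms N" "\<kappa> \<circ> \<pi> = \<kappa> \<circ> \<sigma>"
  shows "\<pi> = \<sigma>"
proof
  fix i
  show "\<pi> i = \<sigma> i"
  proof (cases "i < N")
    case True
    have "\<kappa> (\<pi> i) = \<kappa> (\<sigma> i)" using assms(4) by (metis comp_apply)
    thus ?thesis using assms(1) Perms_less[OF assms(2) True] Perms_less[OF assms(3) True]
      by (auto simp: inj_on_def)
  next
    case False
    thus ?thesis using assms(2,3) permutes_not_in[of \<pi> "{..<N}" i] permutes_not_in[of \<sigma> "{..<N}" i] by auto
  qed
qed

text \<open>For a diagonal matrix only the rows \<tau> that rearrange \<kappa> contribute. If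
  \<kappa> is injective there are N! of them, each contributing the same Vandermonde product up to
  sign. If not, every such \<tau> repeats a row and antisymmetry kills it, while the Vandermonde
  product has a repeated argument.\<close>

lemma krylov_diag_sum:
  assumes k: "\<kappa> \<in> index_fun N n"
  shows "(\<Sum>\<tau>\<in>index_fun N n. (cmod (krylov N (diag_of n a) (\<tau>, \<kappa>)))\<^sup>2) =
    fact N * (cmod (vdm N (a \<circ> \<kappa>)))\<^sup>2"
proof (cases "inj_on \<kappa> {..<N}")
  case True
  have id: "id \<in> Perms N" by (simp add: permutes_id)
  have diag: "krylov N (diag_of n a) (\<kappa>, \<kappa>) = vdm N (a \<circ> \<kappa>)"
  proof -
    have "krylov N (diag_of n a) (\<kappa>, \<kappa>) = (\<Sum>\<pi>\<in>Perms N. \<Sum>\<sigma>\<in>Perms N.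
      if \<sigma> = \<pi> then of_int (sign \<pi>) * (\<Prod>j<N. a (\<kappa> (\<sigma> j)) ^ j) else 0)"
      unfolding krylov_diag[OF k k] using comp_Perms_inj[OF True]
      by (intro sum.cong refl if_cong) auto
    also have "\<dots> = (\<Sum>\<pi>\<in>Perms N. of_int (sign \<pi>) * (\<Prod>j<N. a (\<kappa> (\<pi> j)) ^ j))"
      by (intro sum.cong refl) (simp add: sum.delta)
    also have "\<dots> = vdm N (a \<circ> \<kappa>)" using vandermonde[where x = "a \<circ> \<kappa>"] by (simp add: vdm_def)
    finally show ?thesis .
  qed
  let ?g = "\<lambda>\<tau>. (cmod (krylov N (diag_of n a) (\<tau>, \<kappa>)))\<^sup>2"
  have "(\<Sum>\<tau>\<in>index_fun N n. ?g \<tau>) = (\<Sum>\<tau>\<in>(\<lambda>\<rho>. \<kappa> \<circ> \<rho>) ` Perms N. ?g \<tau>)"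
  proof (rule sum.mono_neutral_right)
    show "(\<lambda>\<rho>. \<kappa> \<circ> \<rho>) ` Perms N \<subseteq> index_fun N n" using index_fun_comp[OF k] by auto
    show "\<forall>\<tau>\<in>index_fun N n - (\<lambda>\<rho>. \<kappa> \<circ> \<rho>) ` Perms N. ?g \<tau> = 0"
    proof
      fix \<tau> assume t: "\<tau> \<in> index_fun N n - (\<lambda>\<rho>. \<kappa> \<circ> \<rho>) ` Perms N"
      have "\<tau> \<circ> \<pi> \<noteq> \<kappa> \<circ> \<sigma>" if p: "\<pi> \<in> Perms N" and s: "\<sigma> \<in> Perms N" for \<pi> \<sigma>
      proof
        assume "\<tau> \<circ> \<pi> = \<kappa> \<circ> \<sigma>"
        hence "\<tau> \<circ> \<pi> \<circ> inv_into UNIV \<pi> = \<kappa> \<circ> (\<sigma> \<circ> inv_into UNIV \<pi>)" by (simp add: comp_assoc)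
        hence "\<tau> = \<kappa> \<circ> (\<sigma> \<circ> inv_into UNIV \<pi>)"
          using p permutes_inv_o(1)[of \<pi> "{..<N}"] by (simp add: comp_assoc)
        moreover have "\<sigma> \<circ> inv_into UNIV \<pi> \<in> Perms N" using p s by (simp add: permutes_inv permutes_compose)
        ultimately show False using t by blast
      qed
      thus "?g \<tau> = 0" using t k by (simp add: krylov_diag)
    qed
  qed simp
  also have "\<dots> = (\<Sum>\<rho>\<in>Perms N. ?g (\<kappa> \<circ> \<rho>))"
    using comp_Perms_inj[OF True] by (subst sum.reindex) (auto simp: inj_on_def)
  also have "\<dots> = (\<Sum>\<rho>\<in>Perms N. (cmod (vdm N (a \<circ> \<kappa>)))\<^sup>2)"
  proof (rule sum.cong[OF refl])
    fix \<rho> assume "\<rho> \<in> Perms N"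
    hence "krylov N (diag_of n a) (\<kappa> \<circ> \<rho>, \<kappa>) = of_int (sign \<rho>) * vdm N (a \<circ> \<kappa>)"
      using krylov_comp[of \<rho> N id "diag_of n a" \<kappa> \<kappa>] id diag by simp
    thus "?g (\<kappa> \<circ> \<rho>) = (cmod (vdm N (a \<circ> \<kappa>)))\<^sup>2" by (simp add: norm_mult sign_def)
  qed
  also have "\<dots> = fact N * (cmod (vdm N (a \<circ> \<kappa>)))\<^sup>2"
    by (simp add: card_permutations)
  finally show ?thesis .
next
  case False
  have "krylov N (diag_of n a) (\<tau>, \<kappa>) = 0" if t: "\<tau> \<in> index_fun N n" for \<tau>
  proof (cases "inj_on \<tau> {..<N}")
    case inj: True
    have "\<tau> \<circ> \<pi> \<noteq> \<kappa> \<circ> \<sigma>" if p: "\<pi> \<in> Perms N" and s: "\<sigma> \<in> Perms N" for \<pi> \<sigma>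
    proof
      assume e: "\<tau> \<circ> \<pi> = \<kappa> \<circ> \<sigma>"
      have "inj_on (\<tau> \<circ> \<pi>) {..<N}"
        using inj p permutes_image[of \<pi> "{..<N}"] permutes_inj_on[of \<pi> "{..<N}" "{..<N}"]
        by (intro comp_inj_on) auto
      hence "inj_on \<kappa> (\<sigma> ` {..<N})" unfolding e by (rule inj_on_imageI)
      thus False using False s permutes_image[of \<sigma> "{..<N}"] by simp
    qed
    thus ?thesis using t k by (simp add: krylov_diag)
  qed (simp add: krylov_not_inj)
  moreover have "vdm N (a \<circ> \<kappa>) = 0"
    using False inj_on_imageI2[of a \<kappa> "{..<N}"] by (auto simp: vdm_eq_0_iff)
  ultimately show ?thesis by simp
qed

lemma sum_krylov_diag:
  "(\<Sum>k\<in>index_fun N n \<times> index_fun N n. (cmod (krylov N (diag_of n a) k))\<^sup>2) =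
    fact N * (\<Sum>\<kappa>\<in>index_fun N n. (cmod (vdm N (a \<circ> \<kappa>)))\<^sup>2)"
proof -
  have "(\<Sum>k\<in>index_fun N n \<times> index_fun N n. (cmod (krylov N (diag_of n a) k))\<^sup>2) =
    (\<Sum>\<tau>\<in>index_fun N n. \<Sum>\<kappa>\<in>index_fun N n. (cmod (krylov N (diag_of n a) (\<tau>, \<kappa>)))\<^sup>2)"
    by (simp add: sum.cartesian_product)
  also have "\<dots> = (\<Sum>\<kappa>\<in>index_fun N n. \<Sum>\<tau>\<in>index_fun N n. (cmod (krylov N (diag_of n a) (\<tau>, \<kappa>)))\<^sup>2)"
    by (rule sum.swap)
  finally show ?thesis by (simp add: krylov_diag_sum sum_distrib_left)
qed

text \<open>Squaring removes the sign, so pairs of positions can be matched with increasing pairs of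
  elements of \<open>S\<close>, whatever the order in which \<kappa> lists \<open>S\<close>.\<close>

lemma vdm_sq_eq_prod:
  fixes x :: "nat \<Rightarrow> 'a :: field"
  assumes b: "bij_betw \<kappa> {..<N} S"
  shows "(vdm N (x \<circ> \<kappa>))\<^sup>2 = (\<Prod>p\<in>{(s, t). s \<in> S \<and> t \<in> S \<and> s < t}. (x (fst p) - x (snd p))\<^sup>2)"
proof -
  have inj: "inj_on \<kappa> {..<N}" and im: "\<kappa> ` {..<N} = S" using b by (auto simp: bij_betw_def)
  have fS: "finite S" using im by auto
  let ?I = "Sigma {..<N} (\<lambda>j. {..<j})"
  let ?f = "\<lambda>(j, i). if \<kappa> i < \<kappa> j then (\<kappa> i, \<kappa> j) else (\<kappa> j, \<kappa> i)"
  have ne: "\<kappa> i \<noteq> \<kappa> j" if "j < N" "i < j" for i j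
    using inj that inj_onD[OF inj, of i j] by auto
  have "bij_betw ?f ?I {(s, t). s \<in> S \<and> t \<in> S \<and> s < t}"
    unfolding bij_betw_def
  proof
    show "inj_on ?f ?I"
    proof (rule inj_onI)
      fix p q assume pq: "p \<in> ?I" "q \<in> ?I" "?f p = ?f q"
      obtain j i j' i' where e: "p = (j, i)" "q = (j', i')" by (cases p; cases q)
      have l: "j < N" "i < j" "j' < N" "i' < j'" using pq e by auto
      have eq: "a = b" if "\<kappa> a = \<kappa> b" "a < N" "b < N" for a b using inj_onD[OF inj that(1)] that by auto
      have "(\<kappa> i = \<kappa> i' \<and> \<kappa> j = \<kappa> j') \<or> (\<kappa> i = \<kappa> j' \<and> \<kappa> j = \<kappa> i')"
        using pq(3) e by (auto split: if_splits)
      hence "(i = i' \<and> j = j') \<or> (i = j' \<and> j = i')" using eq l by (meson less_trans)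
      thus "p = q" using l e by auto
    qed
    show "?f ` ?I = {(s, t). s \<in> S \<and> t \<in> S \<and> s < t}"
    proof
      show "?f ` ?I \<subseteq> {(s, t). s \<in> S \<and> t \<in> S \<and> s < t}"
        using ne im by (fastforce split: if_splits)
      show "{(s, t). s \<in> S \<and> t \<in> S \<and> s < t} \<subseteq> ?f ` ?I"
      proof clarify
        fix s t assume st: "s \<in> S" "t \<in> S" "s < t"
        then obtain i j where ij: "i < N" "j < N" "s = \<kappa> i" "t = \<kappa> j" using im by auto
        hence "i < j \<or> j < i" using st by (metis linorder_neqE_nat order.irrefl)
        thus "(s, t) \<in> ?f ` ?I"
        proof
          assume "i < j"
          thus ?thesis using ij st by (intro image_eqI[of _ _ "(j, i)"]) auto
        next
          assume "j < i"
          thus ?thesis using ij st by (intro image_eqI[of _ _ "(i, j)"]) auto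
        qed
      qed
    qed
  qed
  hence "(\<Prod>p\<in>{(s, t). s \<in> S \<and> t \<in> S \<and> s < t}. (x (fst p) - x (snd p))\<^sup>2) =
    (\<Prod>q\<in>?I. (x (fst (?f q)) - x (snd (?f q)))\<^sup>2)"
    by (rule prod.reindex_bij_betw[symmetric])
  also have "\<dots> = (\<Prod>(j, i)\<in>?I. (x (\<kappa> j) - x (\<kappa> i))\<^sup>2)"
    by (intro prod.cong refl) (auto simp: power2_commute)
  also have "\<dots> = (\<Prod>j<N. \<Prod>i<j. (x (\<kappa> j) - x (\<kappa> i))\<^sup>2)"
    by (subst prod.Sigma) auto
  also have "\<dots> = (vdm N (x \<circ> \<kappa>))\<^sup>2"
    by (simp add: vdm_def prod_power_distrib)
  finally show ?thesis by simp
qed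

text \<open>Non-injective maps contribute zero. The injective ones are grouped by their image, and
  the fibre over an N-subset consists of the N! rearrangements of a single enumeration, all with the
  same squared product.\<close>

lemma sum_vdm_eq_sDisc_list:
  fixes ls :: "complex list"
  assumes N: "N = n - k"
  shows "(\<Sum>\<kappa>\<in>index_fun N n. (vdm N ((!) ls \<circ> \<kappa>))\<^sup>2) = fact N * sDisc_list n k ls"
proof -
  define I where "I = {\<kappa> \<in> index_fun N n. inj_on \<kappa> {..<N}}"
  let ?g = "\<lambda>\<kappa>. (vdm N ((!) ls \<circ> \<kappa>))\<^sup>2"
  let ?h = "\<lambda>S. \<Prod>p\<in>{(s, t). s \<in> S \<and> t \<in> S \<and> s < t}. (ls ! fst p - ls ! snd p)\<^sup>2"
  have fI: "finite I" unfolding I_def by simp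
  have "(\<Sum>\<kappa>\<in>index_fun N n. ?g \<kappa>) = (\<Sum>\<kappa>\<in>I. ?g \<kappa>)"
    unfolding I_def
    by (rule sum.mono_neutral_right) (auto simp: vdm_eq_0_iff dest: inj_on_imageI2)
  also have "\<dots> = (\<Sum>S\<in>(\<lambda>\<kappa>. \<kappa> ` {..<N}) ` I. \<Sum>\<kappa>\<in>{\<kappa> \<in> I. \<kappa> ` {..<N} = S}. ?g \<kappa>)"
    by (rule sum.image_gen[OF fI])
  also have "(\<lambda>\<kappa>. \<kappa> ` {..<N}) ` I = {S. S \<subseteq> {0..<n} \<and> card S = n - k}"
  proof
    show "(\<lambda>\<kappa>. \<kappa> ` {..<N}) ` I \<subseteq> {S. S \<subseteq> {0..<n} \<and> card S = n - k}"
      by (auto simp: I_def N card_image index_fun_less)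
    show "{S. S \<subseteq> {0..<n} \<and> card S = n - k} \<subseteq> (\<lambda>\<kappa>. \<kappa> ` {..<N}) ` I"
    proof clarify
      fix S :: "nat set" assume S: "S \<subseteq> {0..<n}" "card S = n - k"
      have "finite S" using S finite_subset by blast
      then obtain f where f: "bij_betw f {..<N} S"
        using S N by (metis card_lessThan finite_lessThan finite_same_card_bij)
      have "restrict f {..<N} \<in> I" using f S
        by (force simp: I_def index_fun_def bij_betw_def inj_on_def)
      moreover have "restrict f {..<N} ` {..<N} = S" using f by (auto simp: bij_betw_def)
      ultimately show "S \<in> (\<lambda>\<kappa>. \<kappa> ` {..<N}) ` I" by blast
    qed
  qed
  also have "(\<Sum>S\<in>{S. S \<subseteq> {0..<n} \<and> card S = n - k}. \<Sum>\<kappa>\<in>{\<kappa> \<in> I. \<kappa> ` {..<N} = S}. ?g \<kappa>) =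
    (\<Sum>S\<in>{S. S \<subseteq> {0..<n} \<and> card S = n - k}. fact N * ?h S)"
  proof (rule sum.cong[OF refl])
    fix S assume "S \<in> {S. S \<subseteq> {0..<n} \<and> card S = n - k}"
    hence S: "S \<subseteq> {0..<n}" "card S = N" using N by auto
    have "finite S" using S finite_subset by blast
    then obtain f where f: "bij_betw f {..<N} S"
      using S by (metis card_lessThan finite_lessThan finite_same_card_bij)
    define \<kappa>0 where "\<kappa>0 = restrict f {..<N}"
    have k0: "\<kappa>0 \<in> index_fun N n" "inj_on \<kappa>0 {..<N}" "\<kappa>0 ` {..<N} = S"
      using f S by (force simp: \<kappa>0_def index_fun_def bij_betw_def inj_on_def)+
    have "{\<kappa> \<in> I. \<kappa> ` {..<N} = S} = (\<lambda>\<rho>. \<kappa>0 \<circ> \<rho>) ` Perms N"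
    proof
      show "(\<lambda>\<rho>. \<kappa>0 \<circ> \<rho>) ` Perms N \<subseteq> {\<kappa> \<in> I. \<kappa> ` {..<N} = S}"
      proof clarify
        fix \<rho> assume r: "\<rho> permutes {..<N}"
        have "inj_on (\<kappa>0 \<circ> \<rho>) {..<N}"
          using k0 permutes_image[OF r] permutes_inj_on[OF r, of "{..<N}"] by (intro comp_inj_on) auto
        moreover have "(\<kappa>0 \<circ> \<rho>) ` {..<N} = S"
          using k0 permutes_image[OF r] by (metis image_comp)
        ultimately show "\<kappa>0 \<circ> \<rho> \<in> I \<and> (\<kappa>0 \<circ> \<rho>) ` {..<N} = S"
          using r k0 index_fun_comp by (auto simp: I_def)
      qed
      show "{\<kappa> \<in> I. \<kappa> ` {..<N} = S} \<subseteq> (\<lambda>\<rho>. \<kappa>0 \<circ> \<rho>) ` Perms N"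
      proof clarify
        fix \<kappa> assume k: "\<kappa> \<in> I" and S': "S = \<kappa> ` {..<N}"
        define \<rho> where "\<rho> i = (if i < N then inv_into {..<N} \<kappa>0 (\<kappa> i) else i)" for i
        have r1: "\<rho> i < N \<and> \<kappa>0 (\<rho> i) = \<kappa> i" if "i < N" for i
        proof -
          have "\<kappa> i \<in> \<kappa>0 ` {..<N}" using that k0 S' by auto
          thus ?thesis using that inv_into_into[of "\<kappa> i" \<kappa>0 "{..<N}"] f_inv_into_f[of "\<kappa> i" \<kappa>0 "{..<N}"]
            by (auto simp: \<rho>_def)
        qed
        have "inj_on \<rho> {..<N}"
        proof (rule inj_onI)
          fix i j assume "i \<in> {..<N}" "j \<in> {..<N}" "\<rho> i = \<rho> j"
          hence "\<kappa> i = \<kappa> j" "i \<in> {..<N}" "j \<in> {..<N}" using r1[of i] r1[of j] by auto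
          thus "i = j" using k by (auto simp: I_def inj_on_def)
        qed
        hence "bij_betw \<rho> {..<N} {..<N}"
          using r1 by (intro bij_betw_imageI endo_inj_surj) auto
        hence r: "\<rho> permutes {..<N}" by (rule bij_imp_permutes) (auto simp: \<rho>_def)
        have "\<kappa> = \<kappa>0 \<circ> \<rho>"
          by (rule index_fun_eqI[of _ N n]) (use k k0 r r1 index_fun_comp in \<open>auto simp: I_def\<close>)
        thus "\<kappa> \<in> (\<lambda>\<rho>. \<kappa>0 \<circ> \<rho>) ` Perms N" using r by blast
      qed
    qed
    moreover have "inj_on (\<lambda>\<rho>. \<kappa>0 \<circ> \<rho>) (Perms N)"
      using comp_Perms_inj[OF k0(2)] by (auto simp: inj_on_def)
    ultimately have "card {\<kappa> \<in> I. \<kappa> ` {..<N} = S} = fact N"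
      by (simp add: card_image card_permutations)
    moreover have "?g \<kappa> = ?h S" if "\<kappa> \<in> {\<kappa> \<in> I. \<kappa> ` {..<N} = S}" for \<kappa>
      using that by (intro vdm_sq_eq_prod) (auto simp: I_def bij_betw_def)
    ultimately show "(\<Sum>\<kappa>\<in>{\<kappa> \<in> I. \<kappa> ` {..<N} = S}. ?g \<kappa>) = fact N * ?h S" by simp
  qed
  finally show ?thesis unfolding sDisc_list_def sum_distrib_left .
qed

section \<open>Minimal polynomials of unitarily diagonalised matrices\<close>

lemma conj_diag_index:
  assumes "U \<in> carrier_mat n n" "x < n" "y < n"
  shows "(U * diag_of n d * mat_adjoint U) $$ (x, y) = (\<Sum>l<n. U $$ (x, l) * d l * cnj (U $$ (y, l)))"
proof -
  have "(U * diag_of n d * mat_adjoint U) $$ (x, y) =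
    (\<Sum>a<n. \<Sum>b<n. U $$ (x, a) * diag_of n d $$ (a, b) * mat_adjoint U $$ (b, y))"
    by (rule triple_product_index) (use assms in auto)
  also have "\<dots> = (\<Sum>a<n. \<Sum>b<n. if b = a then U $$ (x, a) * d a * cnj (U $$ (y, a)) else 0)"
    using assms by (intro sum.cong refl) auto
  finally show ?thesis by simp
qed

lemma conj_diag_pow:
  assumes U: "U \<in> unitaries n"
  shows "(U * diag_of n d * mat_adjoint U) ^\<^sub>m j = U * diag_of n (\<lambda>i. d i ^ j) * mat_adjoint U"
proof -
  have "(U * diag_of n d * mat_adjoint U) ^\<^sub>m j = U * diag_of n d ^\<^sub>m j * mat_adjoint U"
    by (rule pow_conj) (use unitariesD[OF U] in auto)
  thus ?thesis by (simp add: diag_of_pow)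
qed

lemma mat_poly_eval_conj_diag:
  assumes U: "U \<in> unitaries n"
  shows "mat_poly_eval n p (U * diag_of n d * mat_adjoint U) = U * diag_of n (\<lambda>i. poly p (d i)) * mat_adjoint U"
proof -
  note Uc = unitariesD(1)[OF U]
  define A where "A = U * diag_of n d * mat_adjoint U"
  have A: "A \<in> carrier_mat n n" using Uc by (simp add: A_def)
  have fc: "foldr (+) (map (\<lambda>i. coeff p i \<cdot>\<^sub>m (A ^\<^sub>m i)) xs) (0\<^sub>m n n) \<in> carrier_mat n n" for xs
    by (induction xs) (use A in auto)
  have fi: "foldr (+) (map (\<lambda>i. coeff p i \<cdot>\<^sub>m (A ^\<^sub>m i)) xs) (0\<^sub>m n n) $$ (x, y) =
     (\<Sum>i\<leftarrow>xs. coeff p i * (A ^\<^sub>m i) $$ (x, y))" if "x < n" "y < n" for x y xs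
  proof (induction xs)
    case (Cons i xs)
    have "dim_row (A ^\<^sub>m i) = n" "dim_col (A ^\<^sub>m i) = n" using A by auto
    moreover have "dim_row (foldr (+) (map (\<lambda>i. coeff p i \<cdot>\<^sub>m (A ^\<^sub>m i)) xs) (0\<^sub>m n n)) = n"
      "dim_col (foldr (+) (map (\<lambda>i. coeff p i \<cdot>\<^sub>m (A ^\<^sub>m i)) xs) (0\<^sub>m n n)) = n"
      using fc[of xs] by auto
    ultimately show ?case using Cons that by simp
  qed (use that in simp)
  have "mat_poly_eval n p A = U * diag_of n (\<lambda>i. poly p (d i)) * mat_adjoint U"
  proof (rule eq_matI)
    fix x y assume "x < dim_row (U * diag_of n (\<lambda>i. poly p (d i)) * mat_adjoint U)"
      "y < dim_col (U * diag_of n (\<lambda>i. poly p (d i)) * mat_adjoint U)"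
    hence xy: "x < n" "y < n" using Uc by auto
    have "mat_poly_eval n p A $$ (x, y) = (\<Sum>i\<le>degree p. coeff p i * (A ^\<^sub>m i) $$ (x, y))"
      unfolding mat_poly_eval_def fi[OF xy]
      by (subst sum_list_distinct_conv_sum_set) (auto simp: atLeast0LessThan lessThan_Suc_atMost simp del: upt_Suc)
    also have "\<dots> = (\<Sum>i\<le>degree p. \<Sum>l<n. U $$ (x, l) * (coeff p i * d l ^ i) * cnj (U $$ (y, l)))"
      unfolding A_def conj_diag_pow[OF U] conj_diag_index[OF Uc xy]
      by (simp add: sum_distrib_left mult_ac)
    also have "\<dots> = (\<Sum>l<n. U $$ (x, l) * poly p (d l) * cnj (U $$ (y, l)))"
      by (subst sum.swap) (simp add: poly_altdef sum_distrib_left sum_distrib_right)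
    also have "\<dots> = (U * diag_of n (\<lambda>i. poly p (d i)) * mat_adjoint U) $$ (x, y)"
      unfolding conj_diag_index[OF Uc xy] ..
    finally show "mat_poly_eval n p A $$ (x, y) = \<dots>" .
  qed (use fc[of "[0..<Suc (degree p)]"] Uc in \<open>auto simp: mat_poly_eval_def simp del: upt_Suc\<close>)
  thus ?thesis unfolding A_def .
qed

lemma conj_diag_eq_0_iff:
  assumes U: "U \<in> unitaries n"
  shows "U * diag_of n d * mat_adjoint U = 0\<^sub>m n n \<longleftrightarrow> (\<forall>i<n. d i = 0)"
proof
  note Uc = unitariesD(1)[OF U]
  assume "U * diag_of n d * mat_adjoint U = 0\<^sub>m n n"
  moreover have "mat_adjoint U * (U * diag_of n d * mat_adjoint U) * U = diag_of n d"
    using unitary_conj_cancel[OF unitaries_adjoint[OF U], of "diag_of n d"] by simp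
  ultimately have "diag_of n d = mat_adjoint U * 0\<^sub>m n n * U" by simp
  also have "\<dots> = 0\<^sub>m n n" using Uc by simp
  finally have "diag_of n d $$ (i, i) = 0" if "i < n" for i using that by simp
  thus "\<forall>i<n. d i = 0" by simp
next
  assume "\<forall>i<n. d i = 0"
  thus "U * diag_of n d * mat_adjoint U = 0\<^sub>m n n"
    using unitariesD(1)[OF U] by (intro eq_matI) (auto simp: conj_diag_index simp del: index_mult_mat(1))
qed

text \<open>The product of the linear factors over the distinct diagonal values annihilates the
  matrix. Conversely an annihilating polynomial has all these values as roots, and a monic one is
  nonzero, so its degree bounds their number.\<close>

lemma min_poly_deg_conj_diag:
  assumes U: "U \<in> unitaries n"
  shows "min_poly_deg n (U * diag_of n d * mat_adjoint U) = card (d ` {..<n})"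
  unfolding min_poly_deg_def
proof (rule Least_equality)
  define p where "p = (\<Prod>v\<in>d ` {..<n}. [:- v, 1:])"
  have "lead_coeff p = 1" unfolding p_def by (subst lead_coeff_prod) simp
  moreover have "degree p = card (d ` {..<n})"
    unfolding p_def by (subst degree_prod_eq_sum_degree) auto
  moreover have "\<forall>i<n. poly p (d i) = 0" by (auto simp: p_def poly_prod)
  ultimately show "\<exists>p. lead_coeff p = 1 \<and> degree p = card (d ` {..<n}) \<and>
      mat_poly_eval n p (U * diag_of n d * mat_adjoint U) = 0\<^sub>m n n"
    unfolding mat_poly_eval_conj_diag[OF U] conj_diag_eq_0_iff[OF U] by blast
next
  fix e assume "\<exists>p. lead_coeff p = 1 \<and> degree p = e \<and>
      mat_poly_eval n p (U * diag_of n d * mat_adjoint U) = 0\<^sub>m n n"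
  then obtain p where p: "lead_coeff p = 1" "degree p = e" "\<forall>i<n. poly p (d i) = 0"
    unfolding mat_poly_eval_conj_diag[OF U] conj_diag_eq_0_iff[OF U] by blast
  have p0: "p \<noteq> 0" using p(1) by auto
  have "card (d ` {..<n}) \<le> card {x. poly p x = 0}"
    using p(3) poly_roots_finite[OF p0] by (intro card_mono) auto
  also have "\<dots> \<le> e" using card_poly_roots_bound[OF p0] p(2) by simp
  finally show "card (d ` {..<n}) \<le> e" .
qed

lemma conj_real_diag_Her:
  assumes U: "U \<in> unitaries n"
  shows "U * diag_of n (\<lambda>i. complex_of_real (a i)) * mat_adjoint U \<in> Her n"
proof -
  note Uc = unitariesD(1)[OF U]
  have "mat_adjoint (diag_of n (\<lambda>i. complex_of_real (a i))) = diag_of n (\<lambda>i. complex_of_real (a i))"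
    by (rule eq_matI) auto
  thus ?thesis using Uc unfolding Her_def
    by (simp add: mat_adjoint_mult[of _ n n _ n] assoc_mult_mat[of _ n n _ n _ n])
qed

lemma Her_strat_conj_diag:
  assumes U: "U \<in> unitaries n"
  shows "U * diag_of n (\<lambda>i. complex_of_real (a i)) * mat_adjoint U \<in> Her_strat n k \<longleftrightarrow> card (a ` {..<n}) \<le> n - k - 1"
proof -
  have "(\<lambda>i. complex_of_real (a i)) ` {..<n} = complex_of_real ` (a ` {..<n})" by auto
  hence "card ((\<lambda>i. complex_of_real (a i)) ` {..<n}) = card (a ` {..<n})"
    by (metis card_image inj_of_real inj_on_subset subset_UNIV)
  thus ?thesis using conj_real_diag_Her[OF U] unfolding Her_strat_def
    by (simp add: min_poly_deg_conj_diag[OF U])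
qed

section \<open>Vanishing in low degrees\<close>

text \<open>The parameter \<open>s\<close> is real, so real and imaginary parts of the entries are
  affine in it.\<close>

lemma hpoly_line:
  assumes "hpoly n d p" and A: "A \<in> carrier_mat n n" and B: "B \<in> carrier_mat n n"
  shows "\<exists>P. degree P \<le> d \<and> (\<forall>s. p (A + complex_of_real s \<cdot>\<^sub>m B) = poly P s)"
  using assms(1)
proof induction
  case (hconst c)
  show ?case by (intro exI[of _ "[:c:]"]) auto
next
  case (hre i j)
  thus ?case using A B
    by (intro exI[of _ "[:Re (A $$ (i, j)), Re (B $$ (i, j)):]"]) (auto simp: algebra_simps)
next
  case (him i j)
  thus ?case using A B
    by (intro exI[of _ "[:Im (A $$ (i, j)), Im (B $$ (i, j)):]"]) (auto simp: algebra_simps)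
next
  case (hadd d f g)
  then obtain P Q where "degree P \<le> d" "\<forall>s. f (A + complex_of_real s \<cdot>\<^sub>m B) = poly P s"
    "degree Q \<le> d" "\<forall>s. g (A + complex_of_real s \<cdot>\<^sub>m B) = poly Q s" by blast
  thus ?case by (intro exI[of _ "P + Q"]) (auto intro: degree_add_le)
next
  case (hmult d f e g)
  then obtain P Q where "degree P \<le> d" "\<forall>s. f (A + complex_of_real s \<cdot>\<^sub>m B) = poly P s"
    "degree Q \<le> e" "\<forall>s. g (A + complex_of_real s \<cdot>\<^sub>m B) = poly Q s" by blast
  thus ?case by (intro exI[of _ "P * Q"]) (auto intro: order_trans[OF degree_mult_le] add_mono)
qed

definition ordered_pairs :: "'a :: linorder set \<Rightarrow> ('a \<times> 'a) set" where
  "ordered_pairs W = {(u, v). u \<in> W \<and> v \<in> W \<and> u < v}"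

lemma finite_ordered_pairs: "finite W \<Longrightarrow> finite (ordered_pairs W)"
  by (rule finite_subset[of _ "W \<times> W"]) (auto simp: ordered_pairs_def)

lemma card_ordered_pairs:
  assumes "finite W"
  shows "card (ordered_pairs W) = card W choose 2"
proof -
  have "bij_betw (\<lambda>(u, v). {u, v}) (ordered_pairs W) {B. B \<subseteq> W \<and> card B = 2}"
    unfolding bij_betw_def
  proof
    show "inj_on (\<lambda>(u, v). {u, v}) (ordered_pairs W)"
      by (auto simp: inj_on_def ordered_pairs_def doubleton_eq_iff)
    show "(\<lambda>(u, v). {u, v}) ` ordered_pairs W = {B. B \<subseteq> W \<and> card B = 2}"
    proof
      show "(\<lambda>(u, v). {u, v}) ` ordered_pairs W \<subseteq> {B. B \<subseteq> W \<and> card B = 2}"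
        by (auto simp: ordered_pairs_def)
      show "{B. B \<subseteq> W \<and> card B = 2} \<subseteq> (\<lambda>(u, v). {u, v}) ` ordered_pairs W"
      proof clarify
        fix B assume B: "B \<subseteq> W" "card B = 2"
        then obtain u v where uv: "B = {u, v}" "u \<noteq> v" by (auto simp: card_2_iff)
        show "B \<in> (\<lambda>(u, v). {u, v}) ` ordered_pairs W"
        proof (cases "u < v")
          case True
          thus ?thesis using uv B by (intro image_eqI[of _ _ "(u, v)"]) (auto simp: ordered_pairs_def)
        next
          case False
          thus ?thesis using uv B by (intro image_eqI[of _ _ "(v, u)"]) (auto simp: ordered_pairs_def)
        qed
      qed
    qed
  qed
  hence "card (ordered_pairs W) = card {B. B \<subseteq> W \<and> card B = 2}" by (rule bij_betw_same_card)
  thus ?thesis using n_subsets[OF assms, of 2] by simp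
qed

text \<open>The direction is sought as \<open>t ^ e u\<close> with distinct exponents. Each slope is
  then a polynomial in \<open>t\<close>, nonzero and different for different pairs, so all but
  finitely many \<open>t\<close> keep the slopes nonzero and pairwise distinct.\<close>

lemma generic_slopes:
  fixes W :: "real set"
  assumes W: "finite W"
  obtains b :: "real \<Rightarrow> real" where
    "\<And>u v. (u, v) \<in> ordered_pairs W \<Longrightarrow> b u \<noteq> b v"
    "inj_on (\<lambda>(u, v). (b v - b u) / (v - u)) (ordered_pairs W)"
proof -
  obtain e :: "real \<Rightarrow> nat" where e: "inj_on e W"
    using finite_imp_inj_to_nat_seg[OF W] by blast
  define P where "P = (\<lambda>(u, v). smult (1 / (v - u)) (monom 1 (e v) - monom 1 (e u)) :: real poly)"
  have inj: "P x \<noteq> P y" if x: "x \<in> ordered_pairs W" and y: "y \<in> ordered_pairs W" and ne: "x \<noteq> y" for x y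
  proof
    obtain u v u' v' where xy: "x = (u, v)" "y = (u', v')" by (cases x; cases y)
    have l: "u \<in> W" "v \<in> W" "u < v" "u' \<in> W" "v' \<in> W" "u' < v'"
      using x y xy by (auto simp: ordered_pairs_def)
    assume eq: "P x = P y"
    \<comment> \<open>The exponents that occur determine the pair, whatever the factor 1 / (s - r);
      this separates the slope polynomials.\<close>
    have supp: "{i. coeff (P (r, s)) i \<noteq> 0} = {e r, e s}" if "r \<in> W" "s \<in> W" "r < s" for r s
      using that inj_onD[OF e, of r s] by (auto simp: P_def)
    have "{e u, e v} = {e u', e v'}" using supp l eq xy by metis
    hence "e ` {u, v} = e ` {u', v'}" by simp
    hence "{u, v} = {u', v'}" using e l by (subst (asm) inj_on_image_eq_iff[of e W]) auto
    thus False using ne l xy by (auto simp: doubleton_eq_iff)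
  qed
  have nz: "P x \<noteq> 0" if x: "x \<in> ordered_pairs W" for x
  proof -
    obtain u v where u: "x = (u, v)" "u \<in> W" "v \<in> W" "u < v" using x by (auto simp: ordered_pairs_def)
    hence "coeff (P x) (e v) \<noteq> 0" using inj_onD[OF e, of u v] by (auto simp: P_def)
    thus ?thesis by auto
  qed
  define Q where "Q = P ` ordered_pairs W \<union>
    (\<lambda>(x, y). P x - P y) ` {(x, y) \<in> ordered_pairs W \<times> ordered_pairs W. x \<noteq> y}"
  have "finite Q" unfolding Q_def using finite_ordered_pairs[OF W]
    by (auto intro!: finite_imageI intro: finite_subset[of _ "ordered_pairs W \<times> ordered_pairs W"])
  moreover have "0 \<notin> Q" unfolding Q_def using inj nz by fastforce
  ultimately have "finite (\<Union>q\<in>Q. {t. poly q t = 0})"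
    by (intro finite_UN_I) (auto intro: poly_roots_finite)
  then obtain t :: real where t: "t \<notin> (\<Union>q\<in>Q. {t. poly q t = 0})"
    using ex_new_if_finite[OF infinite_UNIV_char_0] by blast
  have val: "poly (P (u, v)) t = (t ^ e v - t ^ e u) / (v - u)" for u v
    by (simp add: P_def poly_monom)
  show thesis
  proof (rule that[of "\<lambda>u. t ^ e u"])
    fix u v assume uv: "(u, v) \<in> ordered_pairs W"
    hence "poly (P (u, v)) t \<noteq> 0" using t unfolding Q_def by blast
    thus "t ^ e u \<noteq> t ^ e v" by (auto simp: val)
  next
    show "inj_on (\<lambda>(u, v). (t ^ e v - t ^ e u) / (v - u)) (ordered_pairs W)"
    proof (rule inj_onI)
      fix x y assume xy: "x \<in> ordered_pairs W" "y \<in> ordered_pairs W"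
        "(\<lambda>(u, v). (t ^ e v - t ^ e u) / (v - u)) x = (\<lambda>(u, v). (t ^ e v - t ^ e u) / (v - u)) y"
      hence "poly (P x - P y) t = 0" by (auto simp: val split: prod.splits)
      thus "x = y" using t xy unfolding Q_def by fastforce
    qed
  qed
qed

text \<open>A line through a point with \<open>q\<close> distinct eigenvalues, in generic direction inside the same
  stratum, meets the smaller strata in \<open>q choose 2\<close> points, which exceeds the degree.\<close>
lemma hpoly_vanish:
  assumes p: "hpoly n d p" and d: "d < (n - k) choose 2"
    and van: "\<And>A. A \<in> Her_strat n k \<Longrightarrow> p A = 0" and U: "U \<in> unitaries n"
  shows "p (U * diag_of n (\<lambda>i. complex_of_real (x i)) * mat_adjoint U) = 0"
proof (induction "card (x ` {..<n})" arbitrary: x rule: less_induct)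
  case less
  note Uc = unitariesD(1)[OF U]
  define C where "C y = U * diag_of n (\<lambda>i. complex_of_real (y i)) * mat_adjoint U" for y
  have Cc: "C y \<in> carrier_mat n n" for y using Uc by (simp add: C_def)
  have Ci: "C y $$ (i, j) = (\<Sum>l<n. U $$ (i, l) * complex_of_real (y l) * cnj (U $$ (j, l)))"
    if "i < n" "j < n" for y i j
    unfolding C_def by (rule conj_diag_index[OF Uc that])
  define W where "W = x ` {..<n}"
  have W: "finite W" by (simp add: W_def)
  show ?case
  proof (cases "card W \<le> n - k - 1")
    case True
    thus ?thesis using van Her_strat_conj_diag[OF U] unfolding W_def by blast
  next
    case False
    obtain b where b: "\<And>u v. (u, v) \<in> ordered_pairs W \<Longrightarrow> b u \<noteq> b v"
      "inj_on (\<lambda>(u, v). (b v - b u) / (v - u)) (ordered_pairs W)"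
      using generic_slopes[OF W] by metis
    \<comment> \<open>The direction depends on the eigenvalue and not on its position, so equal
      eigenvalues stay equal along the line and their number can only drop.\<close>
    have line: "C (\<lambda>i. x i + s * b (x i)) = C x + complex_of_real s \<cdot>\<^sub>m C (\<lambda>i. b (x i))" for s
    proof (rule eq_matI)
      fix y z assume "y < dim_row (C x + complex_of_real s \<cdot>\<^sub>m C (\<lambda>i. b (x i)))"
        "z < dim_col (C x + complex_of_real s \<cdot>\<^sub>m C (\<lambda>i. b (x i)))"
      hence yz: "y < n" "z < n" using Cc[of "\<lambda>i. b (x i)"] by auto
      show "C (\<lambda>i. x i + s * b (x i)) $$ (y, z) = (C x + complex_of_real s \<cdot>\<^sub>m C (\<lambda>i. b (x i))) $$ (y, z)"
        using yz Cc[of x] Cc[of "\<lambda>i. b (x i)"]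
        by (simp add: Ci sum.distrib algebra_simps sum_distrib_left)
    qed (use Cc[of "\<lambda>i. b (x i)"] Cc[of "\<lambda>i. x i + s * b (x i)"] in auto)
    obtain P where P: "degree P \<le> d" "\<And>s. p (C (\<lambda>i. x i + s * b (x i))) = poly P s"
      using hpoly_line[OF p Cc Cc, of x "\<lambda>i. b (x i)"] unfolding line by blast
    define r where "r = (\<lambda>(u, v). (b v - b u) / (v - u))"
    \<comment> \<open>The parameter at which the eigenvalues u and v collide, obtained by solving u
      + s b(u) = v + s b(v). Distinct slopes give distinct parameters.\<close>
    let ?s = "\<lambda>w. - inverse (r w)"
    have root: "poly P (?s w) = 0" if w: "w \<in> ordered_pairs W" for w
    proof -
      obtain u v where uv: "w = (u, v)" "u \<in> W" "v \<in> W" "u < v" using w by (auto simp: ordered_pairs_def)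
      define s where "s = ?s w"
      let ?f = "\<lambda>w. w + s * b w"
      have bb: "b v - b u \<noteq> 0" using b(1)[of u v] w uv by simp
      have "?f u = ?f v" using bb by (simp add: s_def r_def uv(1) field_simps)
      hence "\<not> inj_on ?f W" using uv by (auto simp: inj_on_def)
      hence "card (?f ` W) < card W"
        using W card_image_le[OF W, of ?f] eq_card_imp_inj_on[OF W, of ?f] by linarith
      moreover have "(\<lambda>i. x i + s * b (x i)) ` {..<n} = ?f ` W" by (auto simp: W_def)
      ultimately have "p (C (\<lambda>i. x i + s * b (x i))) = 0"
        using less.hyps[of "\<lambda>i. x i + s * b (x i)"] unfolding C_def W_def by simp
      thus ?thesis unfolding P(2) s_def .
    qed
    have "inj_on ?s (ordered_pairs W)"
      using b(2) unfolding inj_on_def by (simp add: r_def)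
    hence cd: "card (?s ` ordered_pairs W) = card W choose 2"
      by (simp add: card_image card_ordered_pairs[OF W])
    have "P = 0"
    proof (rule ccontr)
      assume P0: "P \<noteq> 0"
      have "card W choose 2 \<le> card {s. poly P s = 0}"
        unfolding cd[symmetric] using root poly_roots_finite[OF P0] by (intro card_mono) auto
      also have "\<dots> \<le> d" using card_poly_roots_bound[OF P0] P(1) by simp
      finally have "card W choose 2 < (n - k) choose 2" using d by simp
      moreover have "(n - k) choose 2 \<le> card W choose 2" using False by (intro binomial_right_mono) simp
      ultimately show False by simp
    qed
    thus ?thesis using P(2)[of 0] by (simp add: C_def)
  qed
qed

text \<open>\<open>hconst\<close> provides constants in degree 0 only, so in positive degree zero is
  obtained as zero times a matrix entry, and an entry must exist.\<close>

lemma hpoly_zero: "n > 0 \<Longrightarrow> hpoly n d (\<lambda>A. 0)"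
proof (induction d)
  case 0
  show ?case by (rule hconst)
next
  case (Suc d)
  have "hpoly n (d + 1) (\<lambda>A. 0 * Re (A $$ (0, 0)))"
    by (rule hmult[OF Suc.IH hre]) (use Suc.prems in auto)
  thus ?case by simp
qed

lemma vanish_comp_low_degree:
  assumes n: "n > 0" and d: "d < (n - k) choose 2"
  shows "vanish_comp n (Her_strat n k) d = {\<lambda>A. 0}"
proof
  show "{\<lambda>A. 0} \<subseteq> vanish_comp n (Her_strat n k) d"
    using hpoly_zero[OF n] by (auto simp: vanish_comp_def hom_comp_def)
  show "vanish_comp n (Her_strat n k) d \<subseteq> {\<lambda>A. 0}"
  proof
    fix f assume f: "f \<in> vanish_comp n (Her_strat n k) d"
    then obtain p where p: "hpoly n d p" "\<forall>A\<in>Her n. f A = p A"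
      by (auto simp: vanish_comp_def hom_comp_def)
    have "f A = 0" for A
    proof (cases "A \<in> Her n")
      case True
      then obtain U a where U: "U \<in> SUn n" "A = U * diag_of n (\<lambda>i. complex_of_real (a i)) * mat_adjoint U"
        using Hermitian_diagonalization n by blast
      have "p B = 0" if "B \<in> Her_strat n k" for B
        using that f p by (auto simp: vanish_comp_def Her_strat_def)
      hence "p A = 0" unfolding U(2) using hpoly_vanish[OF p(1) d _ SUn_unitaries[OF U(1)]] by blast
      thus ?thesis using p True by simp
    next
      case False
      thus ?thesis using f by (auto simp: vanish_comp_def hom_comp_def)
    qed
    thus "f \<in> {\<lambda>A. 0}" by auto
  qed
qed

section \<open>The subdiscriminant as a norm\<close>

lemma order_prod_list_linear:
  fixes xs :: "'a :: field list"
  shows "order x (prod_list (map (\<lambda>l. [:- l, 1:]) xs)) = count (mset xs) x"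
proof (induction xs)
  case (Cons a xs)
  have "prod_list (map (\<lambda>l. [:- l, 1:]) (a # xs)) \<noteq> 0" unfolding prod_list_zero_iff by auto
  hence "order x (prod_list (map (\<lambda>l. [:- l, 1:]) (a # xs))) =
    order x [:- a, 1:] + order x (prod_list (map (\<lambda>l. [:- l, 1:]) xs))"
    by (simp only: list.map prod_list.Cons) (rule order_mult, simp)
  moreover have "order x [:- a, 1:] = (if x = a then 1 else 0)"
    using order_power_n_n[of a 1] by (auto simp: order_0I)
  ultimately show ?case using Cons by simp
qed simp

text \<open>The symmetry is visible on the sum over all index functions, where permuting the list
  amounts to composing each index function with a permutation. \<open>restrict\<close> keeps the
  composites in the extensional function space.\<close>

lemma sDisc_list_mset:
  assumes m: "mset ls = mset ls'" and l: "length ls' = n"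
  shows "sDisc_list n k ls = sDisc_list n k ls'"
proof -
  obtain p where p: "p permutes {..<n}" "permute_list p ls' = ls"
    using mset_eq_permutation[OF m] l by blast
  define N where "N = n - k"
  have nth: "ls ! i = ls' ! p i" if "i < n" for i
    using p l that permute_list_nth[of p ls' i] by auto
  let ?f = "\<lambda>\<kappa>. restrict (p \<circ> \<kappa>) {..<N}" and ?g = "\<lambda>\<kappa>. restrict (inv_into UNIV p \<circ> \<kappa>) {..<N}"
  have pl: "p i < n" if "i < n" for i using that permutes_in_image[OF p(1), of i] by auto
  have q: "inv_into UNIV p permutes {..<n}" using p(1) by (rule permutes_inv)
  have ql: "inv_into UNIV p i < n" if "i < n" for i using that permutes_in_image[OF q, of i] by auto
  have f: "?f \<kappa> \<in> index_fun N n" if "\<kappa> \<in> index_fun N n" for \<kappa>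
    using index_fun_less[OF that] pl unfolding index_fun_def restrict_PiE_iff by simp
  have g: "?g \<kappa> \<in> index_fun N n" if "\<kappa> \<in> index_fun N n" for \<kappa>
    using index_fun_less[OF that] ql unfolding index_fun_def restrict_PiE_iff by simp
  have "bij_betw ?f (index_fun N n) (index_fun N n)"
  proof (rule bij_betwI[where g = ?g])
    show "?f \<in> index_fun N n \<rightarrow> index_fun N n" "?g \<in> index_fun N n \<rightarrow> index_fun N n"
      using f g by blast+
    show "?g (?f \<kappa>) = \<kappa>" if "\<kappa> \<in> index_fun N n" for \<kappa>
      by (rule index_fun_eqI[OF g[OF f[OF that]] that]) (simp add: permutes_inverses[OF p(1)])
    show "?f (?g \<kappa>) = \<kappa>" if "\<kappa> \<in> index_fun N n" for \<kappa>
      by (rule index_fun_eqI[OF f[OF g[OF that]] that]) (simp add: permutes_inverses[OF p(1)])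
  qed
  hence "(\<Sum>\<kappa>\<in>index_fun N n. (vdm N ((!) ls' \<circ> \<kappa>))\<^sup>2) = (\<Sum>\<kappa>\<in>index_fun N n. (vdm N ((!) ls' \<circ> ?f \<kappa>))\<^sup>2)"
    by (rule sum.reindex_bij_betw[symmetric])
  also have "\<dots> = (\<Sum>\<kappa>\<in>index_fun N n. (vdm N ((!) ls \<circ> \<kappa>))\<^sup>2)"
  proof (rule sum.cong[OF refl])
    fix \<kappa> assume k: "\<kappa> \<in> index_fun N n"
    have "vdm N ((!) ls' \<circ> ?f \<kappa>) = vdm N ((!) ls \<circ> \<kappa>)"
      unfolding vdm_def
    proof (intro prod.cong refl)
      fix j i assume "j \<in> {..<N}" "i \<in> {..<j}"
      thus "((!) ls' \<circ> ?f \<kappa>) j - ((!) ls' \<circ> ?f \<kappa>) i = ((!) ls \<circ> \<kappa>) j - ((!) ls \<circ> \<kappa>) i"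
        using index_fun_less[OF k, of i] index_fun_less[OF k, of j] by (simp add: nth)
    qed
    thus "(vdm N ((!) ls' \<circ> ?f \<kappa>))\<^sup>2 = (vdm N ((!) ls \<circ> \<kappa>))\<^sup>2" by simp
  qed
  finally have "fact N * sDisc_list n k ls' = fact N * sDisc_list n k ls"
    unfolding sum_vdm_eq_sDisc_list[OF N_def] .
  thus ?thesis by simp
qed

text \<open>The eigenvalue list selected by \<open>SOME\<close> may come in any order. Root
  multiplicities of the characteristic polynomial determine its multiset, which is all that the
  subdiscriminant sees.\<close>

lemma sDisc_conj_diag:
  assumes U: "U \<in> unitaries n"
  shows "sDisc n k (U * diag_of n a * mat_adjoint U) = sDisc_list n k (map a [0..<n])"
proof -
  define A where "A = U * diag_of n a * mat_adjoint U"
  note U' = unitariesD[OF U]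
  have "similar_mat A (diag_of n a)"
    unfolding similar_mat_def similar_mat_wit_def A_def using U'
    by (intro exI[of _ U] exI[of _ "mat_adjoint U"]) (auto simp: Let_def)
  hence "char_poly A = char_poly (diag_of n a)" by (rule char_poly_similar)
  also have "\<dots> = (\<Prod>l\<leftarrow>diag_mat (diag_of n a). [:- l, 1:])"
    by (rule char_poly_upper_triangular[where n = n]) (auto simp: upper_triangular_def)
  also have "diag_mat (diag_of n a) = map a [0..<n]" by (auto simp: diag_mat_def)
  finally have ch: "char_poly A = prod_list (map (\<lambda>l. [:- l, 1:]) (map a [0..<n]))" .
  let ?P = "\<lambda>ls. length ls = n \<and> char_poly A = prod_list (map (\<lambda>l. [:- l, 1:]) ls)"
  define ls where "ls = (SOME ls. ?P ls)"
  have "?P (map a [0..<n])" using ch by simp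
  hence "?P ls" unfolding ls_def by (rule someI)
  hence "mset ls = mset (map a [0..<n])"
    using ch by (intro multiset_eqI) (metis order_prod_list_linear)
  thus ?thesis unfolding A_def[symmetric] sDisc_def ls_def[symmetric]
    by (rule sDisc_list_mset) simp
qed

lemma sum_krylov_conj_diag:
  assumes U: "U \<in> unitaries n"
  shows "(\<Sum>l\<in>index_fun N n \<times> index_fun N n. (cmod (krylov N (U * diag_of n a * mat_adjoint U) l))\<^sup>2) =
    fact N * (\<Sum>\<kappa>\<in>index_fun N n. (cmod (vdm N (a \<circ> \<kappa>)))\<^sup>2)"
proof -
  have "complex_of_real (\<Sum>l\<in>index_fun N n \<times> index_fun N n. (cmod (krylov N (U * diag_of n a * mat_adjoint U) l))\<^sup>2)
    = of_real (\<Sum>l\<in>index_fun N n \<times> index_fun N n. (cmod (krylov N (diag_of n a) l))\<^sup>2)"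
    using ip_krylov_unitary[OF unitaries_adjoint[OF U], of "diag_of n a" N]
    unfolding ip_self by simp
  thus ?thesis unfolding of_real_eq_iff sum_krylov_diag .
qed

text \<open>One factor N! counts the rearranged rows for each column map, the other the enumerations
  of each set of N eigenvalues. The eigenvalues are real, so squared moduli of Vandermonde products
  are plain squares.\<close>

lemma sum_krylov_eq_sDisc:
  assumes A: "A \<in> Her n" and n: "n > 0" and N: "N = n - k"
  shows "complex_of_real (\<Sum>l\<in>index_fun N n \<times> index_fun N n. (cmod (krylov N A l))\<^sup>2) =
    (fact N)\<^sup>2 * sDisc n k A"
proof -
  obtain U a where U: "U \<in> SUn n" "A = U * diag_of n (\<lambda>i. complex_of_real (a i)) * mat_adjoint U"
    using Hermitian_diagonalization[OF A n] by blast
  let ?a = "\<lambda>i. complex_of_real (a i)"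
  have sq: "complex_of_real ((cmod (vdm N (?a \<circ> \<kappa>)))\<^sup>2) = (vdm N ((!) (map ?a [0..<n]) \<circ> \<kappa>))\<^sup>2"
    if k: "\<kappa> \<in> index_fun N n" for \<kappa>
  proof -
    have "vdm N (?a \<circ> \<kappa>) = of_real (vdm N (a \<circ> \<kappa>))" by (simp add: vdm_def)
    moreover have "vdm N ((!) (map ?a [0..<n]) \<circ> \<kappa>) = vdm N (?a \<circ> \<kappa>)"
      by (auto simp: vdm_def index_fun_less[OF k] intro!: prod.cong)
    ultimately show ?thesis by simp
  qed
  have "complex_of_real (\<Sum>l\<in>index_fun N n \<times> index_fun N n. (cmod (krylov N A l))\<^sup>2) =
    fact N * (\<Sum>\<kappa>\<in>index_fun N n. complex_of_real ((cmod (vdm N (?a \<circ> \<kappa>)))\<^sup>2))"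
    unfolding U(2) sum_krylov_conj_diag[OF SUn_unitaries[OF U(1)]] by simp
  also have "\<dots> = fact N * (\<Sum>\<kappa>\<in>index_fun N n. (vdm N ((!) (map ?a [0..<n]) \<circ> \<kappa>))\<^sup>2)"
    by (simp only: sq cong: sum.cong)
  also have "\<dots> = fact N * (fact N * sDisc n k A)"
    unfolding sum_vdm_eq_sDisc_list[OF N] U(2) sDisc_conj_diag[OF SUn_unitaries[OF U(1)]] ..
  finally show ?thesis by (simp add: power2_eq_square)
qed

text \<open>With fewer than N distinct eigenvalues every Vandermonde product vanishes, hence so does
  the sum of squared moduli and each coordinate with it.\<close>

lemma krylov_vanish_strat:
  assumes A: "A \<in> Her_strat n k" and n: "n > 0" and N: "N = n - k" "N > 0"
    and l: "l \<in> index_fun N n \<times> index_fun N n"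
  shows "krylov N A l = 0"
proof -
  have "A \<in> Her n" using A by (simp add: Her_strat_def)
  then obtain U a where U: "U \<in> SUn n" "A = U * diag_of n (\<lambda>i. complex_of_real (a i)) * mat_adjoint U"
    using Hermitian_diagonalization n by blast
  have cd: "card (a ` {..<n}) < N"
    using A Her_strat_conj_diag[OF SUn_unitaries[OF U(1)], of a k] N unfolding U(2) by linarith
  have "vdm N ((\<lambda>i. complex_of_real (a i)) \<circ> \<kappa>) = 0" if k: "\<kappa> \<in> index_fun N n" for \<kappa>
  proof (rule ccontr)
    assume "vdm N ((\<lambda>i. complex_of_real (a i)) \<circ> \<kappa>) \<noteq> 0"
    hence "inj_on (\<lambda>i. complex_of_real (a (\<kappa> i))) {..<N}" by (simp add: vdm_eq_0_iff o_def)
    hence "inj_on (\<lambda>i. a (\<kappa> i)) {..<N}" by (simp add: inj_on_def)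
    hence "N = card ((\<lambda>i. a (\<kappa> i)) ` {..<N})" by (simp add: card_image)
    also have "\<dots> \<le> card (a ` {..<n})"
      by (intro card_mono) (auto simp: index_fun_less[OF k])
    finally show False using cd by simp
  qed
  hence "(\<Sum>l\<in>index_fun N n \<times> index_fun N n. (cmod (krylov N A l))\<^sup>2) = 0"
    unfolding U(2) sum_krylov_conj_diag[OF SUn_unitaries[OF U(1)]] by simp
  thus ?thesis using l by (subst (asm) sum_nonneg_eq_0_iff) auto
qed

section \<open>Diagonal, permutation and triangular substitutions\<close>

lemma sum_single:
  fixes f :: "'b \<Rightarrow> 'a :: comm_monoid_add"
  assumes "finite K" "x \<in> K" "\<And>y. y \<in> K \<Longrightarrow> y \<noteq> x \<Longrightarrow> f y = 0"
  shows "sum f K = f x"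
proof -
  have "sum f K = sum f {x}" by (rule sum.mono_neutral_right) (use assms in auto)
  thus ?thesis by simp
qed

text \<open>Every coordinate is a weight vector for the diagonal torus: the column indices enter its
  weight positively, the row indices negatively.\<close>

lemma krylov_conj_diag:
  assumes A: "A \<in> carrier_mat n n" and gh: "\<And>i. i < n \<Longrightarrow> g i * h i = 1"
    and x: "\<tau> \<in> index_fun N n" "\<kappa> \<in> index_fun N n"
  shows "krylov N (diag_of n h * A * diag_of n g) (\<tau>, \<kappa>) =
    (\<Prod>i<N. h (\<tau> i) * g (\<kappa> i)) * krylov N A (\<tau>, \<kappa>)"
proof -
  let ?K = "index_fun N n \<times> index_fun N n"
  have gh1: "diag_of n g * diag_of n h = 1\<^sub>m n"
  proof (rule eq_matI)
    fix i j assume "i < dim_row (1\<^sub>m n)" "j < dim_col (1\<^sub>m n)"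
    hence ij: "i < n" "j < n" by auto
    have "(diag_of n g * diag_of n h) $$ (i, j) = (\<Sum>l<n. diag_of n g $$ (i, l) * diag_of n h $$ (l, j))"
      using ij by (simp add: scalar_prod_def atLeast0LessThan)
    also have "\<dots> = diag_of n g $$ (i, i) * diag_of n h $$ (i, j)"
      using ij by (intro sum_single) auto
    finally show "(diag_of n g * diag_of n h) $$ (i, j) = 1\<^sub>m n $$ (i, j)" using ij gh by auto
  qed auto
  have "krylov N (diag_of n h * A * diag_of n g) (\<tau>, \<kappa>) =
    (\<Sum>y\<in>?K. tensor_act N (diag_of n g) (diag_of n h) (\<tau>, \<kappa>) y * krylov N A y)"
    by (rule krylov_conj) (use A gh1 x in auto)
  also have "\<dots> = tensor_act N (diag_of n g) (diag_of n h) (\<tau>, \<kappa>) (\<tau>, \<kappa>) * krylov N A (\<tau>, \<kappa>)"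
  proof (rule sum_single)
    fix y assume y: "y \<in> ?K" "y \<noteq> (\<tau>, \<kappa>)"
    obtain \<tau>' \<kappa>' where ye: "y = (\<tau>', \<kappa>')" by (cases y)
    have t: "\<tau>' \<in> index_fun N n" "\<kappa>' \<in> index_fun N n" using y ye by auto
    have "\<exists>i<N. \<tau> i \<noteq> \<tau>' i \<or> \<kappa> i \<noteq> \<kappa>' i"
      using y ye index_fun_eqI[OF x(1) t(1)] index_fun_eqI[OF x(2) t(2)] by blast
    then obtain i where i: "i < N" "\<tau> i \<noteq> \<tau>' i \<or> \<kappa> i \<noteq> \<kappa>' i" by blast
    have "diag_of n h $$ (\<tau> i, \<tau>' i) * diag_of n g $$ (\<kappa>' i, \<kappa> i) = 0"
      using i index_fun_less[OF x(1) i(1)] index_fun_less[OF x(2) i(1)]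
        index_fun_less[OF t(1) i(1)] index_fun_less[OF t(2) i(1)] by auto
    hence "tensor_act N (diag_of n g) (diag_of n h) (\<tau>, \<kappa>) y = 0"
      unfolding tensor_act_def ye split using i(1) by (intro prod_zero) auto
    thus "tensor_act N (diag_of n g) (diag_of n h) (\<tau>, \<kappa>) y * krylov N A y = 0" by simp
  qed (use x in auto)
  also have "tensor_act N (diag_of n g) (diag_of n h) (\<tau>, \<kappa>) (\<tau>, \<kappa>) = (\<Prod>i<N. h (\<tau> i) * g (\<kappa> i))"
    unfolding tensor_act_def split using index_fun_less[OF x(1)] index_fun_less[OF x(2)]
    by (intro prod.cong) auto
  finally show ?thesis .
qed

definition perm_mat :: "nat \<Rightarrow> (nat \<Rightarrow> nat) \<Rightarrow> complex mat" where
  "perm_mat n \<rho> = mat n n (\<lambda>(a, b). if a = \<rho> b then 1 else 0)"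

lemma perm_mat_unitary:
  assumes r: "\<rho> permutes {..<n}"
  shows "perm_mat n \<rho> \<in> unitaries n"
proof (rule unitariesI)
  have rl: "\<rho> i < n" if "i < n" for i using that permutes_in_image[OF r, of i] by auto
  show "mat_adjoint (perm_mat n \<rho>) * perm_mat n \<rho> = 1\<^sub>m n"
  proof (rule eq_matI)
    fix i j assume "i < dim_row (1\<^sub>m n)" "j < dim_col (1\<^sub>m n)"
    hence ij: "i < n" "j < n" by auto
    have "(mat_adjoint (perm_mat n \<rho>) * perm_mat n \<rho>) $$ (i, j) =
      (\<Sum>l<n. (if l = \<rho> i then 1 else 0) * (if l = \<rho> j then 1 else 0))"
      using ij by (auto simp: scalar_prod_def atLeast0LessThan perm_mat_def intro!: sum.cong)
    also have "\<dots> = (if \<rho> i = \<rho> j then 1 else 0)"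
      using rl[OF ij(1)] by (subst sum_single[of _ "\<rho> i"]) auto
    also have "\<dots> = (if i = j then 1 else 0)" using permutes_inj[OF r] by (auto simp: inj_def)
    finally show "(mat_adjoint (perm_mat n \<rho>) * perm_mat n \<rho>) $$ (i, j) = 1\<^sub>m n $$ (i, j)" using ij by simp
  qed (auto simp: perm_mat_def)
qed (simp add: perm_mat_def)

text \<open>The relabelled maps \<tau>' and \<kappa>' are separate parameters, tied to \<rho> only
  on the N positions, because composing with \<rho> on the left need not give an extensional
  function.\<close>

lemma krylov_conj_perm:
  assumes A: "A \<in> carrier_mat n n" and r: "\<rho> permutes {..<n}"
    and x: "\<tau> \<in> index_fun N n" "\<kappa> \<in> index_fun N n"
    and y: "\<tau>' \<in> index_fun N n" "\<kappa>' \<in> index_fun N n"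
    and eq: "\<And>i. i < N \<Longrightarrow> \<tau>' i = \<rho> (\<tau> i)" "\<And>i. i < N \<Longrightarrow> \<kappa>' i = \<rho> (\<kappa> i)"
  shows "krylov N (mat_adjoint (perm_mat n \<rho>) * A * perm_mat n \<rho>) (\<tau>, \<kappa>) = krylov N A (\<tau>', \<kappa>')"
proof -
  let ?K = "index_fun N n \<times> index_fun N n" and ?P = "perm_mat n \<rho>"
  note U = unitariesD[OF perm_mat_unitary[OF r]]
  have e: "?P $$ (a, b) = (if a = \<rho> b then 1 else 0)" "mat_adjoint ?P $$ (b, a) = (if a = \<rho> b then 1 else 0)"
    if "a < n" "b < n" for a b using that U(1) by (auto simp: perm_mat_def)
  have "krylov N (mat_adjoint ?P * A * ?P) (\<tau>, \<kappa>) = (\<Sum>y\<in>?K. tensor_act N ?P (mat_adjoint ?P) (\<tau>, \<kappa>) y * krylov N A y)"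
    by (rule krylov_conj) (use A U x in auto)
  also have "\<dots> = tensor_act N ?P (mat_adjoint ?P) (\<tau>, \<kappa>) (\<tau>', \<kappa>') * krylov N A (\<tau>', \<kappa>')"
  proof (rule sum_single)
    fix z assume z: "z \<in> ?K" "z \<noteq> (\<tau>', \<kappa>')"
    obtain \<tau>2 \<kappa>2 where ze: "z = (\<tau>2, \<kappa>2)" by (cases z)
    have t: "\<tau>2 \<in> index_fun N n" "\<kappa>2 \<in> index_fun N n" using z ze by auto
    have "\<exists>i<N. \<tau>2 i \<noteq> \<tau>' i \<or> \<kappa>2 i \<noteq> \<kappa>' i"
      using z ze index_fun_eqI[OF t(1) y(1)] index_fun_eqI[OF t(2) y(2)] by blast
    then obtain i where i: "i < N" "\<tau>2 i \<noteq> \<tau>' i \<or> \<kappa>2 i \<noteq> \<kappa>' i" by blast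
    have "mat_adjoint ?P $$ (\<tau> i, \<tau>2 i) * ?P $$ (\<kappa>2 i, \<kappa> i) = 0"
      using i eq[OF i(1)] index_fun_less[OF x(1) i(1)] index_fun_less[OF x(2) i(1)]
        index_fun_less[OF t(1) i(1)] index_fun_less[OF t(2) i(1)] by (auto simp: e)
    hence "tensor_act N ?P (mat_adjoint ?P) (\<tau>, \<kappa>) z = 0"
      unfolding tensor_act_def ze split using i(1) by (intro prod_zero) auto
    thus "tensor_act N ?P (mat_adjoint ?P) (\<tau>, \<kappa>) z * krylov N A z = 0" by simp
  qed (use y in auto)
  also have "tensor_act N ?P (mat_adjoint ?P) (\<tau>, \<kappa>) (\<tau>', \<kappa>') = 1"
    unfolding tensor_act_def split
    using index_fun_less[OF x(1)] index_fun_less[OF x(2)] index_fun_less[OF y(1)] index_fun_less[OF y(2)] eq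
    by (intro prod.neutral) (auto simp: e)
  finally show ?thesis by simp
qed

lemma unitriangular_inverse:
  assumes u: "upper_unitriangular n u" and h: "h \<in> carrier_mat n n" and hu: "h * u = 1\<^sub>m n"
  shows "upper_unitriangular n h"
  unfolding upper_unitriangular_def
proof (intro conjI h allI impI)
  have uc: "u \<in> carrier_mat n n" using u by (simp add: upper_unitriangular_def)
  have ut: "u $$ (l, j) = (if l = j then 1 else 0)" if "j \<le> l" "l < n" for l j
    using u that by (auto simp: upper_unitriangular_def)
  have main: "j \<le> i \<longrightarrow> h $$ (i, j) = (if i = j then 1 else 0)" if "i < n" "j < n" for i j
    using that(2)
  proof (induction j rule: less_induct)
    case (less j)
    show ?case
    proof
      assume ji: "j \<le> i"
      have "(h * u) $$ (i, j) = (\<Sum>l<n. h $$ (i, l) * u $$ (l, j))"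
        using h uc that less by (simp add: scalar_prod_def atLeast0LessThan)
      also have "\<dots> = h $$ (i, j) * u $$ (j, j)"
      proof (rule sum_single)
        fix l assume l: "l \<in> {..<n}" "l \<noteq> j"
        show "h $$ (i, l) * u $$ (l, j) = 0"
        proof (cases "l < j")
          case True
          thus ?thesis using less.IH[of l] l ji by auto
        next
          case False
          thus ?thesis using ut[of j l] l by auto
        qed
      qed (use less in auto)
      finally show "h $$ (i, j) = (if i = j then 1 else 0)"
        using hu ut[of j j] that less by simp
    qed
  qed
  fix i j assume "i < n" "j < n"
  thus "j < i \<Longrightarrow> h $$ (i, j) = 0" "i = j \<Longrightarrow> h $$ (i, j) = 1" using main[of i j] by auto
qed

section \<open>Polarisation\<close>

text \<open>Ryser's formula for the permanent. Expanding the right side over all maps f,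
  inclusion-exclusion over the sets containing the image cancels every f that is not surjective, and
  the surjective ones are the permutations.\<close>

lemma ryser:
  fixes x :: "nat \<Rightarrow> nat \<Rightarrow> complex"
  shows "(\<Sum>\<sigma>\<in>Perms N. \<Prod>j<N. x j (\<sigma> j)) =
    (\<Sum>T\<in>Pow {..<N}. (-1) ^ card ({..<N} - T) * (\<Prod>j<N. \<Sum>t\<in>T. x j t))"
proof -
  let ?F = "index_fun N N"
  have incl: "(\<Sum>T\<in>Pow {..<N}. (-1) ^ card ({..<N} - T) * (if S \<subseteq> T then 1 else 0)) =
    (if S = {..<N} then 1 else (0 :: complex))" if S: "S \<subseteq> {..<N}" for S
  proof -
    \<comment> \<open>The alternating sum over supersets of \<open>S\<close> is the expansion of
      this product, which has a zero factor at every index outside \<open>S\<close>.\<close>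
    have "(\<Prod>i<N. (1 :: complex) + (if i \<in> S then 0 else -1)) =
      (\<Sum>T\<in>Pow {..<N}. (\<Prod>i\<in>T. 1) * (\<Prod>i\<in>{..<N} - T. if i \<in> S then 0 else -1))"
      by (rule prod_add) simp
    also have "\<dots> = (\<Sum>T\<in>Pow {..<N}. (-1) ^ card ({..<N} - T) * (if S \<subseteq> T then 1 else 0))"
    proof (rule sum.cong[OF refl])
      fix T assume T: "T \<in> Pow {..<N}"
      show "(\<Prod>i\<in>T. 1) * (\<Prod>i\<in>{..<N} - T. if i \<in> S then 0 else -1) =
        ((-1) ^ card ({..<N} - T) * (if S \<subseteq> T then 1 else 0) :: complex)"
      proof (cases "S \<subseteq> T")
        case True
        hence "(\<Prod>i\<in>{..<N} - T. if i \<in> S then 0 else -1) = (\<Prod>i\<in>{..<N} - T. -1 :: complex)"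
          by (intro prod.cong) auto
        thus ?thesis using True by simp
      next
        case False
        hence "(\<Prod>i\<in>{..<N} - T. if i \<in> S then 0 else -1) = (0 :: complex)"
          using S by (intro prod_zero) auto
        thus ?thesis using False by simp
      qed
    qed
    also have "(\<Prod>i<N. (1 :: complex) + (if i \<in> S then 0 else -1)) = (if S = {..<N} then 1 else 0)"
    proof (cases "S = {..<N}")
      case False
      then obtain i where "i < N" "i \<notin> S" using S by auto
      hence "(\<Prod>i<N. (1 :: complex) + (if i \<in> S then 0 else -1)) = 0" by (intro prod_zero) auto
      thus ?thesis using False by simp
    qed auto
    finally show ?thesis by simp
  qed
  have "(\<Sum>T\<in>Pow {..<N}. (-1) ^ card ({..<N} - T) * (\<Prod>j<N. \<Sum>t\<in>T. x j t)) =
    (\<Sum>T\<in>Pow {..<N}. \<Sum>f\<in>?F. (-1) ^ card ({..<N} - T) * (if f ` {..<N} \<subseteq> T then 1 else 0) * (\<Prod>j<N. x j (f j)))"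
  proof (rule sum.cong[OF refl])
    fix T assume "T \<in> Pow {..<N}"
    hence T: "T \<subseteq> {..<N}" "finite T" by (auto intro: finite_subset)
    have "(\<Prod>j<N. \<Sum>t\<in>T. x j t) = (\<Sum>f\<in>{..<N} \<rightarrow>\<^sub>E T. \<Prod>j<N. x j (f j))"
      by (rule prod_sum_PiE) (use T in auto)
    also have "\<dots> = (\<Sum>f\<in>?F. if f ` {..<N} \<subseteq> T then (\<Prod>j<N. x j (f j)) else 0)"
    proof -
      have "{f \<in> ?F. f ` {..<N} \<subseteq> T} = {..<N} \<rightarrow>\<^sub>E T"
        using T by (fastforce simp: index_fun_def PiE_iff extensional_def)
      thus ?thesis by (subst sum.inter_filter[symmetric]) auto
    qed
    finally show "(-1) ^ card ({..<N} - T) * (\<Prod>j<N. \<Sum>t\<in>T. x j t) =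
      (\<Sum>f\<in>?F. (-1) ^ card ({..<N} - T) * (if f ` {..<N} \<subseteq> T then 1 else 0) * (\<Prod>j<N. x j (f j)))"
      by (simp add: sum_distrib_left if_distrib if_distribR cong: if_cong)
  qed
  also have "\<dots> = (\<Sum>f\<in>?F. (\<Sum>T\<in>Pow {..<N}. (-1) ^ card ({..<N} - T) * (if f ` {..<N} \<subseteq> T then 1 else 0)) *
    (\<Prod>j<N. x j (f j)))"
    by (subst sum.swap) (simp add: sum_distrib_right)
  also have "\<dots> = (\<Sum>f\<in>?F. if f ` {..<N} = {..<N} then (\<Prod>j<N. x j (f j)) else 0)"
  proof (rule sum.cong[OF refl])
    fix f assume "f \<in> ?F"
    hence "f ` {..<N} \<subseteq> {..<N}" by (auto simp: index_fun_less)
    thus "(\<Sum>T\<in>Pow {..<N}. (-1) ^ card ({..<N} - T) * (if f ` {..<N} \<subseteq> T then 1 else 0)) *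
      (\<Prod>j<N. x j (f j)) = (if f ` {..<N} = {..<N} then (\<Prod>j<N. x j (f j)) else 0)"
      by (simp only: incl) simp
  qed
  also have "\<dots> = (\<Sum>f\<in>{f \<in> ?F. f ` {..<N} = {..<N}}. \<Prod>j<N. x j (f j))"
    by (subst sum.inter_filter) auto
  also have "\<dots> = (\<Sum>\<sigma>\<in>Perms N. \<Prod>j<N. x j (restrict \<sigma> {..<N} j))"
  proof (rule sum.reindex_bij_betw[symmetric], rule bij_betwI[where g = "\<lambda>f i. if i < N then f i else i"])
    show "(\<lambda>\<sigma>. restrict \<sigma> {..<N}) \<in> Perms N \<rightarrow> {f \<in> ?F. f ` {..<N} = {..<N}}"
    proof
      fix \<sigma> assume s: "\<sigma> \<in> Perms N"
      have "restrict \<sigma> {..<N} \<in> ?F" unfolding index_fun_def restrict_PiE_iff using Perms_less[OF s] by simp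
      thus "restrict \<sigma> {..<N} \<in> {f \<in> ?F. f ` {..<N} = {..<N}}" using s permutes_image[of \<sigma> "{..<N}"] by simp
    qed
    show "(\<lambda>f i. if i < N then f i else i) \<in> {f \<in> ?F. f ` {..<N} = {..<N}} \<rightarrow> Perms N"
    proof
      fix f assume f: "f \<in> {f \<in> ?F. f ` {..<N} = {..<N}}"
      let ?g = "\<lambda>i. if i < N then f i else i"
      have "?g ` {..<N} = f ` {..<N}" by (rule image_cong) auto
      hence "?g ` {..<N} = {..<N}" using f by simp
      hence "bij_betw ?g {..<N} {..<N}" by (simp add: bij_betw_def eq_card_imp_inj_on)
      hence "?g permutes {..<N}" by (rule bij_imp_permutes) simp
      thus "?g \<in> Perms N" by simp
    qed
    show "(\<lambda>i. if i < N then restrict \<sigma> {..<N} i else i) = \<sigma>" if "\<sigma> \<in> Perms N" for \<sigma>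
      using that permutes_not_in[of \<sigma> "{..<N}"] by (auto simp: fun_eq_iff)
    show "restrict (\<lambda>i. if i < N then f i else i) {..<N} = f" if "f \<in> {f \<in> ?F. f ` {..<N} = {..<N}}" for f
      using that by (auto simp: fun_eq_iff index_fun_def PiE_def extensional_def)
  qed
  also have "\<dots> = (\<Sum>\<sigma>\<in>Perms N. \<Prod>j<N. x j (\<sigma> j))" by simp
  finally show ?thesis by simp
qed

lemma sum_krylov_power:
  assumes A: "A \<in> carrier_mat n n" and t: "\<tau> \<in> index_fun N n"
  shows "(\<Sum>\<kappa>\<in>index_fun N n. (\<Prod>i<N. w (\<kappa> i)) * krylov N A (\<tau>, \<kappa>)) =
    fact N * (\<Sum>\<pi>\<in>Perms N. of_int (sign \<pi>) * (\<Prod>j<N. \<Sum>a<n. (A ^\<^sub>m j) $$ (\<tau> (\<pi> j), a) * w a))"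
proof -
  let ?F = "index_fun N n"
  define H where "H \<pi> \<kappa> = of_int (sign \<pi>) * ((\<Prod>i<N. w (\<kappa> i)) * (\<Prod>j<N. (A ^\<^sub>m j) $$ (\<tau> (\<pi> j), \<kappa> j)))" for \<pi> \<kappa>
  have "(\<Sum>\<kappa>\<in>?F. (\<Prod>i<N. w (\<kappa> i)) * krylov N A (\<tau>, \<kappa>)) = (\<Sum>\<kappa>\<in>?F. \<Sum>\<pi>\<in>Perms N. \<Sum>\<sigma>\<in>Perms N. H \<pi> (\<kappa> \<circ> \<sigma>))"
  proof (rule sum.cong[OF refl])
    fix \<kappa>
    have e: "(\<Prod>i<N. w ((\<kappa> \<circ> \<sigma>) i)) = (\<Prod>i<N. w (\<kappa> i))" if "\<sigma> \<in> Perms N" for \<sigma>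
      using prod.permute[of \<sigma> "{..<N}" "\<lambda>i. w (\<kappa> i)"] that by simp
    have "(\<Sum>\<pi>\<in>Perms N. \<Sum>\<sigma>\<in>Perms N. H \<pi> (\<kappa> \<circ> \<sigma>)) =
      (\<Sum>\<pi>\<in>Perms N. \<Sum>\<sigma>\<in>Perms N. of_int (sign \<pi>) *
        ((\<Prod>i<N. w (\<kappa> i)) * (\<Prod>j<N. (A ^\<^sub>m j) $$ (\<tau> (\<pi> j), (\<kappa> \<circ> \<sigma>) j))))"
      unfolding H_def by (simp only: e cong: sum.cong)
    thus "(\<Prod>i<N. w (\<kappa> i)) * krylov N A (\<tau>, \<kappa>) = (\<Sum>\<pi>\<in>Perms N. \<Sum>\<sigma>\<in>Perms N. H \<pi> (\<kappa> \<circ> \<sigma>))"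
      unfolding krylov_def split sum_distrib_left by (simp add: mult.left_commute)
  qed
  also have "\<dots> = (\<Sum>\<pi>\<in>Perms N. \<Sum>\<sigma>\<in>Perms N. \<Sum>\<kappa>\<in>?F. H \<pi> (\<kappa> \<circ> \<sigma>))"
    by (subst sum.swap) (intro sum.cong refl sum.swap)
  also have "\<dots> = (\<Sum>\<pi>\<in>Perms N. \<Sum>\<sigma>\<in>Perms N. \<Sum>\<kappa>\<in>?F. H \<pi> \<kappa>)"
    by (intro sum.cong refl sum.reindex_bij_betw bij_betw_index_fun_comp)
  also have "\<dots> = fact N * (\<Sum>\<pi>\<in>Perms N. \<Sum>\<kappa>\<in>?F. H \<pi> \<kappa>)"
    by (simp add: card_permutations sum_distrib_left)
  also have "(\<Sum>\<pi>\<in>Perms N. \<Sum>\<kappa>\<in>?F. H \<pi> \<kappa>) =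
    (\<Sum>\<pi>\<in>Perms N. of_int (sign \<pi>) * (\<Prod>j<N. \<Sum>a<n. (A ^\<^sub>m j) $$ (\<tau> (\<pi> j), a) * w a))"
  proof (rule sum.cong[OF refl])
    fix \<pi>
    have "(\<Prod>j<N. \<Sum>a<n. (A ^\<^sub>m j) $$ (\<tau> (\<pi> j), a) * w a) =
      (\<Sum>\<kappa>\<in>?F. \<Prod>j<N. (A ^\<^sub>m j) $$ (\<tau> (\<pi> j), \<kappa> j) * w (\<kappa> j))"
      unfolding index_fun_def by (rule prod_sum_PiE) auto
    thus "(\<Sum>\<kappa>\<in>?F. H \<pi> \<kappa>) = of_int (sign \<pi>) * (\<Prod>j<N. \<Sum>a<n. (A ^\<^sub>m j) $$ (\<tau> (\<pi> j), a) * w a)"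
      unfolding H_def by (simp add: sum_distrib_left prod.distrib mult_ac)
  qed
  finally show ?thesis .
qed

text \<open>Ryser's formula in the column permutation recovers the polarised form from values at
  single vectors. The set \<open>T\<close> contributes the value at the sum of the basis vectors
  with index \<kappa> t for t in \<open>T\<close>, whose coordinate at a is the cardinality
  occurring here.\<close>

lemma krylov_polarisation:
  assumes A: "A \<in> carrier_mat n n" and t: "\<tau> \<in> index_fun N n" "\<kappa> \<in> index_fun N n"
  shows "fact N * krylov N A (\<tau>, \<kappa>) = (\<Sum>T\<in>Pow {..<N}. (-1) ^ card ({..<N} - T) *
    (\<Sum>\<kappa>'\<in>index_fun N n. (\<Prod>i<N. of_nat (card {t \<in> T. \<kappa> t = \<kappa>' i})) * krylov N A (\<tau>, \<kappa>')))"
proof -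
  have lin: "(\<Sum>a<n. x a * of_nat (card {t \<in> T. \<kappa> t = a})) = (\<Sum>t\<in>T. x (\<kappa> t))"
    if T: "T \<subseteq> {..<N}" for T and x :: "nat \<Rightarrow> complex"
  proof -
    have fT: "finite T" using T finite_subset by blast
    have "(\<Sum>t\<in>T. x (\<kappa> t)) = (\<Sum>a<n. \<Sum>t\<in>{t \<in> T. \<kappa> t = a}. x (\<kappa> t))"
      by (rule sum.group[symmetric]) (use fT T index_fun_less[OF t(2)] in auto)
    also have "\<dots> = (\<Sum>a<n. x a * of_nat (card {t \<in> T. \<kappa> t = a}))"
      by (intro sum.cong refl) (simp add: mult.commute)
    finally show ?thesis by simp
  qed
  define Z where "Z \<pi> T = (\<Prod>j<N. \<Sum>t\<in>T. (A ^\<^sub>m j) $$ (\<tau> (\<pi> j), \<kappa> t))" for \<pi> T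
  define s where "s T = (-1 :: complex) ^ card ({..<N} - T)" for T
  have "krylov N A (\<tau>, \<kappa>) = (\<Sum>\<pi>\<in>Perms N. of_int (sign \<pi>) * (\<Sum>T\<in>Pow {..<N}. s T * Z \<pi> T))"
    unfolding krylov_def split s_def Z_def
    using ryser[where x = "\<lambda>j t. (A ^\<^sub>m j) $$ (\<tau> (_ j), \<kappa> t)" and N = N]
    by (simp only: sum_distrib_left[symmetric])
  also have "\<dots> = (\<Sum>\<pi>\<in>Perms N. \<Sum>T\<in>Pow {..<N}. s T * (of_int (sign \<pi>) * Z \<pi> T))"
    by (simp only: sum_distrib_left mult.left_commute)
  also have "\<dots> = (\<Sum>T\<in>Pow {..<N}. s T * (\<Sum>\<pi>\<in>Perms N. of_int (sign \<pi>) * Z \<pi> T))"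
    unfolding sum_distrib_left by (rule sum.swap)
  finally have "fact N * krylov N A (\<tau>, \<kappa>) =
    (\<Sum>T\<in>Pow {..<N}. s T * (fact N * (\<Sum>\<pi>\<in>Perms N. of_int (sign \<pi>) * Z \<pi> T)))"
    by (simp only: sum_distrib_left mult.left_commute[of "fact N"])
  also have "\<dots> = (\<Sum>T\<in>Pow {..<N}. s T *
    (\<Sum>\<kappa>'\<in>index_fun N n. (\<Prod>i<N. of_nat (card {t \<in> T. \<kappa> t = \<kappa>' i})) * krylov N A (\<tau>, \<kappa>')))"
  proof (rule sum.cong[OF refl])
    fix T assume "T \<in> Pow {..<N}"
    hence "Z \<pi> T = (\<Prod>j<N. \<Sum>a<n. (A ^\<^sub>m j) $$ (\<tau> (\<pi> j), a) * of_nat (card {t \<in> T. \<kappa> t = a}))" for \<pi>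
      unfolding Z_def by (simp only: lin Pow_iff)
    thus "s T * (fact N * (\<Sum>\<pi>\<in>Perms N. of_int (sign \<pi>) * Z \<pi> T)) = s T *
      (\<Sum>\<kappa>'\<in>index_fun N n. (\<Prod>i<N. of_nat (card {t \<in> T. \<kappa> t = \<kappa>' i})) * krylov N A (\<tau>, \<kappa>'))"
      using sum_krylov_power[OF A t(1), of "\<lambda>a. of_nat (card {t \<in> T. \<kappa> t = a})"] by simp
  qed
  finally show ?thesis unfolding s_def .
qed

section \<open>The extreme weight\<close>

text \<open>\<open>N\<close> is a parameter with \<open>n = k + N\<close>, which keeps truncated
  subtraction out of the index computations.\<close>

locale hook =
  fixes n k N :: nat
  assumes nkN: "n = k + N" and N3: "3 \<le> N"
begin

lemma n_pos: "0 < n" and N_pos: "0 < N" and N_def: "N = n - k" and kn: "k < n"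
  using nkN N3 by auto

abbreviation K where "K \<equiv> index_fun N n \<times> index_fun N n"

lemma finite_K [simp]: "finite K" by simp

text \<open>Indices start at 0, so the rows are 0 and k + 1, ..., n - 1, and the vector at which the
  form is evaluated has index 0.\<close>

definition hw_row :: "nat \<Rightarrow> nat" where
  "hw_row = restrict (\<lambda>i. if i = 0 then 0 else k + i) {..<N}"

definition hw_col :: "nat \<Rightarrow> nat" where
  "hw_col = restrict (\<lambda>i. 0) {..<N}"

lemma hw_index [simp]: "hw_row \<in> index_fun N n" "hw_col \<in> index_fun N n"
  using nkN N3 by (auto simp: hw_row_def hw_col_def index_fun_def)

lemma hw_row_simps: "hw_row 0 = 0" "0 < i \<Longrightarrow> i < N \<Longrightarrow> hw_row i = k + i"
  using N_pos by (auto simp: hw_row_def)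

lemma hw_col_simps: "i < N \<Longrightarrow> hw_col i = 0"
  by (auto simp: hw_col_def)

text \<open>The factor with j = 0 is an entry of the identity matrix. This is how divisibility of
  the form by w enters the weight computations: one row index always cancels against one column
  index.\<close>

lemma krylov_term_nonzero:
  fixes A :: "complex mat"
  assumes A: "A \<in> carrier_mat n n" and x: "\<tau> \<in> index_fun N n" "\<kappa> \<in> index_fun N n"
    and p: "\<pi> \<in> Perms N" "\<sigma> \<in> Perms N"
    and nz: "(\<Prod>j<N. (A ^\<^sub>m j) $$ (\<tau> (\<pi> j), \<kappa> (\<sigma> j))) \<noteq> 0"
  shows "\<tau> (\<pi> 0) = \<kappa> (\<sigma> 0)"
proof -
  have l: "\<tau> (\<pi> 0) < n" "\<kappa> (\<sigma> 0) < n"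
    using index_fun_less[OF x(1) Perms_less[OF p(1) N_pos]] index_fun_less[OF x(2) Perms_less[OF p(2) N_pos]] by auto
  have "(A ^\<^sub>m 0) $$ (\<tau> (\<pi> 0), \<kappa> (\<sigma> 0)) \<noteq> 0"
  proof
    assume "(A ^\<^sub>m 0) $$ (\<tau> (\<pi> 0), \<kappa> (\<sigma> 0)) = 0"
    hence "(\<Prod>j<N. (A ^\<^sub>m j) $$ (\<tau> (\<pi> j), \<kappa> (\<sigma> j))) = 0"
      using N_pos by (intro prod_zero[OF finite_lessThan] bexI[of _ 0]) simp_all
    thus False using nz by simp
  qed
  thus ?thesis using A l by (auto split: if_splits)
qed

lemma krylov_nonzeroE:
  assumes A: "A \<in> carrier_mat n n" and x: "\<tau> \<in> index_fun N n" "\<kappa> \<in> index_fun N n"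
    and nz: "krylov N A (\<tau>, \<kappa>) \<noteq> 0"
  obtains \<pi> \<sigma> where "\<pi> \<in> Perms N" "\<sigma> \<in> Perms N" "\<tau> (\<pi> 0) = \<kappa> (\<sigma> 0)" "inj_on \<tau> {..<N}"
proof -
  have "\<exists>\<pi>\<in>Perms N. \<exists>\<sigma>\<in>Perms N. (\<Prod>j<N. (A ^\<^sub>m j) $$ (\<tau> (\<pi> j), \<kappa> (\<sigma> j))) \<noteq> 0"
  proof (rule ccontr)
    assume "\<not> ?thesis"
    hence "krylov N A (\<tau>, \<kappa>) = 0" unfolding krylov_def split by (intro sum.neutral ballI) auto
    thus False using nz by simp
  qed
  moreover have "inj_on \<tau> {..<N}" using nz krylov_not_inj by blast
  ultimately show thesis using that krylov_term_nonzero[OF A x] by blast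
qed

definition hw_minor :: "complex mat \<Rightarrow> complex" where
  "hw_minor A = (\<Sum>\<pi> | \<pi> permutes {1..<N}. of_int (sign \<pi>) * (\<Prod>j\<in>{1..<N}. (A ^\<^sub>m j) $$ (k + \<pi> j, 0)))"

text \<open>The identity factor must pair the row \<open>a\<close> with a column \<open>a\<close>,
  since no other row equals a column value. The rest is the same minor for every \<open>a\<close>;
  only the count of admissible \<sigma> differs, as for \<open>a = 0\<close> all columns agree.
  Hence the different coordinates of weight \<open>M\<close> are proportional.\<close>

lemma krylov_leading:
  assumes A: "A \<in> carrier_mat n n" and x: "\<tau> \<in> index_fun N n" "\<kappa> \<in> index_fun N n"
    and a: "a \<le> k" "\<tau> 0 = a" "\<kappa> 0 = a"
    and r: "\<And>i. 0 < i \<Longrightarrow> i < N \<Longrightarrow> \<tau> i = k + i" "\<And>i. 0 < i \<Longrightarrow> i < N \<Longrightarrow> \<kappa> i = 0"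
  shows "krylov N A (\<tau>, \<kappa>) = of_nat (card {\<sigma> \<in> Perms N. \<kappa> (\<sigma> 0) = a}) * hw_minor A"
proof -
  define G where "G \<pi> = of_int (sign \<pi>) * (\<Prod>j\<in>{1..<N}. (A ^\<^sub>m j) $$ (k + \<pi> j, 0))" for \<pi>
  have step: "of_int (sign \<pi>) * (\<Prod>j<N. (A ^\<^sub>m j) $$ (\<tau> (\<pi> j), \<kappa> (\<sigma> j))) =
      (if \<pi> 0 = 0 \<and> \<kappa> (\<sigma> 0) = a then G \<pi> else 0)" if p: "\<pi> \<in> Perms N" "\<sigma> \<in> Perms N" for \<pi> \<sigma>
  proof (cases "\<pi> 0 = 0 \<and> \<kappa> (\<sigma> 0) = a")
    case True
    have nz: "\<pi> j \<noteq> 0" if "0 < j" for j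
      using True p(1) that permutes_inj[of \<pi> "{..<N}"] injD[of \<pi> j 0] by auto
    have kz: "\<kappa> (\<sigma> j) = 0" if j: "0 < j" "j < N" for j
    proof (cases "a = 0")
      case True
      thus ?thesis using a r(2) Perms_less[OF p(2) j(2)] by (cases "\<sigma> j = 0") auto
    next
      case False
      hence "\<sigma> 0 = 0" using True r(2)[of "\<sigma> 0"] Perms_less[OF p(2) N_pos] by (cases "\<sigma> 0 = 0") auto
      hence "\<sigma> j \<noteq> 0" using p(2) j permutes_inj[of \<sigma> "{..<N}"] injD[of \<sigma> j 0] by auto
      thus ?thesis using r(2) Perms_less[OF p(2) j(2)] by simp
    qed
    have "{..<N} = insert 0 {1..<N}" using N_pos by auto
    hence "(\<Prod>j<N. (A ^\<^sub>m j) $$ (\<tau> (\<pi> j), \<kappa> (\<sigma> j))) =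
      (A ^\<^sub>m 0) $$ (\<tau> (\<pi> 0), \<kappa> (\<sigma> 0)) * (\<Prod>j\<in>{1..<N}. (A ^\<^sub>m j) $$ (\<tau> (\<pi> j), \<kappa> (\<sigma> j)))"
      by simp
    also have "(A ^\<^sub>m 0) $$ (\<tau> (\<pi> 0), \<kappa> (\<sigma> 0)) = 1" using True a A kn by simp
    also have "(\<Prod>j\<in>{1..<N}. (A ^\<^sub>m j) $$ (\<tau> (\<pi> j), \<kappa> (\<sigma> j))) = (\<Prod>j\<in>{1..<N}. (A ^\<^sub>m j) $$ (k + \<pi> j, 0))"
    proof (rule prod.cong[OF refl])
      fix j assume "j \<in> {1..<N}"
      hence j: "0 < j" "j < N" by auto
      show "(A ^\<^sub>m j) $$ (\<tau> (\<pi> j), \<kappa> (\<sigma> j)) = (A ^\<^sub>m j) $$ (k + \<pi> j, 0)"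
        using nz[OF j(1)] kz[OF j] r(1)[of "\<pi> j"] Perms_less[OF p(1) j(2)] by simp
    qed
    finally show ?thesis using True by (simp add: G_def)
  next
    case False
    have "(\<Prod>j<N. (A ^\<^sub>m j) $$ (\<tau> (\<pi> j), \<kappa> (\<sigma> j))) = 0"
    proof (rule ccontr)
      assume "(\<Prod>j<N. (A ^\<^sub>m j) $$ (\<tau> (\<pi> j), \<kappa> (\<sigma> j))) \<noteq> 0"
      from krylov_term_nonzero[OF A x p this] have e: "\<tau> (\<pi> 0) = \<kappa> (\<sigma> 0)" .
      have c: "\<kappa> (\<sigma> 0) = a \<or> \<kappa> (\<sigma> 0) = 0"
        using a r(2)[of "\<sigma> 0"] Perms_less[OF p(2) N_pos] by (cases "\<sigma> 0 = 0") auto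
      have "\<pi> 0 = 0"
        using c e a r(1)[of "\<pi> 0"] Perms_less[OF p(1) N_pos] by (cases "\<pi> 0 = 0") auto
      thus False using False e a by simp
    qed
    thus ?thesis using False by auto
  qed
  have P: "{\<pi> \<in> Perms N. \<pi> 0 = 0} = {\<pi>. \<pi> permutes {1..<N}}"
  proof safe
    fix \<pi> assume "\<pi> permutes {..<N}" "\<pi> 0 = 0"
    thus "\<pi> permutes {1..<N}" by (elim permutes_superset) (auto simp: Suc_le_eq)
  next
    fix \<pi> assume p: "\<pi> permutes {1..<N}"
    show "\<pi> permutes {..<N}" using p by (rule permutes_subset) auto
    show "\<pi> 0 = 0" using permutes_not_in[OF p, of 0] by simp
  qed
  have "krylov N A (\<tau>, \<kappa>) = (\<Sum>\<pi>\<in>Perms N. \<Sum>\<sigma>\<in>Perms N. if \<pi> 0 = 0 \<and> \<kappa> (\<sigma> 0) = a then G \<pi> else 0)"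
    unfolding krylov_def split by (intro sum.cong refl step)
  also have "\<dots> = (\<Sum>\<pi>\<in>Perms N. if \<pi> 0 = 0 then of_nat (card {\<sigma> \<in> Perms N. \<kappa> (\<sigma> 0) = a}) * G \<pi> else 0)"
  proof (rule sum.cong[OF refl])
    fix \<pi>
    have "(\<Sum>\<sigma>\<in>Perms N. if \<kappa> (\<sigma> 0) = a then G \<pi> else 0) = (\<Sum>\<sigma>\<in>{\<sigma> \<in> Perms N. \<kappa> (\<sigma> 0) = a}. G \<pi>)"
      by (rule sum.inter_filter[symmetric]) simp
    thus "(\<Sum>\<sigma>\<in>Perms N. if \<pi> 0 = 0 \<and> \<kappa> (\<sigma> 0) = a then G \<pi> else 0) =
      (if \<pi> 0 = 0 then of_nat (card {\<sigma> \<in> Perms N. \<kappa> (\<sigma> 0) = a}) * G \<pi> else 0)" by simp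
  qed
  also have "\<dots> = (\<Sum>\<pi>\<in>{\<pi> \<in> Perms N. \<pi> 0 = 0}. of_nat (card {\<sigma> \<in> Perms N. \<kappa> (\<sigma> 0) = a}) * G \<pi>)"
    by (rule sum.inter_filter[symmetric]) simp
  finally show ?thesis unfolding P hw_minor_def G_def by (simp add: sum_distrib_left)
qed

abbreviation hw :: "complex mat \<Rightarrow> complex" where "hw A \<equiv> krylov N A (hw_row, hw_col)"

lemma hw_minor_hw: "\<exists>c. \<forall>A\<in>carrier_mat n n. hw_minor A = c * hw A"
proof -
  define m where "m = card {\<sigma> \<in> Perms N. hw_col (\<sigma> 0) = 0}"
  have "id \<in> {\<sigma> \<in> Perms N. hw_col (\<sigma> 0) = 0}" using N_pos by (auto simp: hw_col_simps permutes_id)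
  moreover have "finite {\<sigma> \<in> Perms N. hw_col (\<sigma> 0) = 0}" by simp
  ultimately have "m \<noteq> 0" unfolding m_def using card_gt_0_iff by blast
  moreover have "hw A = of_nat m * hw_minor A" if "A \<in> carrier_mat n n" for A
    unfolding m_def by (rule krylov_leading[OF that]) (use N_pos in \<open>auto simp: hw_row_simps hw_col_simps\<close>)
  ultimately have "\<forall>A\<in>carrier_mat n n. hw_minor A = (1 / of_nat m) * hw A" by simp
  thus ?thesis by blast
qed

text \<open>Exponents of a one-parameter subgroup of the torus: N - 1 once, 0 k times, -1 at the
  last N - 1 indices, with sum zero. A difference of two exponents reaches N only for column index 0
  against a row index above k.\<close>

definition xi :: "nat \<Rightarrow> int" where
  "xi a = (if a = 0 then int N - 1 else if a \<le> k then 0 else -1)"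

definition wt :: "(nat \<Rightarrow> nat) \<times> (nat \<Rightarrow> nat) \<Rightarrow> int" where
  "wt = (\<lambda>(\<tau>, \<kappa>). \<Sum>i<N. xi (\<kappa> i) - xi (\<tau> i))"

text \<open>The maximal difference N, once for each of the N - 1 factors with j > 0.\<close>

definition M :: int where "M = int N * (int N - 1)"

lemma xi_bounds:
  "xi b - xi a \<le> int N" "- int N \<le> xi b - xi a"
  "xi b - xi a = int N \<Longrightarrow> b = 0 \<and> k < a" "xi b - xi a = - int N \<Longrightarrow> a = 0"
  using N3 by (auto simp: xi_def split: if_splits)

lemma sum_nonneg_atLeast1:
  assumes "(\<Sum>j\<in>{1..<N}. f j) = (0 :: int)" "\<And>j. 0 \<le> f j" "0 < j" "j < N"
  shows "f j = 0"
  using sum_nonneg_eq_0_iff[of "{1..<N}" f] assms by auto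

text \<open>The weight \<open>M\<close> is extreme and has multiplicity one; \<open>- M\<close> is not a weight, because it would need
  the index \<open>0\<close> twice in the antisymmetric part. The latter distinguishes the representation from its
  dual and uses \<open>N \<ge> 3\<close>.\<close>
lemma krylov_weights:
  assumes x: "\<tau> \<in> index_fun N n" "\<kappa> \<in> index_fun N n"
    and nz: "A0 \<in> carrier_mat n n" "krylov N A0 (\<tau>, \<kappa>) \<noteq> 0"
  shows "- M < wt (\<tau>, \<kappa>)" "wt (\<tau>, \<kappa>) \<le> M"
    "wt (\<tau>, \<kappa>) = M \<Longrightarrow> \<exists>c. \<forall>A\<in>carrier_mat n n. krylov N A (\<tau>, \<kappa>) = c * hw A"
proof -
  obtain \<pi> \<sigma> where p: "\<pi> \<in> Perms N" "\<sigma> \<in> Perms N"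
    and e0: "\<tau> (\<pi> 0) = \<kappa> (\<sigma> 0)" and inj: "inj_on \<tau> {..<N}"
    by (rule krylov_nonzeroE[OF nz(1) x nz(2)])
  \<comment> \<open>Reordering by the two permutations puts the pair that comes from the identity
    matrix at position 0. Its exponents cancel, leaving N - 1 differences of absolute value at most
    N.\<close>
  define \<tau>' \<kappa>' where "\<tau>' = \<tau> \<circ> \<pi>" and "\<kappa>' = \<kappa> \<circ> \<sigma>"
  have x': "\<tau>' \<in> index_fun N n" "\<kappa>' \<in> index_fun N n"
    unfolding \<tau>'_def \<kappa>'_def using index_fun_comp x p by blast+
  have inj': "inj_on \<tau>' {..<N}"
    unfolding \<tau>'_def using inj p(1) permutes_image[of \<pi> "{..<N}"] permutes_inj_on[of \<pi> "{..<N}" "{..<N}"]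
    by (intro comp_inj_on) auto
  define d where "d j = xi (\<kappa>' j) - xi (\<tau>' j)" for j
  have "wt (\<tau>, \<kappa>) = (\<Sum>i<N. xi (\<kappa> i)) - (\<Sum>i<N. xi (\<tau> i))" by (simp add: wt_def sum_subtractf)
  also have "(\<Sum>i<N. xi (\<kappa> i)) = (\<Sum>i<N. xi (\<kappa>' i))"
    using sum.permute[of \<sigma> "{..<N}" "\<lambda>i. xi (\<kappa> i)"] p by (simp add: \<kappa>'_def)
  also have "(\<Sum>i<N. xi (\<tau> i)) = (\<Sum>i<N. xi (\<tau>' i))"
    using sum.permute[of \<pi> "{..<N}" "\<lambda>i. xi (\<tau> i)"] p by (simp add: \<tau>'_def)
  also have "(\<Sum>i<N. xi (\<kappa>' i)) - (\<Sum>i<N. xi (\<tau>' i)) = (\<Sum>i<N. d i)" by (simp add: d_def sum_subtractf)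
  also have "{..<N} = insert 0 {1..<N}" using N_pos by auto
  also have "(\<Sum>i\<in>insert 0 {1..<N}. d i) = (\<Sum>i\<in>{1..<N}. d i)"
    using e0 by (simp add: d_def \<tau>'_def \<kappa>'_def)
  finally have wt: "wt (\<tau>, \<kappa>) = (\<Sum>i\<in>{1..<N}. d i)" .
  have Msum: "M = (\<Sum>i\<in>{1..<N}. int N)" using N_pos by (simp add: M_def of_nat_diff)
  have up: "M - wt (\<tau>, \<kappa>) = (\<Sum>i\<in>{1..<N}. int N - d i)" unfolding wt Msum by (rule sum_subtractf[symmetric])
  have lo: "M + wt (\<tau>, \<kappa>) = (\<Sum>i\<in>{1..<N}. int N + d i)" unfolding wt Msum by (rule sum.distrib[symmetric])
  have db: "0 \<le> int N - d j" "0 \<le> int N + d j" for j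
    using xi_bounds(1)[of "\<kappa>' j" "\<tau>' j"] xi_bounds(2)[of "\<kappa>' j" "\<tau>' j"] unfolding d_def by linarith+
  have "0 \<le> M - wt (\<tau>, \<kappa>)" unfolding up by (intro sum_nonneg db)
  thus "wt (\<tau>, \<kappa>) \<le> M" by simp
  have "0 \<le> M + wt (\<tau>, \<kappa>)" unfolding lo by (intro sum_nonneg db)
  moreover have "M + wt (\<tau>, \<kappa>) \<noteq> 0"
  proof
    assume "M + wt (\<tau>, \<kappa>) = 0"
    \<comment> \<open>At the lower bound every difference is -N. Positions 1 and 2 both exist since
      N is at least 3, and both rows would have to be 0.\<close>
    hence "int N + d 1 = 0" "int N + d 2 = 0"
      using sum_nonneg_atLeast1[of "\<lambda>j. int N + d j" 1] sum_nonneg_atLeast1[of "\<lambda>j. int N + d j" 2] lo db N3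
      by auto
    hence "xi (\<kappa>' 1) - xi (\<tau>' 1) = - int N" "xi (\<kappa>' 2) - xi (\<tau>' 2) = - int N" unfolding d_def by linarith+
    hence "\<tau>' 1 = 0" "\<tau>' 2 = 0" using xi_bounds(4) by blast+
    thus False using inj_onD[OF inj', of 1 2] N3 by auto
  qed
  ultimately show "- M < wt (\<tau>, \<kappa>)" by linarith
  assume wM: "wt (\<tau>, \<kappa>) = M"
  have ext: "\<kappa>' j = 0 \<and> k < \<tau>' j" if j: "0 < j" "j < N" for j
  proof -
    have "int N - d j = 0"
      using sum_nonneg_atLeast1[of "\<lambda>j. int N - d j" j] up db wM j by auto
    hence "xi (\<kappa>' j) - xi (\<tau>' j) = int N" unfolding d_def by linarith
    thus ?thesis by (rule xi_bounds(3))
  qed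
  \<comment> \<open>The N - 1 distinct rows above k exhaust k + 1, ..., n - 1, and \<rho> records
    their order. The remaining row \<open>a\<close> is then at most k.\<close>
  define \<rho> where "\<rho> j = (if j \<in> {1..<N} then \<tau>' j - k else j)" for j
  have r1: "\<rho> j \<in> {1..<N}" if "j \<in> {1..<N}" for j
    using ext[of j] index_fun_less[OF x'(1), of j] that nkN by (auto simp: \<rho>_def)
  have "inj_on \<rho> {1..<N}"
  proof (rule inj_onI)
    fix i j assume ij: "i \<in> {1..<N}" "j \<in> {1..<N}" "\<rho> i = \<rho> j"
    hence "\<tau>' i = \<tau>' j" using ext[of i] ext[of j] by (auto simp: \<rho>_def)
    thus "i = j" using inj_onD[OF inj', of i j] ij by auto
  qed
  moreover have rsub: "\<rho> ` {1..<N} \<subseteq> {1..<N}" using r1 by blast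
  ultimately have rim: "\<rho> ` {1..<N} = {1..<N}" "bij_betw \<rho> {1..<N} {1..<N}"
    using endo_inj_surj[of "{1..<N}" \<rho>] by (auto simp: bij_betw_def)
  have rp: "\<rho> permutes {1..<N}" by (rule bij_imp_permutes[OF rim(2)]) (auto simp: \<rho>_def)
  have r: "\<rho> \<in> Perms N" by (intro CollectI permutes_subset[OF rp]) auto
  define a where "a = \<tau>' 0"
  have ak: "a \<le> k"
  proof (rule ccontr)
    assume "\<not> a \<le> k"
    moreover have "a < n" unfolding a_def by (rule index_fun_less[OF x'(1) N_pos])
    ultimately have "a - k \<in> \<rho> ` {1..<N}" unfolding rim using nkN by auto
    then obtain j where j: "j \<in> {1..<N}" "a - k = \<rho> j" by auto
    hence "\<tau>' j = a" using ext[of j] \<open>\<not> a \<le> k\<close> by (auto simp: \<rho>_def)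
    thus False using inj_onD[OF inj', of 0 j] j N_pos unfolding a_def by auto
  qed
  define \<tau>2 where "\<tau>2 = restrict (\<lambda>i. if i = 0 then a else k + i) {..<N}"
  have t2: "\<tau>2 \<in> index_fun N n"
    using ak kn nkN by (auto simp: \<tau>2_def index_fun_def)
  have t2r: "\<tau>2 \<circ> \<rho> = \<tau>'"
  proof (rule index_fun_eqI[OF index_fun_comp[OF t2 r] x'(1)])
    fix i assume i: "i < N"
    show "(\<tau>2 \<circ> \<rho>) i = \<tau>' i"
    proof (cases "i = 0")
      case True
      thus ?thesis using N_pos by (simp add: \<tau>2_def \<rho>_def a_def)
    next
      case False
      thus ?thesis using i r1[of i] ext[of i] by (auto simp: \<tau>2_def \<rho>_def)
    qed
  qed
  have k0: "\<kappa>' 0 = a" using e0 by (simp add: a_def \<tau>'_def \<kappa>'_def)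
  obtain c where c: "\<And>A. A \<in> carrier_mat n n \<Longrightarrow> hw_minor A = c * hw A" using hw_minor_hw by blast
  define m where "m = card {\<sigma> \<in> Perms N. \<kappa>' (\<sigma> 0) = a}"
  have "krylov N A (\<tau>, \<kappa>) = (of_int (sign \<pi>) * of_int (sign \<rho>) * of_nat m * c) * hw A"
    if A: "A \<in> carrier_mat n n" for A
  proof -
    have id: "id \<in> Perms N" by (simp add: permutes_id)
    have "krylov N A (\<tau>2, \<kappa>') = of_nat m * hw_minor A"
      unfolding m_def by (rule krylov_leading[OF A t2 x'(2) ak]) (use ext k0 N_pos in \<open>auto simp: \<tau>2_def\<close>)
    moreover have "krylov N A (\<tau>', \<kappa>') = of_int (sign \<rho>) * krylov N A (\<tau>2, \<kappa>')"
      using krylov_comp[OF r id, of A \<tau>2 \<kappa>'] t2r by simp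
    moreover have "krylov N A (\<tau>', \<kappa>') = of_int (sign \<pi>) * krylov N A (\<tau>, \<kappa>)"
      unfolding \<tau>'_def \<kappa>'_def by (rule krylov_comp[OF p])
    moreover have "of_int (sign \<pi>) * of_int (sign \<pi>) = (1 :: complex)" by (simp add: sign_def)
    ultimately have "krylov N A (\<tau>, \<kappa>) = of_int (sign \<pi>) * (of_int (sign \<rho>) * (of_nat m * hw_minor A))"
      by (metis mult.assoc mult_1)
    thus ?thesis using c[OF A] by simp
  qed
  thus "\<exists>c. \<forall>A\<in>carrier_mat n n. krylov N A (\<tau>, \<kappa>) = c * hw A" by blast
qed

lemma wt_hw: "wt (hw_row, hw_col) = M"
proof -
  have "{..<N} = insert 0 {1..<N}" using N_pos by auto
  hence "wt (hw_row, hw_col) = (\<Sum>i\<in>{1..<N}. xi (hw_col i) - xi (hw_row i))"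
    by (simp add: wt_def hw_row_simps hw_col_simps N_pos)
  also have "\<dots> = (\<Sum>i\<in>{1..<N}. int N)"
    by (intro sum.cong refl) (auto simp: hw_row_simps hw_col_simps xi_def)
  also have "\<dots> = M" using N_pos by (simp add: M_def of_nat_diff)
  finally show ?thesis .
qed

section \<open>Highest weight vector\<close>

text \<open>Triangularity restricts the tensor expansion to columns equal to 0 and rows with \<tau>
  i at least \<open>hw_row i\<close>. A coordinate that does not vanish has distinct rows, one of
  them 0; this must be \<tau> 0, and the other N - 1 rows, each between k + i and n - 1, have no
  freedom left. All other coordinates in the expansion vanish.\<close>

lemma hw_unitriangular:
  assumes A: "A \<in> carrier_mat n n" and u: "upper_unitriangular n u" and h: "h \<in> carrier_mat n n"
    and uh: "u * h = 1\<^sub>m n"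
  shows "hw (h * A * u) = hw A"
proof -
  have uc: "u \<in> carrier_mat n n" using u by (simp add: upper_unitriangular_def)
  have hu: "h * u = 1\<^sub>m n" by (rule mat_mult_left_right_inverse[OF uc h uh])
  note ht = unitriangular_inverse[OF u h hu]
  have up: "g $$ (i, j) = 0" if "upper_unitriangular n g" "i < n" "j < i" for g i j
    using that unfolding upper_unitriangular_def by auto
  have d1: "g $$ (i, i) = 1" if "upper_unitriangular n g" "i < n" for g i
    using that unfolding upper_unitriangular_def by auto
  have "hw (h * A * u) = (\<Sum>y\<in>K. tensor_act N u h (hw_row, hw_col) y * krylov N A y)"
    by (rule krylov_conj) (use A uc h uh in auto)
  also have "\<dots> = tensor_act N u h (hw_row, hw_col) (hw_row, hw_col) * hw A"
  proof (rule sum_single)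
    fix y assume y: "y \<in> K" "y \<noteq> (hw_row, hw_col)"
    obtain \<tau> \<kappa> where ye: "y = (\<tau>, \<kappa>)" by (cases y)
    have x: "\<tau> \<in> index_fun N n" "\<kappa> \<in> index_fun N n" using y ye by auto
    show "tensor_act N u h (hw_row, hw_col) y * krylov N A y = 0"
    proof (rule ccontr)
      assume "\<not> ?thesis"
      hence ta: "tensor_act N u h (hw_row, hw_col) (\<tau>, \<kappa>) \<noteq> 0" and kr: "krylov N A (\<tau>, \<kappa>) \<noteq> 0"
        using ye by auto
      have fac: "h $$ (hw_row i, \<tau> i) * u $$ (\<kappa> i, hw_col i) \<noteq> 0" if "i < N" for i
        using ta that unfolding tensor_act_def split by auto
      have "\<kappa> i = hw_col i" if "i < N" for i
        using fac[OF that] up[OF u, of "\<kappa> i" 0] index_fun_less[OF x(2) that] hw_col_simps[OF that] by auto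
      hence ke: "\<kappa> = hw_col" by (intro index_fun_eqI[OF x(2) hw_index(2)])
      have ge: "hw_row i \<le> \<tau> i" if "i < N" for i
        using fac[OF that] up[OF ht, of "hw_row i" "\<tau> i"] index_fun_less[OF hw_index(1) that] by force
      obtain \<pi> \<sigma> where p: "\<pi> \<in> Perms N" "\<sigma> \<in> Perms N"
        and e0: "\<tau> (\<pi> 0) = \<kappa> (\<sigma> 0)" and inj: "inj_on \<tau> {..<N}"
        by (rule krylov_nonzeroE[OF A x kr])
      have "\<tau> (\<pi> 0) = 0" using e0 ke hw_col_simps[OF Perms_less[OF p(2) N_pos]] by simp
      moreover have "\<pi> 0 < N" by (rule Perms_less[OF p(1) N_pos])
      ultimately have "\<pi> 0 = 0" using ge[of "\<pi> 0"] hw_row_simps(2)[of "\<pi> 0"] by (cases "\<pi> 0 = 0") auto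
      hence t0: "\<tau> 0 = 0" using \<open>\<tau> (\<pi> 0) = 0\<close> by simp
      define \<rho> where "\<rho> j = (if j \<in> {1..<N} then \<tau> j - k else j)" for j
      have ge': "k + j \<le> \<tau> j" "\<tau> j < n" if "j \<in> {1..<N}" for j
        using ge[of j] hw_row_simps(2)[of j] index_fun_less[OF x(1), of j] that by auto
      have "inj_on \<rho> {1..<N}"
      proof (rule inj_onI)
        fix i j assume ij: "i \<in> {1..<N}" "j \<in> {1..<N}" "\<rho> i = \<rho> j"
        hence "\<tau> i = \<tau> j" using ge'[of i] ge'[of j] by (auto simp: \<rho>_def)
        thus "i = j" using inj_onD[OF inj, of i j] ij by auto
      qed
      moreover have "\<rho> ` {1..<N} \<subseteq> {1..<N}"
      proof clarify
        fix j assume j: "j \<in> {1..<N}"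
        thus "\<rho> j \<in> {1..<N}" using ge'[OF j] nkN by (auto simp: \<rho>_def)
      qed
      ultimately have "bij_betw \<rho> {1..<N} {1..<N}"
        using endo_inj_surj[of "{1..<N}" \<rho>] by (auto simp: bij_betw_def)
      hence rp: "\<rho> permutes {1..<N}" by (rule bij_imp_permutes) (auto simp: \<rho>_def)
      have "\<rho> j \<ge> j" if "j \<in> {1..<N}" for j using ge'[OF that] that by (simp add: \<rho>_def)
      hence rid: "\<rho> = id" using permutes_natset_ge[OF rp] by blast
      have "\<tau> j = hw_row j" if j: "j < N" for j
      proof (cases "j = 0")
        case True
        thus ?thesis using t0 by (simp add: hw_row_simps)
      next
        case False
        hence j': "j \<in> {1..<N}" using j by auto
        have "\<rho> j = j" using rid by simp
        hence "\<tau> j - k = j" using j' by (simp add: \<rho>_def)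
        thus ?thesis using ge'[OF j'] hw_row_simps(2)[of j] j False by simp
      qed
      hence "\<tau> = hw_row" by (intro index_fun_eqI[OF x(1) hw_index(1)])
      thus False using ke y ye by simp
    qed
  qed auto
  also have "tensor_act N u h (hw_row, hw_col) (hw_row, hw_col) = 1"
    unfolding tensor_act_def split
    using index_fun_less[OF hw_index(1)] index_fun_less[OF hw_index(2)] d1[OF u] d1[OF ht]
    by (intro prod.neutral) auto
  finally show ?thesis by simp
qed

lemma prod_hw_row: "(\<Prod>i<N. f (hw_row i)) = f 0 * (\<Prod>a\<in>{k<..<n}. f a :: complex)"
proof -
  have "{..<N} = insert 0 {1..<N}" using N_pos by auto
  hence "(\<Prod>i<N. f (hw_row i)) = f 0 * (\<Prod>i\<in>{1..<N}. f (k + i))"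
    by (simp add: hw_row_simps)
  also have "(\<Prod>i\<in>{1..<N}. f (k + i)) = (\<Prod>a\<in>{k<..<n}. f a)"
    by (rule prod.reindex_bij_witness[of _ "\<lambda>a. a - k" "\<lambda>i. k + i"]) (use nkN in auto)
  finally show ?thesis .
qed

text \<open>The weight is N times index 0, minus index 0, minus all indices above k. Since the
  determinant is one, the negative part equals the sum of the indices 1, ..., k, which gives the
  hook.\<close>

lemma hw_torus:
  assumes A: "A \<in> carrier_mat n n" and t: "t \<in> SLn n" "diagonal_mat t" and h: "h \<in> carrier_mat n n"
    and th: "t * h = 1\<^sub>m n"
  shows "hw (h * A * t) = torus_char n (hook_wt n k) t * hw A"
proof -
  have tc: "t \<in> carrier_mat n n" and dt: "det t = 1" using t by (auto simp: SLn_def)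
  define g where "g i = t $$ (i, i)" for i
  have te: "t = diag_of n g"
    using tc t(2) by (intro eq_matI) (auto simp: diagonal_mat_def g_def)
  have pg: "(\<Prod>i<n. g i) = 1"
  proof -
    have "det t = prod_list (diag_mat t)"
      by (rule det_upper_triangular[OF _ tc]) (use tc t(2) in \<open>auto simp: upper_triangular_def diagonal_mat_def\<close>)
    also have "\<dots> = (\<Prod>i<n. g i)"
      using tc by (simp add: diag_mat_def g_def prod.list_conv_set_nth atLeast0LessThan)
    finally show ?thesis using dt by simp
  qed
  hence gnz: "g i \<noteq> 0" if "i < n" for i using that prod_zero[of "{..<n}" g] by force
  have he: "diag_of n (\<lambda>i. inverse (g i)) = h"
  proof -
    have "diag_of n (\<lambda>i. inverse (g i)) * t = 1\<^sub>m n"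
    proof (rule eq_matI)
      fix i j assume "i < dim_row (1\<^sub>m n)" "j < dim_col (1\<^sub>m n)"
      hence ij: "i < n" "j < n" by auto
      have "(diag_of n (\<lambda>i. inverse (g i)) * t) $$ (i, j) =
        (\<Sum>l<n. diag_of n (\<lambda>i. inverse (g i)) $$ (i, l) * diag_of n g $$ (l, j))"
        using ij unfolding te by (simp add: scalar_prod_def atLeast0LessThan)
      also have "\<dots> = diag_of n (\<lambda>i. inverse (g i)) $$ (i, i) * diag_of n g $$ (i, j)"
        using ij by (intro sum_single) auto
      finally show "(diag_of n (\<lambda>i. inverse (g i)) * t) $$ (i, j) = 1\<^sub>m n $$ (i, j)"
        using ij gnz by auto
    qed (use tc in auto)
    hence "h = diag_of n (\<lambda>i. inverse (g i)) * t * h" using h by simp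
    also have "\<dots> = diag_of n (\<lambda>i. inverse (g i))"
      using th h tc by (simp add: assoc_mult_mat[of _ n n _ n _ n])
    finally show ?thesis by simp
  qed
  have "hw (diag_of n (\<lambda>i. inverse (g i)) * A * diag_of n g) =
    (\<Prod>i<N. inverse (g (hw_row i)) * g (hw_col i)) * hw A"
    by (rule krylov_conj_diag[OF A]) (use gnz in auto)
  hence "hw (h * A * t) = (\<Prod>i<N. inverse (g (hw_row i)) * g (hw_col i)) * hw A"
    unfolding he te[symmetric] .
  also have "(\<Prod>i<N. inverse (g (hw_row i)) * g (hw_col i)) = torus_char n (hook_wt n k) t"
  proof -
    have rest: "(\<Prod>a\<in>{k<..<n}. g a) * (g 0 * (\<Prod>a\<in>{1..k}. g a)) = 1"
    proof -
      have "{..<n} = {k<..<n} \<union> insert 0 {1..k}" using kn by auto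
      hence "(\<Prod>i<n. g i) = prod g ({k<..<n} \<union> insert 0 {1..k})" by (rule arg_cong)
      also have "\<dots> = (\<Prod>a\<in>{k<..<n}. g a) * (\<Prod>a\<in>insert 0 {1..k}. g a)"
        by (rule prod.union_disjoint) auto
      finally have "(\<Prod>i<n. g i) = (\<Prod>a\<in>{k<..<n}. g a) * (\<Prod>a\<in>insert 0 {1..k}. g a)" .
      thus ?thesis using pg by simp
    qed
    have "torus_char n (hook_wt n k) t = (\<Prod>i<n - 1. g i ^ hook_wt n k i)"
      by (simp add: torus_char_def g_def)
    also have "\<dots> = (\<Prod>i\<in>insert 0 {1..k}. g i ^ hook_wt n k i)"
      by (rule prod.mono_neutral_right) (use nkN N3 in \<open>auto simp: hook_wt_def\<close>)
    also have "\<dots> = g 0 ^ N * (\<Prod>a\<in>{1..k}. g a)"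
      by (simp add: hook_wt_def N_def[symmetric])
    finally have tch: "torus_char n (hook_wt n k) t = g 0 ^ N * (\<Prod>a\<in>{1..k}. g a)" .
    have "(\<Prod>i<N. inverse (g (hw_row i)) * g (hw_col i)) = inverse (g 0 * (\<Prod>a\<in>{k<..<n}. g a)) * g 0 ^ N"
      unfolding prod.distrib prod_inversef[unfolded o_def] prod_hw_row
      by (simp add: hw_col_simps)
    also have "inverse (g 0 * (\<Prod>a\<in>{k<..<n}. g a)) = (\<Prod>a\<in>{1..k}. g a)"
      using rest by (intro inverse_unique) (simp add: mult_ac)
    finally show ?thesis unfolding tch by simp
  qed
  finally show ?thesis .
qed

end

lemma permutation_extending:
  fixes f g :: "nat \<Rightarrow> nat" and n N :: nat
  assumes f: "inj_on f {..<N}" "f ` {..<N} \<subseteq> {..<n}" and g: "inj_on g {..<N}" "g ` {..<N} \<subseteq> {..<n}"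
  obtains \<rho> where "\<rho> permutes {..<n}" "\<And>i. i < N \<Longrightarrow> \<rho> (f i) = g i"
proof -
  let ?S = "f ` {..<N}" and ?T = "g ` {..<N}"
  have "card ({..<n} - ?S) = card ({..<n} - ?T)"
    using f g card_Diff_subset[of ?S "{..<n}"] card_Diff_subset[of ?T "{..<n}"]
    by (simp add: card_image)
  then obtain h where h: "bij_betw h ({..<n} - ?S) ({..<n} - ?T)"
    using finite_same_card_bij[of "{..<n} - ?S" "{..<n} - ?T"] by auto
  define \<rho> where "\<rho> x = (if x \<in> ?S then g (inv_into {..<N} f x) else if x < n then h x else x)" for x
  have rf: "\<rho> (f i) = g i" if "i < N" for i
    using that inv_into_f_f[OF f(1), of i] by (simp add: \<rho>_def)
  have "bij_betw \<rho> ?S ?T"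
  proof (rule bij_betw_imageI)
    show "inj_on \<rho> ?S"
    proof (rule inj_onI)
      fix x y assume "x \<in> ?S" "y \<in> ?S" "\<rho> x = \<rho> y"
      then obtain i j where "i < N" "j < N" "x = f i" "y = f j" "g i = g j" using rf by auto
      thus "x = y" using inj_onD[OF g(1), of i j] by auto
    qed
    have "\<rho> ` f ` {..<N} = (\<lambda>i. \<rho> (f i)) ` {..<N}" by (rule image_image)
    also have "\<dots> = ?T" by (rule image_cong) (use rf in auto)
    finally show "\<rho> ` ?S = ?T" .
  qed
  moreover have "bij_betw \<rho> ({..<n} - ?S) ({..<n} - ?T)"
    using h by (rule bij_betw_cong[THEN iffD2, rotated]) (auto simp: \<rho>_def)
  ultimately have "bij_betw \<rho> (?S \<union> ({..<n} - ?S)) (?T \<union> ({..<n} - ?T))"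
    by (rule bij_betw_combine) blast
  moreover have "?S \<union> ({..<n} - ?S) = {..<n}" "?T \<union> ({..<n} - ?T) = {..<n}" using f(2) g(2) by blast+
  ultimately have "bij_betw \<rho> {..<n} {..<n}" by simp
  hence "\<rho> permutes {..<n}" by (rule bij_imp_permutes) (use f(2) in \<open>auto simp: \<rho>_def\<close>)
  thus thesis using that rf by blast
qed

context hook
begin

section \<open>Cyclicity\<close>

text \<open>\<open>good\<close> stands for membership in a space of functions that contains
  \<open>hw\<close> and is closed under linear combinations and special unitary substitutions.
  Functions matter only on n by n matrices, hence \<open>good_cong\<close>. The outcome
  \<open>good_krylov\<close> is applied in \<open>cyclic\<close> to the functions represented by a
  submodule.\<close>

context
  fixes good :: "(complex mat \<Rightarrow> complex) \<Rightarrow> bool"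
  assumes good_add: "\<And>f g. good f \<Longrightarrow> good g \<Longrightarrow> good (\<lambda>A. f A + g A)"
    and good_scale: "\<And>c f. good f \<Longrightarrow> good (\<lambda>A. c * f A)"
    and good_SU: "\<And>U f. U \<in> SUn n \<Longrightarrow> good f \<Longrightarrow> good (\<lambda>A. f (mat_adjoint U * A * U))"
    and good_cong: "\<And>f g. good f \<Longrightarrow> (\<And>A. A \<in> carrier_mat n n \<Longrightarrow> f A = g A) \<Longrightarrow> good g"
    and good_hw: "good hw"
begin

lemma good_zero: "good (\<lambda>A. 0)"
  using good_scale[OF good_hw, of 0] by simp

lemma good_sum: "finite I \<Longrightarrow> (\<And>i. i \<in> I \<Longrightarrow> good (f i)) \<Longrightarrow> good (\<lambda>A. \<Sum>i\<in>I. f i A)"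
proof (induction I rule: finite_induct)
  case empty
  show ?case using good_zero by simp
next
  case (insert i I)
  thus ?case using good_add[of "f i" "\<lambda>A. \<Sum>i\<in>I. f i A"] by simp
qed

lemma good_unitary:
  assumes U: "U \<in> unitaries n" and f: "good f"
  shows "good (\<lambda>A. f (mat_adjoint U * A * U))"
proof -
  obtain c where c: "cmod c = 1" "c \<cdot>\<^sub>m U \<in> SUn n" using unitary_to_SU[OF U n_pos] by blast
  show ?thesis
    by (rule good_cong[OF good_SU[OF c(2) f]]) (simp only: smult_unitary_conj[OF c(1) unitariesD(1)[OF U]])
qed

text \<open>With all columns equal to 0, a coordinate that is not identically zero has distinct
  rows, one of them 0. Moving that row to the front costs a sign, and a permutation matrix fixing
  index 0 then carries \<open>hw_row\<close> to the given rows.\<close>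

lemma good_hw_col:
  assumes t: "\<tau> \<in> index_fun N n"
  shows "good (\<lambda>A. krylov N A (\<tau>, hw_col))"
proof (cases "\<forall>A\<in>carrier_mat n n. krylov N A (\<tau>, hw_col) = 0")
  case True
  show ?thesis by (rule good_cong[OF good_zero]) (use True in simp)
next
  case False
  then obtain A0 where A0: "A0 \<in> carrier_mat n n" "krylov N A0 (\<tau>, hw_col) \<noteq> 0" by blast
  obtain \<pi> \<sigma> where p: "\<pi> \<in> Perms N" "\<sigma> \<in> Perms N"
    and e0: "\<tau> (\<pi> 0) = hw_col (\<sigma> 0)" and inj: "inj_on \<tau> {..<N}"
    by (rule krylov_nonzeroE[OF A0(1) t hw_index(2) A0(2)])
  have z: "\<tau> (\<pi> 0) = 0" using e0 hw_col_simps[OF Perms_less[OF p(2) N_pos]] by simp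
  define \<tau>' where "\<tau>' = \<tau> \<circ> \<pi>"
  have t': "\<tau>' \<in> index_fun N n" unfolding \<tau>'_def by (rule index_fun_comp[OF t p(1)])
  have inj': "inj_on \<tau>' {..<N}"
    unfolding \<tau>'_def using inj p(1) permutes_image[of \<pi> "{..<N}"] permutes_inj_on[of \<pi> "{..<N}" "{..<N}"]
    by (intro comp_inj_on) auto
  have inj0: "inj_on hw_row {..<N}"
  proof (rule inj_onI)
    fix i j assume "i \<in> {..<N}" "j \<in> {..<N}" "hw_row i = hw_row j"
    thus "i = j" using hw_row_simps by (cases "i = 0"; cases "j = 0") auto
  qed
  obtain \<rho> where r: "\<rho> permutes {..<n}" "\<And>i. i < N \<Longrightarrow> \<rho> (hw_row i) = \<tau>' i"
  proof (rule permutation_extending[OF inj0 _ inj', of n])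
    show "hw_row ` {..<N} \<subseteq> {..<n}" "\<tau>' ` {..<N} \<subseteq> {..<n}"
      using index_fun_less[OF hw_index(1)] index_fun_less[OF t'] by auto
  qed blast
  have r0: "\<rho> 0 = 0" using r(2)[OF N_pos] z by (simp add: hw_row_simps \<tau>'_def)
  have id: "id \<in> Perms N" by (simp add: permutes_id)
  have "of_int (sign \<pi>) * hw (mat_adjoint (perm_mat n \<rho>) * A * perm_mat n \<rho>) = krylov N A (\<tau>, hw_col)"
    if A: "A \<in> carrier_mat n n" for A
  proof -
    have "hw (mat_adjoint (perm_mat n \<rho>) * A * perm_mat n \<rho>) = krylov N A (\<tau>', hw_col)"
      by (rule krylov_conj_perm[OF A r(1)]) (use t' r r0 hw_col_simps in auto)
    also have "\<dots> = of_int (sign \<pi>) * krylov N A (\<tau>, hw_col)"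
      using krylov_comp[OF p(1) id, of A \<tau> hw_col] by (simp add: \<tau>'_def)
    finally show ?thesis by (simp add: sign_def)
  qed
  thus ?thesis by (rule good_cong[OF good_scale[OF good_unitary[OF perm_mat_unitary[OF r(1)] good_hw]]])
qed

text \<open>A unitary matrix whose first column is proportional to \<open>w\<close> turns evaluation
  at \<open>w\<close> into evaluation at a multiple of the basis vector of index 0, which
  \<open>good_hw_col\<close> covers.\<close>

lemma good_power:
  assumes t: "\<tau> \<in> index_fun N n"
  shows "good (\<lambda>A. \<Sum>\<kappa>\<in>index_fun N n. (\<Prod>i<N. w (\<kappa> i)) * krylov N A (\<tau>, \<kappa>))"
proof (cases "\<forall>a<n. w a = 0")
  case True
  have "(\<Prod>i<N. w (\<kappa> i)) = 0" if "\<kappa> \<in> index_fun N n" for \<kappa>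
    using True index_fun_less[OF that N_pos] N_pos by (intro prod_zero) auto
  thus ?thesis by (intro good_cong[OF good_zero]) simp
next
  case False
  let ?F = "index_fun N n"
  define s where "s = (\<Sum>a<n. (cmod (w a))\<^sup>2)"
  have "s \<noteq> 0"
  proof
    assume "s = 0"
    hence "\<forall>a\<in>{..<n}. (cmod (w a))\<^sup>2 = 0"
      unfolding s_def by (subst (asm) sum_nonneg_eq_0_iff) auto
    thus False using False by auto
  qed
  moreover have "s \<ge> 0" unfolding s_def by (intro sum_nonneg) auto
  ultimately have s: "s > 0" by simp
  define q where "q = complex_of_real (sqrt s)"
  have q0: "q \<noteq> 0" using s by (simp add: q_def)
  have "(\<Sum>a<n. (cmod (w a / q))\<^sup>2) = (\<Sum>a<n. (cmod (w a))\<^sup>2 / s)"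
    using s by (intro sum.cong refl) (simp add: norm_divide power_divide q_def)
  also have "\<dots> = 1" using s unfolding sum_divide_distrib[symmetric] s_def by simp
  finally obtain U where U: "U \<in> unitaries n" and Uw: "\<And>a. a < n \<Longrightarrow> U $$ (a, 0) = w a / q"
    using unitary_first_column[of "\<lambda>a. w a / q" n] by blast
  note U' = unitariesD[OF U]
  have adjw: "(\<Sum>a<n. mat_adjoint U $$ (b, a) * w a) = (if b = 0 then q else 0)" if b: "b < n" for b
  proof -
    have "(\<Sum>a<n. mat_adjoint U $$ (b, a) * w a) = (\<Sum>a<n. q * (mat_adjoint U $$ (b, a) * U $$ (a, 0)))"
      using q0 Uw by (intro sum.cong refl) simp
    also have "\<dots> = q * (mat_adjoint U * U) $$ (b, 0)"
      using U'(1) b n_pos by (simp add: scalar_prod_def atLeast0LessThan sum_distrib_left)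
    finally show ?thesis using U'(3) b n_pos by simp
  qed
  \<comment> \<open>\<open>q\<close> is the length of \<open>w\<close>; its N-th power appears
    because the form has degree N in \<open>w\<close>.\<close>
  define C where "C \<tau>' = (\<Prod>i<N. U $$ (\<tau> i, \<tau>' i)) * q ^ N" for \<tau>'
  have key: "(\<Sum>\<kappa>\<in>?F. (\<Prod>i<N. w (\<kappa> i)) * krylov N A (\<tau>, \<kappa>)) =
    (\<Sum>\<tau>'\<in>?F. C \<tau>' * krylov N (mat_adjoint U * A * U) (\<tau>', hw_col))" if A: "A \<in> carrier_mat n n" for A
  proof -
    define A' where "A' = mat_adjoint U * A * U"
    have A': "A' \<in> carrier_mat n n" using A U' by (simp add: A'_def)
    have Ae: "A = U * A' * mat_adjoint U" unfolding A'_def by (rule unitary_conj_cancel[OF U A, symmetric])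
    have col: "(\<Sum>\<kappa>\<in>?F. (\<Prod>i<N. mat_adjoint U $$ (\<kappa>' i, \<kappa> i) * w (\<kappa> i))) = (if \<kappa>' = hw_col then q ^ N else 0)"
      if k': "\<kappa>' \<in> ?F" for \<kappa>'
    proof -
      have "(\<Sum>\<kappa>\<in>?F. (\<Prod>i<N. mat_adjoint U $$ (\<kappa>' i, \<kappa> i) * w (\<kappa> i))) =
        (\<Prod>i<N. \<Sum>a<n. mat_adjoint U $$ (\<kappa>' i, a) * w a)"
        unfolding index_fun_def by (rule prod_sum_PiE[symmetric]) auto
      also have "\<dots> = (\<Prod>i<N. if \<kappa>' i = 0 then q else 0)"
        by (intro prod.cong refl adjw) (use index_fun_less[OF k'] in auto)
      also have "\<dots> = (if \<kappa>' = hw_col then q ^ N else 0)"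
      proof (cases "\<kappa>' = hw_col")
        case True
        thus ?thesis by (simp add: hw_col_simps)
      next
        case False
        then obtain i where "i < N" "\<kappa>' i \<noteq> 0" using index_fun_eqI[OF k' hw_index(2)] hw_col_simps by auto
        hence "(\<Prod>i<N. if \<kappa>' i = 0 then q else 0) = 0" by (intro prod_zero bexI[of _ i]) auto
        thus ?thesis using False by simp
      qed
      finally show ?thesis .
    qed
    have ta: "(\<Prod>i<N. w (\<kappa> i)) * (tensor_act N (mat_adjoint U) U (\<tau>, \<kappa>) (\<tau>', \<kappa>') * z) =
      (\<Prod>i<N. U $$ (\<tau> i, \<tau>' i)) * z * (\<Prod>i<N. mat_adjoint U $$ (\<kappa>' i, \<kappa> i) * w (\<kappa> i))" for \<kappa> \<tau>' \<kappa>' z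
      unfolding tensor_act_def split prod.distrib by (simp only: mult_ac)
    have "(\<Sum>\<kappa>\<in>?F. (\<Prod>i<N. w (\<kappa> i)) * krylov N A (\<tau>, \<kappa>)) =
      (\<Sum>\<kappa>\<in>?F. \<Sum>y\<in>K. (\<Prod>i<N. w (\<kappa> i)) * (tensor_act N (mat_adjoint U) U (\<tau>, \<kappa>) y * krylov N A' y))"
    proof (rule sum.cong[OF refl])
      fix \<kappa> assume k: "\<kappa> \<in> ?F"
      have "krylov N A (\<tau>, \<kappa>) = (\<Sum>y\<in>K. tensor_act N (mat_adjoint U) U (\<tau>, \<kappa>) y * krylov N A' y)"
        unfolding Ae by (rule krylov_conj) (use U' A' t k in auto)
      thus "(\<Prod>i<N. w (\<kappa> i)) * krylov N A (\<tau>, \<kappa>) =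
        (\<Sum>y\<in>K. (\<Prod>i<N. w (\<kappa> i)) * (tensor_act N (mat_adjoint U) U (\<tau>, \<kappa>) y * krylov N A' y))"
        by (simp only: sum_distrib_left)
    qed
    also have "\<dots> = (\<Sum>y\<in>K. \<Sum>\<kappa>\<in>?F. (\<Prod>i<N. w (\<kappa> i)) * (tensor_act N (mat_adjoint U) U (\<tau>, \<kappa>) y * krylov N A' y))"
      by (rule sum.swap)
    also have "\<dots> = (\<Sum>(\<tau>', \<kappa>')\<in>K. (\<Prod>i<N. U $$ (\<tau> i, \<tau>' i)) * krylov N A' (\<tau>', \<kappa>') *
        (\<Sum>\<kappa>\<in>?F. (\<Prod>i<N. mat_adjoint U $$ (\<kappa>' i, \<kappa> i) * w (\<kappa> i))))"
    proof (rule sum.cong[OF refl])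
      fix y assume "y \<in> K"
      obtain \<tau>' \<kappa>' where y: "y = (\<tau>', \<kappa>')" by (cases y)
      show "(\<Sum>\<kappa>\<in>?F. (\<Prod>i<N. w (\<kappa> i)) * (tensor_act N (mat_adjoint U) U (\<tau>, \<kappa>) y * krylov N A' y)) =
        (case y of (\<tau>', \<kappa>') \<Rightarrow> (\<Prod>i<N. U $$ (\<tau> i, \<tau>' i)) * krylov N A' (\<tau>', \<kappa>') *
          (\<Sum>\<kappa>\<in>?F. (\<Prod>i<N. mat_adjoint U $$ (\<kappa>' i, \<kappa> i) * w (\<kappa> i))))"
        unfolding y split ta sum_distrib_left ..
    qed
    also have "\<dots> = (\<Sum>\<tau>'\<in>?F. \<Sum>\<kappa>'\<in>?F. (\<Prod>i<N. U $$ (\<tau> i, \<tau>' i)) * krylov N A' (\<tau>', \<kappa>') *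
        (if \<kappa>' = hw_col then q ^ N else 0))"
      unfolding sum.cartesian_product[symmetric] by (intro sum.cong refl) (simp only: col)
    also have "\<dots> = (\<Sum>\<tau>'\<in>?F. C \<tau>' * krylov N A' (\<tau>', hw_col))"
      by (intro sum.cong refl, subst sum_single[of _ hw_col]) (auto simp: C_def)
    finally show ?thesis unfolding A'_def .
  qed
  have "good (\<lambda>A. \<Sum>\<tau>'\<in>?F. C \<tau>' * krylov N (mat_adjoint U * A * U) (\<tau>', hw_col))"
    by (intro good_sum good_scale good_unitary[OF U good_hw_col]) auto
  thus ?thesis by (rule good_cong) (simp only: key)
qed

lemma good_krylov:
  assumes x: "\<tau> \<in> index_fun N n" "\<kappa> \<in> index_fun N n"
  shows "good (\<lambda>A. krylov N A (\<tau>, \<kappa>))"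
proof -
  have "good (\<lambda>A. (1 / fact N) * (\<Sum>T\<in>Pow {..<N}. (-1) ^ card ({..<N} - T) *
    (\<Sum>\<kappa>'\<in>index_fun N n. (\<Prod>i<N. of_nat (card {t \<in> T. \<kappa> t = \<kappa>' i})) * krylov N A (\<tau>, \<kappa>'))))"
    by (rule good_scale, rule good_sum, simp, rule good_scale,
        rule good_power[OF x(1), where w = "\<lambda>a. of_nat (card {t \<in> _. \<kappa> t = a})"])
  thus ?thesis by (rule good_cong) (simp only: krylov_polarisation[OF _ x, symmetric], simp)
qed

end

end

section \<open>Inverses in SL(n) and conjugation of Hermitian matrices\<close>

lemma inverse_mat_unique:
  fixes g h h' :: "'a :: field mat"
  assumes "g \<in> carrier_mat n n" "h \<in> carrier_mat n n" "h' \<in> carrier_mat n n" "g * h = 1\<^sub>m n" "g * h' = 1\<^sub>m n"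
  shows "h = h'"
proof -
  have "h * g = 1\<^sub>m n" by (rule mat_mult_left_right_inverse) (use assms in auto)
  hence "h' = (h * g) * h'" using assms by simp
  also have "\<dots> = h * (g * h')" using assms by (simp add: assoc_mult_mat[of _ n n _ n _ n])
  finally show ?thesis using assms by simp
qed

lemma SLn_adj:
  assumes "g \<in> SLn n"
  shows "g \<in> carrier_mat n n" "adj_mat g \<in> carrier_mat n n" "g * adj_mat g = 1\<^sub>m n" "adj_mat g * g = 1\<^sub>m n"
proof -
  have g: "g \<in> carrier_mat n n" "det g = 1" using assms by (auto simp: SLn_def)
  show "g \<in> carrier_mat n n" by (rule g(1))
  show "adj_mat g \<in> carrier_mat n n" using adj_mat(1)[OF g(1)] .
  have "1 \<cdot>\<^sub>m 1\<^sub>m n = (1\<^sub>m n :: complex mat)" by (rule eq_matI) auto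
  thus "g * adj_mat g = 1\<^sub>m n" "adj_mat g * g = 1\<^sub>m n"
    using adj_mat(2,3)[OF g(1)] g(2) by simp_all
qed

lemma SLn_mult: "g \<in> SLn n \<Longrightarrow> h \<in> SLn n \<Longrightarrow> g * h \<in> SLn n"
  using det_mult[of g n h] by (auto simp: SLn_def)

lemma mat_eq_on_vec:
  fixes B C :: "'a :: comm_semiring_1 mat"
  assumes B: "B \<in> carrier_mat m m" and C: "C \<in> carrier_mat m m"
    and e: "\<And>x. x \<in> carrier_vec m \<Longrightarrow> B *\<^sub>v x = (C *\<^sub>v x)"
  shows "B = C"
proof (rule eq_matI)
  fix i j assume "i < dim_row C" "j < dim_col C"
  hence ij: "i < m" "j < m" using C by auto
  have "(B *\<^sub>v unit_vec m j) $ i = (C *\<^sub>v unit_vec m j) $ i" using e[of "unit_vec m j"] by simp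
  thus "B $$ (i, j) = C $$ (i, j)" using ij B C by simp
qed (use B C in auto)

lemma one_SLn: "1\<^sub>m n \<in> SLn n"
  by (simp add: SLn_def)

lemma one_SUn: "1\<^sub>m n \<in> SUn n"
  by (auto simp: SUn_def)

lemma adj_mat_SUn:
  assumes "U \<in> SUn n"
  shows "adj_mat U = mat_adjoint U"
  by (rule inverse_mat_unique[OF SLn_adj(1,2)[OF SUn_SLn[OF assms]]])
     (use assms SLn_adj(3)[OF SUn_SLn[OF assms]] in \<open>simp_all add: SUn_def\<close>)

lemma Her_conj:
  assumes "A \<in> Her n" "U \<in> carrier_mat n n"
  shows "mat_adjoint U * A * U \<in> Her n"
proof -
  have A: "A \<in> carrier_mat n n" "mat_adjoint A = A" using assms by (auto simp: Her_def)
  have "mat_adjoint (mat_adjoint U * A * U) = mat_adjoint U * (mat_adjoint A * mat_adjoint (mat_adjoint U))"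
    using A(1) assms(2) by (simp add: mat_adjoint_mult[of _ n n _ n])
  also have "\<dots> = mat_adjoint U * (A * U)" by (simp only: A(2) mat_adjoint_adjoint)
  also have "\<dots> = mat_adjoint U * A * U"
    using A(1) assms(2) by (simp add: assoc_mult_mat[of _ n n _ n _ n])
  finally show ?thesis using A(1) assms(2) by (simp add: Her_def)
qed

lemma Her_carrier: "A \<in> Her n \<Longrightarrow> A \<in> carrier_mat n n"
  by (simp add: Her_def)

section \<open>Root-of-unity filter\<close>

lemma cis_eq_1_imp:
  assumes "cis (2 * pi * real_of_int r / real L) = 1" "\<bar>r\<bar> < int L"
  shows "r = 0"
proof -
  have L: "0 < real L" using assms(2) by auto
  have "cos (2 * pi * real_of_int r / real L) = 1" using arg_cong[OF assms(1), of Re] by simp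
  then obtain j :: int where "2 * pi * real_of_int r / real L = real_of_int j * (2 * pi)"
    using cos_one_2pi_int by auto
  hence "real_of_int r = real_of_int j * real L" using L by (simp add: field_simps)
  hence "real_of_int r = real_of_int (j * int L)" by simp
  hence r: "r = j * int L" unfolding of_int_eq_iff .
  hence "\<bar>j\<bar> * int L < 1 * int L" using assms(2) by (simp add: abs_mult)
  hence "\<bar>j\<bar> < 1" using L by (subst (asm) mult_less_cancel_right) auto
  thus ?thesis using r by simp
qed

lemma sum_cis:
  assumes r: "\<bar>r\<bar> < int L"
  shows "(\<Sum>l<L. cis (2 * pi / real L * real l * real_of_int r)) = (if r = 0 then of_nat L else 0)"
proof (cases "r = 0")
  case False
  define z where "z = cis (2 * pi * real_of_int r / real L)"
  have z1: "z \<noteq> 1" using cis_eq_1_imp[OF _ r] False unfolding z_def by blast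
  have L: "L \<noteq> 0" using r by auto
  have "(\<Sum>l<L. cis (2 * pi / real L * real l * real_of_int r)) = (\<Sum>l<L. z ^ l)"
    by (intro sum.cong refl) (simp add: z_def DeMoivre mult_ac)
  also have "\<dots> = (z ^ L - 1) / (z - 1)" using z1 by (rule geometric_sum)
  also have "z ^ L = cis (2 * pi * real_of_int r)" using L by (simp add: z_def DeMoivre)
  also have "\<dots> = 1" using cis_multiple_2pi[of "real_of_int r"] by (simp add: mult_ac)
  finally show ?thesis using False by simp
qed simp

text \<open>Since 2 cos x = cis x + cis (-x), real coefficients can only select the weights M and -M
  together. \<open>L\<close> exceeds 2M, so no other weight in the range is congruent to them, and
  the strict lower bound removes -M.\<close>

lemma cos_filter:
  fixes M :: nat and w :: int
  assumes L: "L = 2 * M + 1" and w: "- int M < w" "w \<le> int M"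
  shows "(\<Sum>l<L. complex_of_real (2 * cos (2 * pi / real L * real l * real M) / real L) *
     cis (2 * pi / real L * real l * real_of_int w)) = (if w = int M then 1 else 0)"
proof -
  let ?t = "2 * pi / real L"
  have L0: "real L \<noteq> 0" using L by simp
  have gen: "complex_of_real (2 * cos (t * real l * real M) / real L) * cis (t * real l * real_of_int w) =
    (cis (t * real l * real_of_int (w + int M)) + cis (t * real l * real_of_int (w - int M))) / of_nat L" for t l
  proof -
    have "complex_of_real (2 * cos x) = cis x + cis (- x)" for x by (simp add: complex_eq_iff)
    hence "complex_of_real (2 * cos (t * real l * real M) / real L) =
      (cis (t * real l * real M) + cis (- (t * real l * real M))) / of_nat L"
      by (simp add: of_real_divide del: of_real_mult)
    hence "complex_of_real (2 * cos (t * real l * real M) / real L) * cis (t * real l * real_of_int w) =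
      (cis (t * real l * real M) * cis (t * real l * real_of_int w) +
       cis (- (t * real l * real M)) * cis (t * real l * real_of_int w)) / of_nat L"
      by (simp only: times_divide_eq_left distrib_right)
    thus ?thesis by (simp add: cis_mult algebra_simps)
  qed
  have "(\<Sum>l<L. complex_of_real (2 * cos (?t * real l * real M) / real L) * cis (?t * real l * real_of_int w)) =
    ((\<Sum>l<L. cis (?t * real l * real_of_int (w + int M))) + (\<Sum>l<L. cis (?t * real l * real_of_int (w - int M)))) / of_nat L"
    unfolding gen sum_divide_distrib[symmetric] sum.distrib ..
  also have "(\<Sum>l<L. cis (?t * real l * real_of_int (w + int M))) = (if w + int M = 0 then of_nat L else 0)"
    by (rule sum_cis) (use L w in auto)
  also have "(\<Sum>l<L. cis (?t * real l * real_of_int (w - int M))) = (if w - int M = 0 then of_nat L else 0)"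
    by (rule sum_cis) (use L w in auto)
  finally show ?thesis using w L0 by auto
qed

text \<open>The angle is just below \<pi>. Hence the generator of the cyclic group acts on the
  extreme vector by a non-real scalar, which is what recovers complex multiples in a real
  subspace.\<close>

lemma sin_filter_nonzero:
  assumes L: "L = 2 * M + 1" and M: "M > 0"
  shows "sin (2 * pi / real L * real M) \<noteq> 0"
proof -
  have "sin (2 * pi / real L * real M) > 0"
  proof (rule sin_gt_zero)
    show "0 < 2 * pi / real L * real M" using L M by simp
    have "2 * real M / real L < 1" using L by simp
    hence "pi * (2 * real M / real L) < pi * 1" by (intro mult_strict_left_mono) auto
    thus "2 * pi / real L * real M < pi" by (simp add: mult_ac)
  qed
  thus ?thesis by simp
qed

section \<open>The representation\<close>

text \<open>The span over all matrices and not only Hermitian ones, so that SL(n) acts. The rule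
  \<open>lin\<close> has the closure form that \<open>orthonormal_basis_extend\<close> asks
  for.\<close>

inductive_set kspan :: "nat \<Rightarrow> nat \<Rightarrow> ((nat \<Rightarrow> nat) \<times> (nat \<Rightarrow> nat) \<Rightarrow> complex) set" for n N where
  base: "A \<in> carrier_mat n n \<Longrightarrow> krylov N A \<in> kspan n N"
| lin: "x \<in> kspan n N \<Longrightarrow> y \<in> kspan n N \<Longrightarrow> (\<lambda>l. x l + c * y l) \<in> kspan n N"

locale hook_basis = hook +
  fixes m :: nat and u :: "nat \<Rightarrow> (nat \<Rightarrow> nat) \<times> (nat \<Rightarrow> nat) \<Rightarrow> complex"
  assumes on: "orthonormal K m u" and u_kspan: "\<And>i. i < m \<Longrightarrow> u i \<in> kspan n N"
    and complete: "\<And>x l. x \<in> kspan n N \<Longrightarrow> l \<in> K \<Longrightarrow> x l = (\<Sum>i<m. ip K x (u i) * u i l)"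
begin

definition coord :: "nat \<Rightarrow> complex mat \<Rightarrow> complex" where
  "coord i A = ip K (krylov N A) (u i)"

text \<open>Identifies column vectors with the functions spanned by the coordinates; the model of
  the representation is the space of these functions, dual to \<open>kspan\<close>.\<close>

definition form :: "complex vec \<Rightarrow> complex mat \<Rightarrow> complex" where
  "form x A = (\<Sum>i<m. x $ i * coord i A)"

text \<open>The tensor action compressed to the span and transposed, because it acts on functions
  and not on the span itself. On SL(n) the adjugate is the inverse and has polynomial
  entries.\<close>

definition rho :: "complex mat \<Rightarrow> complex mat" where
  "rho g = mat m m (\<lambda>(j, i). \<Sum>l\<in>K. \<Sum>l'\<in>K. tensor_act N g (adj_mat g) l l' * u j l' * cnj (u i l))"

definition kvec :: "(nat \<Rightarrow> nat) \<times> (nat \<Rightarrow> nat) \<Rightarrow> complex vec" where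
  "kvec l = vec m (\<lambda>i. u i l)"

abbreviation "x0 \<equiv> kvec (hw_row, hw_col)"

lemma rho_carrier [simp]: "rho g \<in> carrier_mat m m"
  by (simp add: rho_def)

lemma rho_dims [simp]: "dim_row (rho g) = m" "dim_col (rho g) = m"
  by (simp_all add: rho_def)

lemma rho_vec [simp]: "rho g *\<^sub>v x \<in> carrier_vec m"
  by (rule carrier_vecI) simp

lemma kvec_carrier [simp]: "kvec l \<in> carrier_vec m"
  by (simp add: kvec_def)

lemma krylov_coord: "A \<in> carrier_mat n n \<Longrightarrow> l \<in> K \<Longrightarrow> krylov N A l = (\<Sum>i<m. coord i A * u i l)"
  unfolding coord_def by (rule complete[OF kspan.base])

lemma form_kvec: "A \<in> carrier_mat n n \<Longrightarrow> l \<in> K \<Longrightarrow> form (kvec l) A = krylov N A l"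
  by (simp add: form_def kvec_def krylov_coord mult.commute)

lemma form_add: "x \<in> carrier_vec m \<Longrightarrow> y \<in> carrier_vec m \<Longrightarrow> form (x + y) A = form x A + form y A"
  by (simp add: form_def sum.distrib distrib_right)

lemma form_smult: "x \<in> carrier_vec m \<Longrightarrow> form (c \<cdot>\<^sub>v x) A = c * form x A"
  by (simp add: form_def sum_distrib_left mult.assoc)

lemma form_krylov: "form x A = (\<Sum>l\<in>K. (\<Sum>i<m. x $ i * cnj (u i l)) * krylov N A l)"
  unfolding form_def coord_def ip_def sum_distrib_left sum_distrib_right
  by (subst sum.swap) (intro sum.cong refl, simp only: mult_ac)

text \<open>The coefficients define a functional on the span. If it vanishes at all values of the
  covariant it vanishes on \<open>kspan\<close>, in particular at the basis vectors, where it reads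
  off the coefficients.\<close>

lemma form_eq_0:
  assumes x: "x \<in> carrier_vec m" and z: "\<And>A. A \<in> carrier_mat n n \<Longrightarrow> form x A = 0"
  shows "x = 0\<^sub>v m"
proof (rule eq_vecI)
  define w where "w = (\<lambda>l. \<Sum>i<m. cnj (x $ i) * u i l)"
  have ip_w: "ip K y w = (\<Sum>i<m. x $ i * ip K y (u i))" for y
    unfolding w_def ip_sum_right ip_scale_right by simp
  have "ip K y w = 0" if "y \<in> kspan n N" for y
    using that
  proof induction
    case (base A)
    show ?case using z[OF base] unfolding ip_w form_def coord_def .
  next
    case (lin y y' c)
    have "ip K (\<lambda>l. y l + c * y' l) w = ip K y w + c * ip K y' w"
      by (simp add: ip_def algebra_simps sum.distrib sum_distrib_left)
    thus ?case using lin by simp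
  qed
  fix j assume "j < dim_vec (0\<^sub>v m :: complex vec)"
  hence j: "j < m" by simp
  have "x $ j = (\<Sum>i<m. x $ i * ip K (u j) (u i))"
    using on j by (subst sum_single[of _ j]) (auto simp: orthonormal_def)
  also have "\<dots> = ip K (u j) w" by (rule ip_w[symmetric])
  also have "\<dots> = 0" by (rule \<open>\<And>y. y \<in> kspan n N \<Longrightarrow> ip K y w = 0\<close>[OF u_kspan[OF j]])
  finally show "x $ j = 0\<^sub>v m $ j" using j by simp
qed (use x in simp)

text \<open>Reduces every identity for \<open>rho\<close> to functions, where the action is mere
  substitution of the conjugated matrix.\<close>

lemma form_inject:
  assumes x: "x \<in> carrier_vec m" and y: "y \<in> carrier_vec m"
    and e: "\<And>A. A \<in> carrier_mat n n \<Longrightarrow> form x A = form y A"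
  shows "x = y"
proof -
  have "x + (-1) \<cdot>\<^sub>v y = 0\<^sub>v m"
    using x y e by (intro form_eq_0) (simp_all add: form_add form_smult)
  hence "(x + (-1) \<cdot>\<^sub>v y) $ i = 0" if "i < m" for i using that by simp
  thus ?thesis using x y by (intro eq_vecI) auto
qed

lemma coord_conj:
  assumes A: "A \<in> carrier_mat n n" and g: "g \<in> SLn n" and i: "i < m"
  shows "coord i (adj_mat g * A * g) = (\<Sum>j<m. rho g $$ (j, i) * coord j A)"
proof -
  note g' = SLn_adj[OF g]
  have "coord i (adj_mat g * A * g) =
    (\<Sum>l\<in>K. (\<Sum>l'\<in>K. tensor_act N g (adj_mat g) l l' * krylov N A l') * cnj (u i l))"
    unfolding coord_def ip_def
    by (intro sum.cong refl arg_cong2[of _ _ _ _ "(*)"] krylov_conj) (use A g' in auto)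
  also have "\<dots> = (\<Sum>l\<in>K. \<Sum>l'\<in>K. \<Sum>j<m. tensor_act N g (adj_mat g) l l' * u j l' * cnj (u i l) * coord j A)"
    unfolding sum_distrib_right
    by (intro sum.cong refl) (simp only: krylov_coord[OF A] sum_distrib_left sum_distrib_right mult_ac)
  also have "\<dots> = (\<Sum>l\<in>K. \<Sum>j<m. \<Sum>l'\<in>K. tensor_act N g (adj_mat g) l l' * u j l' * cnj (u i l) * coord j A)"
    by (intro sum.cong refl sum.swap)
  also have "\<dots> = (\<Sum>j<m. \<Sum>l\<in>K. \<Sum>l'\<in>K. tensor_act N g (adj_mat g) l l' * u j l' * cnj (u i l) * coord j A)"
    by (rule sum.swap)
  also have "\<dots> = (\<Sum>j<m. rho g $$ (j, i) * coord j A)"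
    using i by (intro sum.cong refl) (simp add: rho_def sum_distrib_right)
  finally show ?thesis .
qed

lemma rho_vec_index: "x \<in> carrier_vec m \<Longrightarrow> j < m \<Longrightarrow> (rho g *\<^sub>v x) $ j = (\<Sum>i<m. rho g $$ (j, i) * x $ i)"
  by (simp add: scalar_prod_def atLeast0LessThan)

lemma form_rho:
  assumes x: "x \<in> carrier_vec m" and A: "A \<in> carrier_mat n n" and g: "g \<in> SLn n"
  shows "form (rho g *\<^sub>v x) A = form x (adj_mat g * A * g)"
proof -
  have "form (rho g *\<^sub>v x) A = (\<Sum>j<m. \<Sum>i<m. rho g $$ (j, i) * x $ i * coord j A)"
    unfolding form_def by (intro sum.cong refl) (simp only: lessThan_iff rho_vec_index[OF x] sum_distrib_right)
  also have "\<dots> = (\<Sum>i<m. \<Sum>j<m. rho g $$ (j, i) * x $ i * coord j A)" by (rule sum.swap)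
  also have "\<dots> = (\<Sum>i<m. x $ i * coord i (adj_mat g * A * g))"
    by (intro sum.cong refl) (simp only: lessThan_iff coord_conj[OF A g] sum_distrib_left mult_ac)
  finally show ?thesis unfolding form_def .
qed

lemma form_rho_SU:
  assumes x: "x \<in> carrier_vec m" and A: "A \<in> carrier_mat n n" and U: "U \<in> SUn n"
  shows "form (rho U *\<^sub>v x) A = form x (mat_adjoint U * A * U)"
  using form_rho[OF x A SUn_SLn[OF U]] adj_mat_SUn[OF U] by simp

lemma rho_mult_vec:
  assumes g: "g \<in> SLn n" and h: "h \<in> SLn n" and x: "x \<in> carrier_vec m"
  shows "rho (g * h) *\<^sub>v x = rho g *\<^sub>v (rho h *\<^sub>v x)"
proof (rule form_inject)
  fix A :: "complex mat" assume A: "A \<in> carrier_mat n n"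
  note g' = SLn_adj[OF g] and h' = SLn_adj[OF h] and gh = SLn_adj[OF SLn_mult[OF g h]]
  have "adj_mat (g * h) = adj_mat h * adj_mat g"
    by (rule inverse_mat_unique[of "g * h" n]) (use g' h' gh mult_inverse_mult[of g n h "adj_mat h" "adj_mat g"] in auto)
  hence "adj_mat (g * h) * A * (g * h) = adj_mat h * (adj_mat g * A * g) * h"
    using A g' h' by (simp add: assoc_mult_mat[of _ n n _ n _ n])
  thus "form (rho (g * h) *\<^sub>v x) A = form (rho g *\<^sub>v (rho h *\<^sub>v x)) A"
    using A g' x g h by (simp add: form_rho SLn_mult)
qed auto

lemma rho_mult: "g \<in> SLn n \<Longrightarrow> h \<in> SLn n \<Longrightarrow> rho (g * h) = rho g * rho h"
  by (rule mat_eq_on_vec) (auto simp: rho_mult_vec assoc_mult_mat_vec[of _ m m _ m])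

lemma rho_one: "rho (1\<^sub>m n) = 1\<^sub>m m"
proof (rule mat_eq_on_vec)
  fix x :: "complex vec" assume x: "x \<in> carrier_vec m"
  have a: "adj_mat (1\<^sub>m n) = (1\<^sub>m n :: complex mat)" using SLn_adj(2,3)[OF one_SLn[of n]] by simp
  have "rho (1\<^sub>m n) *\<^sub>v x = x"
    by (rule form_inject) (use x in \<open>simp_all add: form_rho one_SLn a\<close>)
  thus "rho (1\<^sub>m n) *\<^sub>v x = 1\<^sub>m m *\<^sub>v x" using x by simp
qed auto

section \<open>The invariant inner product and generation by the extreme vector\<close>

abbreviation vip :: "complex vec \<Rightarrow> complex vec \<Rightarrow> complex" where
  "vip x y \<equiv> ip {..<m} (\<lambda>i. x $ i) (\<lambda>i. y $ i)"

lemma vip_add_left: "x \<in> carrier_vec m \<Longrightarrow> y \<in> carrier_vec m \<Longrightarrow> vip (x + y) z = vip x z + vip y z"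
  by (simp add: ip_def sum.distrib distrib_right)

lemma vip_add_right: "x \<in> carrier_vec m \<Longrightarrow> y \<in> carrier_vec m \<Longrightarrow> vip z (x + y) = vip z x + vip z y"
  by (simp add: ip_def sum.distrib distrib_left)

lemma vip_smult_left: "x \<in> carrier_vec m \<Longrightarrow> vip (c \<cdot>\<^sub>v x) z = c * vip x z"
  by (simp add: ip_def sum_distrib_left mult.assoc)

lemma vip_smult_right: "x \<in> carrier_vec m \<Longrightarrow> vip z (c \<cdot>\<^sub>v x) = cnj c * vip z x"
  by (simp add: ip_def sum_distrib_left mult_ac)

text \<open>\<open>rho\<close> is unitary on SU(n), since it is written in an orthonormal basis and
  the tensor action of a unitary matrix is unitary.\<close>

lemma rho_adjoint_entry:
  assumes U: "U \<in> SUn n" and ij: "i < m" "j < m"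
  shows "cnj (rho U $$ (j, i)) = rho (mat_adjoint U) $$ (i, j)"
proof -
  have Uc: "U \<in> carrier_mat n n" using U by (simp add: SUn_def)
  have a: "adj_mat (mat_adjoint U) = U" using adj_mat_SUn[OF SUn_adjoint[OF U]] by simp
  have "cnj (rho U $$ (j, i)) = (\<Sum>l\<in>K. \<Sum>l'\<in>K. cnj (tensor_act N U (mat_adjoint U) l l') * cnj (u j l') * u i l)"
    using ij by (simp add: rho_def adj_mat_SUn[OF U])
  also have "\<dots> = (\<Sum>l\<in>K. \<Sum>l'\<in>K. tensor_act N (mat_adjoint U) U l' l * cnj (u j l') * u i l)"
    by (intro sum.cong refl) (simp only: cnj_tensor_act_unitary[OF Uc])
  also have "\<dots> = (\<Sum>l'\<in>K. \<Sum>l\<in>K. tensor_act N (mat_adjoint U) U l' l * cnj (u j l') * u i l)"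
    by (rule sum.swap)
  also have "\<dots> = rho (mat_adjoint U) $$ (i, j)"
    using ij by (simp add: rho_def a mult_ac)
  finally show ?thesis .
qed

lemma vip_rho:
  assumes U: "U \<in> SUn n" and x: "x \<in> carrier_vec m" and y: "y \<in> carrier_vec m"
  shows "vip (rho U *\<^sub>v x) y = vip x (rho (mat_adjoint U) *\<^sub>v y)"
proof -
  have "vip (rho U *\<^sub>v x) y = (\<Sum>j<m. \<Sum>i<m. rho U $$ (j, i) * x $ i * cnj (y $ j))"
    unfolding ip_def by (intro sum.cong refl) (simp only: lessThan_iff rho_vec_index[OF x] sum_distrib_right)
  also have "\<dots> = (\<Sum>i<m. \<Sum>j<m. rho U $$ (j, i) * x $ i * cnj (y $ j))" by (rule sum.swap)
  also have "\<dots> = (\<Sum>i<m. x $ i * cnj (\<Sum>j<m. rho (mat_adjoint U) $$ (i, j) * y $ j))"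
  proof (rule sum.cong[OF refl])
    fix i assume i: "i \<in> {..<m}"
    have "x $ i * cnj (\<Sum>j<m. rho (mat_adjoint U) $$ (i, j) * y $ j) =
      (\<Sum>j<m. x $ i * (cnj (rho (mat_adjoint U) $$ (i, j)) * cnj (y $ j)))"
      by (simp add: sum_distrib_left)
    also have "\<dots> = (\<Sum>j<m. rho U $$ (j, i) * x $ i * cnj (y $ j))"
    proof (rule sum.cong[OF refl])
      fix j assume j: "j \<in> {..<m}"
      have "cnj (rho (mat_adjoint U) $$ (i, j)) = rho U $$ (j, i)"
        using rho_adjoint_entry[OF U, of i j] i j by (metis complex_cnj_cnj lessThan_iff)
      thus "x $ i * (cnj (rho (mat_adjoint U) $$ (i, j)) * cnj (y $ j)) = rho U $$ (j, i) * x $ i * cnj (y $ j)"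
        by (simp add: mult_ac)
    qed
    finally show "(\<Sum>j<m. rho U $$ (j, i) * x $ i * cnj (y $ j)) =
      x $ i * cnj (\<Sum>j<m. rho (mat_adjoint U) $$ (i, j) * y $ j)" by simp
  qed
  also have "\<dots> = vip x (rho (mat_adjoint U) *\<^sub>v y)"
    unfolding ip_def by (intro sum.cong refl) (simp only: lessThan_iff rho_vec_index[OF y])
  finally show ?thesis .
qed

text \<open>The functions represented by vectors of \<open>Q\<close> satisfy the closure conditions
  of \<open>good\<close>, so all coordinates are among them, and every form is a combination of
  coordinates.\<close>

lemma cyclic:
  assumes Q: "Q \<subseteq> carrier_vec m" and x0: "x0 \<in> Q"
    and add: "\<And>x y. x \<in> Q \<Longrightarrow> y \<in> Q \<Longrightarrow> x + y \<in> Q"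
    and smult: "\<And>c x. x \<in> Q \<Longrightarrow> c \<cdot>\<^sub>v x \<in> Q"
    and rhoQ: "\<And>U x. U \<in> SUn n \<Longrightarrow> x \<in> Q \<Longrightarrow> rho U *\<^sub>v x \<in> Q"
  shows "Q = carrier_vec m"
proof
  show "Q \<subseteq> carrier_vec m" by (rule Q)
  define good where "good f \<longleftrightarrow> (\<exists>y\<in>Q. \<forall>A\<in>carrier_mat n n. form y A = f A)" for f
  have g_add: "good (\<lambda>A. f A + g A)" if fg: "good f" "good g" for f g
  proof -
    obtain y z where yz: "y \<in> Q" "z \<in> Q" "\<forall>A\<in>carrier_mat n n. form y A = f A" "\<forall>A\<in>carrier_mat n n. form z A = g A"
      using fg unfolding good_def by blast
    have "y \<in> carrier_vec m" "z \<in> carrier_vec m" using yz Q by auto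
    thus ?thesis unfolding good_def using yz add[OF yz(1,2)]
      by (intro bexI[of _ "y + z"]) (simp_all add: form_add)
  qed
  have g_scale: "good (\<lambda>A. c * f A)" if fg: "good f" for c f
  proof -
    obtain y where y: "y \<in> Q" "\<forall>A\<in>carrier_mat n n. form y A = f A" using fg unfolding good_def by blast
    have "y \<in> carrier_vec m" using y Q by auto
    thus ?thesis unfolding good_def using y smult[OF y(1)]
      by (intro bexI[of _ "c \<cdot>\<^sub>v y"]) (simp_all add: form_smult)
  qed
  have g_SU: "good (\<lambda>A. f (mat_adjoint U * A * U))" if U: "U \<in> SUn n" and f: "good f" for U f
  proof -
    obtain y where y: "y \<in> Q" "\<forall>A\<in>carrier_mat n n. form y A = f A" using f unfolding good_def by blast
    have yc: "y \<in> carrier_vec m" using y Q by auto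
    have "U \<in> carrier_mat n n" using U by (simp add: SUn_def)
    thus ?thesis unfolding good_def using y rhoQ[OF U y(1)] yc U
      by (intro bexI[of _ "rho U *\<^sub>v y"]) (simp_all add: form_rho_SU)
  qed
  have g_cong: "good g" if fg: "good f" "\<And>A. A \<in> carrier_mat n n \<Longrightarrow> f A = g A" for f g
  proof -
    obtain y where y: "y \<in> Q" "\<forall>A\<in>carrier_mat n n. form y A = f A" using fg(1) unfolding good_def by blast
    have "\<forall>A\<in>carrier_mat n n. form y A = g A" using y(2) fg(2) by simp
    thus ?thesis unfolding good_def using y(1) by blast
  qed
  have g_hw: "good hw" unfolding good_def by (rule bexI[OF _ x0]) (simp add: form_kvec)
  have g_kr: "good (\<lambda>A. krylov N A l)" if lK: "l \<in> K" for l
  proof -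
    obtain \<tau> \<kappa> where l: "l = (\<tau>, \<kappa>)" "\<tau> \<in> index_fun N n" "\<kappa> \<in> index_fun N n" using lK by auto
    show ?thesis unfolding l(1)
      by (rule good_krylov[where good = good, OF g_add g_scale g_SU g_cong g_hw l(2,3)])
  qed
  show "carrier_vec m \<subseteq> Q"
  proof
    fix x :: "complex vec" assume x: "x \<in> carrier_vec m"
    have "good (\<lambda>A. \<Sum>l\<in>K. (\<Sum>i<m. x $ i * cnj (u i l)) * krylov N A l)"
      by (rule good_sum[where good = good, OF g_add g_scale g_SU g_cong g_hw finite_K g_scale[OF g_kr]])
    hence "good (form x)" unfolding form_krylov .
    then obtain y where y: "y \<in> Q" "\<forall>A\<in>carrier_mat n n. form y A = form x A"
      unfolding good_def by blast
    have "y = x" by (rule form_inject) (use y Q x in auto)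
    thus "x \<in> Q" using y by simp
  qed
qed

end

context hook_basis
begin

section \<open>Real irreducibility\<close>

text \<open>Closure is demanded for real scalars only; recovering complex ones is the content of
  \<open>real_irreducible\<close>.\<close>

definition inv_sub :: "complex vec set \<Rightarrow> bool" where
  "inv_sub X \<longleftrightarrow> X \<subseteq> carrier_vec m \<and> 0\<^sub>v m \<in> X \<and> (\<forall>x\<in>X. \<forall>y\<in>X. x + y \<in> X) \<and>
     (\<forall>r. \<forall>x\<in>X. complex_of_real r \<cdot>\<^sub>v x \<in> X) \<and> (\<forall>U\<in>SUn n. \<forall>x\<in>X. rho U *\<^sub>v x \<in> X)"

lemma inv_subD:
  assumes "inv_sub X"
  shows "X \<subseteq> carrier_vec m" "0\<^sub>v m \<in> X" "\<And>x y. x \<in> X \<Longrightarrow> y \<in> X \<Longrightarrow> x + y \<in> X"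
    "\<And>r x. x \<in> X \<Longrightarrow> complex_of_real r \<cdot>\<^sub>v x \<in> X" "\<And>U x. U \<in> SUn n \<Longrightarrow> x \<in> X \<Longrightarrow> rho U *\<^sub>v x \<in> X"
  using assms unfolding inv_sub_def by blast+

lemma vip_rho_right:
  assumes U: "U \<in> SUn n" and x: "x \<in> carrier_vec m" and y: "y \<in> carrier_vec m"
  shows "vip x (rho U *\<^sub>v y) = vip (rho (mat_adjoint U) *\<^sub>v x) y"
  using vip_rho[OF SUn_adjoint[OF U] x y] by simp

text \<open>The vectors whose whole orbit is orthogonal to \<open>x\<close> form a complex invariant
  subspace. If \<open>x0\<close> belonged to it, so would everything, including \<open>x\<close>
  itself.\<close>

lemma not_orthogonal_orbit:
  assumes x: "x \<in> carrier_vec m" "x \<noteq> 0\<^sub>v m"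
  shows "\<exists>U\<in>SUn n. vip x (rho U *\<^sub>v x0) \<noteq> 0"
proof (rule ccontr)
  assume neg: "\<not> ?thesis"
  define Q where "Q = {y \<in> carrier_vec m. \<forall>U\<in>SUn n. vip x (rho U *\<^sub>v y) = 0}"
  have "Q = carrier_vec m"
  proof (rule cyclic)
    show "Q \<subseteq> carrier_vec m" by (auto simp: Q_def)
    show "x0 \<in> Q" using neg by (auto simp: Q_def)
    show "y + z \<in> Q" if "y \<in> Q" "z \<in> Q" for y z
      using that by (auto simp: Q_def mult_add_distrib_mat_vec[of _ m m] vip_add_right)
    show "c \<cdot>\<^sub>v y \<in> Q" if "y \<in> Q" for c y
      using that by (auto simp: Q_def mult_mat_vec[of _ m m] vip_smult_right)
    show "rho V *\<^sub>v y \<in> Q" if V: "V \<in> SUn n" and y: "y \<in> Q" for V y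
    proof -
      have "vip x (rho U *\<^sub>v (rho V *\<^sub>v y)) = 0" if U: "U \<in> SUn n" for U
        using y SUn_mult[OF U V] rho_mult_vec[OF SUn_SLn[OF U] SUn_SLn[OF V], of y] by (auto simp: Q_def)
      thus ?thesis by (simp add: Q_def)
    qed
  qed
  hence "x \<in> Q" using x by simp
  hence "vip x (rho (1\<^sub>m n) *\<^sub>v x) = 0" using one_SUn[of n] by (auto simp: Q_def)
  hence "vip x x = 0" using x by (simp add: rho_one)
  hence "\<forall>i\<in>{..<m}. x $ i = 0" by (subst (asm) ip_self_eq_0) auto
  hence "x = 0\<^sub>v m" using x by (intro eq_vecI) auto
  thus False using x by simp
qed

section \<open>A finite cyclic subgroup of the torus and its real projection\<close>

definition Mn :: nat where "Mn = N * (N - 1)"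

definition L :: nat where "L = 2 * Mn + 1"

abbreviation theta :: real where "theta \<equiv> 2 * pi / real L"

definition torus :: "nat \<Rightarrow> complex mat" where
  "torus l = diag_of n (\<lambda>a. cis (theta * real l * real_of_int (xi a)))"

lemma Mn_M: "int Mn = M"
  using N_pos by (simp add: Mn_def M_def of_nat_diff)

lemma Mn_pos: "0 < Mn"
  using N3 by (simp add: Mn_def)

lemma prod_cis: "finite I \<Longrightarrow> (\<Prod>i\<in>I. cis (f i)) = cis (\<Sum>i\<in>I. f i)"
  by (induction I rule: finite_induct) (auto simp: cis_mult)

lemma sum_xi: "(\<Sum>a<n. xi a) = 0"
proof -
  have "{..<n} = insert 0 ({1..k} \<union> {k<..<n})" using kn by auto
  hence "sum xi {..<n} = sum xi (insert 0 ({1..k} \<union> {k<..<n}))" by (rule arg_cong)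
  also have "\<dots> = xi 0 + sum xi ({1..k} \<union> {k<..<n})" by (rule sum.insert) auto
  also have "sum xi ({1..k} \<union> {k<..<n}) = sum xi {1..k} + sum xi {k<..<n}" by (rule sum.union_disjoint) auto
  also have "sum xi {1..k} = 0" by (intro sum.neutral) (auto simp: xi_def)
  also have "sum xi {k<..<n} = (\<Sum>a\<in>{k<..<n}. -1)" by (intro sum.cong) (auto simp: xi_def)
  also have "xi 0 + (0 + \<dots>) = 0" using nkN N_pos by (simp add: xi_def of_nat_diff)
  finally show ?thesis .
qed

lemma torus_adjoint: "mat_adjoint (torus l) = diag_of n (\<lambda>a. cis (- (theta * real l * real_of_int (xi a))))"
  by (rule eq_matI) (auto simp: torus_def cis_cnj)

lemma torus_SUn: "torus l \<in> SUn n"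
proof -
  have "mat_adjoint (torus l) * torus l = 1\<^sub>m n"
  proof (rule eq_matI)
    fix i j assume "i < dim_row (1\<^sub>m n)" "j < dim_col (1\<^sub>m n)"
    hence ij: "i < n" "j < n" by auto
    have "(mat_adjoint (torus l) * torus l) $$ (i, j) =
      (\<Sum>b<n. mat_adjoint (torus l) $$ (i, b) * torus l $$ (b, j))"
      using ij by (simp add: torus_def scalar_prod_def atLeast0LessThan)
    also have "\<dots> = mat_adjoint (torus l) $$ (i, i) * torus l $$ (i, j)"
      using ij unfolding torus_adjoint by (intro sum_single) (auto simp: torus_def)
    finally show "(mat_adjoint (torus l) * torus l) $$ (i, j) = 1\<^sub>m n $$ (i, j)"
      using ij unfolding torus_adjoint by (auto simp: torus_def cis_mult)
  qed (auto simp: torus_def)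
  hence "torus l \<in> unitaries n" by (intro unitariesI) (auto simp: torus_def)
  moreover have "det (torus l) = 1"
  proof -
    have "det (torus l) = prod_list (diag_mat (torus l))"
      by (rule det_upper_triangular[where n = n]) (auto simp: torus_def upper_triangular_def)
    also have "\<dots> = (\<Prod>a<n. cis (theta * real l * real_of_int (xi a)))"
      by (simp add: diag_mat_def torus_def prod.list_conv_set_nth atLeast0LessThan)
    also have "\<dots> = cis (\<Sum>a<n. theta * real l * real_of_int (xi a))" by (rule prod_cis) simp
    also have "(\<Sum>a<n. theta * real l * real_of_int (xi a)) = theta * real l * real_of_int (\<Sum>a<n. xi a)"
      by (simp only: sum_distrib_left of_int_sum)
    finally show ?thesis by (simp add: sum_xi)
  qed
  ultimately show ?thesis by (auto simp: SUn_def unitaries_def)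
qed

lemma krylov_torus:
  assumes A: "A \<in> carrier_mat n n" and x: "y \<in> K"
  shows "krylov N (mat_adjoint (torus l) * A * torus l) y = cis (theta * real l * real_of_int (wt y)) * krylov N A y"
    "krylov N (torus l * A * mat_adjoint (torus l)) y = cis (- (theta * real l * real_of_int (wt y))) * krylov N A y"
proof -
  obtain \<tau> \<kappa> where y: "y = (\<tau>, \<kappa>)" "\<tau> \<in> index_fun N n" "\<kappa> \<in> index_fun N n" using x by auto
  define s where "s = theta * real l"
  have e: "(\<Prod>i<N. cis (- (e * real_of_int (xi (\<tau> i)))) * cis (e * real_of_int (xi (\<kappa> i)))) = cis (e * real_of_int (wt y))" for e
  proof -
    have "(\<Prod>i<N. cis (- (e * real_of_int (xi (\<tau> i)))) * cis (e * real_of_int (xi (\<kappa> i)))) =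
      (\<Prod>i<N. cis (e * real_of_int (xi (\<kappa> i) - xi (\<tau> i))))"
      by (intro prod.cong refl) (simp add: cis_mult algebra_simps)
    also have "\<dots> = cis (\<Sum>i<N. e * real_of_int (xi (\<kappa> i) - xi (\<tau> i)))" by (rule prod_cis) simp
    also have "(\<Sum>i<N. e * real_of_int (xi (\<kappa> i) - xi (\<tau> i))) = e * real_of_int (wt y)"
      unfolding y wt_def split by (simp only: sum_distrib_left of_int_sum)
    finally show ?thesis .
  qed
  have "krylov N (diag_of n (\<lambda>a. cis (- (s * real_of_int (xi a)))) * A * diag_of n (\<lambda>a. cis (s * real_of_int (xi a)))) (\<tau>, \<kappa>) =
    (\<Prod>i<N. cis (- (s * real_of_int (xi (\<tau> i)))) * cis (s * real_of_int (xi (\<kappa> i)))) * krylov N A (\<tau>, \<kappa>)"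
    by (rule krylov_conj_diag[OF A _ y(2,3)]) (simp add: cis_mult)
  thus "krylov N (mat_adjoint (torus l) * A * torus l) y = cis (theta * real l * real_of_int (wt y)) * krylov N A y"
    unfolding torus_adjoint unfolding torus_def s_def[symmetric] e y(1)[symmetric] .
  have "krylov N (diag_of n (\<lambda>a. cis (s * real_of_int (xi a))) * A * diag_of n (\<lambda>a. cis (- (s * real_of_int (xi a))))) (\<tau>, \<kappa>) =
    (\<Prod>i<N. cis (s * real_of_int (xi (\<tau> i))) * cis (- (s * real_of_int (xi (\<kappa> i))))) * krylov N A (\<tau>, \<kappa>)"
    by (rule krylov_conj_diag[OF A _ y(2,3)]) (simp add: cis_mult)
  moreover have "(\<Prod>i<N. cis (s * real_of_int (xi (\<tau> i))) * cis (- (s * real_of_int (xi (\<kappa> i))))) = cis (- (s * real_of_int (wt y)))"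
    using e[of "- s"] by simp
  ultimately show "krylov N (torus l * A * mat_adjoint (torus l)) y = cis (- (theta * real l * real_of_int (wt y))) * krylov N A y"
    unfolding torus_adjoint unfolding torus_def s_def[symmetric] y(1)[symmetric] by simp
qed

lemma rho_torus_x0:
  "rho (torus l) *\<^sub>v x0 = cis (theta * real l * real Mn) \<cdot>\<^sub>v x0"
  "rho (mat_adjoint (torus l)) *\<^sub>v x0 = cis (- (theta * real l * real Mn)) \<cdot>\<^sub>v x0"
proof -
  have tc: "torus l \<in> carrier_mat n n" by (simp add: torus_def)
  have w: "real_of_int (wt (hw_row, hw_col)) = real Mn" unfolding wt_hw Mn_M[symmetric] by simp
  have h: "(hw_row, hw_col) \<in> K" by simp
  show "rho (torus l) *\<^sub>v x0 = cis (theta * real l * real Mn) \<cdot>\<^sub>v x0"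
  proof (rule form_inject)
    fix A :: "complex mat" assume A: "A \<in> carrier_mat n n"
    have A': "mat_adjoint (torus l) * A * torus l \<in> carrier_mat n n" using A tc by simp
    show "form (rho (torus l) *\<^sub>v x0) A = form (cis (theta * real l * real Mn) \<cdot>\<^sub>v x0) A"
      unfolding form_rho_SU[OF kvec_carrier A torus_SUn] form_kvec[OF A' h] krylov_torus(1)[OF A h] w
        form_smult[OF kvec_carrier] form_kvec[OF A h] ..
  qed auto
  show "rho (mat_adjoint (torus l)) *\<^sub>v x0 = cis (- (theta * real l * real Mn)) \<cdot>\<^sub>v x0"
  proof (rule form_inject)
    fix A :: "complex mat" assume A: "A \<in> carrier_mat n n"
    have A': "torus l * A * mat_adjoint (torus l) \<in> carrier_mat n n" using A tc by simp
    show "form (rho (mat_adjoint (torus l)) *\<^sub>v x0) A = form (cis (- (theta * real l * real Mn)) \<cdot>\<^sub>v x0) A"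
      unfolding form_rho_SU[OF kvec_carrier A SUn_adjoint[OF torus_SUn]] mat_adjoint_adjoint
        form_kvec[OF A' h] krylov_torus(2)[OF A h] w form_smult[OF kvec_carrier] form_kvec[OF A h] ..
  qed auto
qed

text \<open>The projection to the extreme weight space has real coefficients on a representation without
  the weight \<open>- M\<close>; this makes it available in real invariant subspaces.\<close>
lemma real_projection:
  assumes X: "inv_sub X" and y: "y \<in> X"
  shows "\<exists>c. c \<cdot>\<^sub>v x0 \<in> X \<and> vip (c \<cdot>\<^sub>v x0) x0 = vip y x0"
proof -
  note X' = inv_subD[OF X]
  have yc: "y \<in> carrier_vec m" using X' y by blast
  define cf where "cf l = 2 * cos (theta * real l * real Mn) / real L" for l :: nat
  \<comment> \<open>The average is built inside \<open>X\<close> one group element at a time, using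
    real coefficients only, and both its values and its inner product with \<open>x0\<close> are
    tracked.\<close>
  have ex: "\<exists>z\<in>X. (\<forall>A\<in>carrier_mat n n. form z A = (\<Sum>l<I. complex_of_real (cf l) * form y (mat_adjoint (torus l) * A * torus l))) \<and>
     vip z x0 = (\<Sum>l<I. complex_of_real (cf l) * vip (rho (torus l) *\<^sub>v y) x0)" for I
  proof (induction I)
    case 0
    show ?case by (rule bexI[OF _ X'(2)]) (auto simp: form_def ip_def)
  next
    case (Suc I)
    then obtain z where z: "z \<in> X"
      "\<forall>A\<in>carrier_mat n n. form z A = (\<Sum>l<I. complex_of_real (cf l) * form y (mat_adjoint (torus l) * A * torus l))"
      "vip z x0 = (\<Sum>l<I. complex_of_real (cf l) * vip (rho (torus l) *\<^sub>v y) x0)" by blast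
    let ?z = "z + complex_of_real (cf I) \<cdot>\<^sub>v (rho (torus I) *\<^sub>v y)"
    have "?z \<in> X" by (intro X'(3) X'(4) X'(5) z(1) y torus_SUn)
    moreover have zc: "z \<in> carrier_vec m" using X' z by blast
    ultimately show ?case using z yc
      by (intro bexI[of _ ?z]) (simp_all add: form_add form_smult form_rho_SU torus_SUn vip_add_left vip_smult_left)
  qed
  obtain z where z: "z \<in> X"
    "\<forall>A\<in>carrier_mat n n. form z A = (\<Sum>l<L. complex_of_real (cf l) * form y (mat_adjoint (torus l) * A * torus l))"
    "vip z x0 = (\<Sum>l<L. complex_of_real (cf l) * vip (rho (torus l) *\<^sub>v y) x0)" using ex[of L] by blast
  have zc: "z \<in> carrier_vec m" using X' z by blast
  have filt: "(\<Sum>l<L. complex_of_real (cf l) * cis (theta * real l * real_of_int w)) = (if w = M then 1 else 0)"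
    if "- M < w" "w \<le> M" for w
    using cos_filter[OF L_def, of w] that unfolding cf_def Mn_M by simp
  \<comment> \<open>Moving the torus element across the inner product hits \<open>x0\<close>, of
    weight \<open>M\<close>, where the filter sums to one; so the projection keeps this inner
    product.\<close>
  have v: "vip z x0 = vip y x0"
  proof -
    have "vip (rho (torus l) *\<^sub>v y) x0 = cis (theta * real l * real_of_int M) * vip y x0" for l
      using vip_rho[OF torus_SUn yc, of x0 l] rho_torus_x0(2)[of l]
      by (simp add: vip_smult_right cis_cnj Mn_M[symmetric])
    hence "vip z x0 = (\<Sum>l<L. complex_of_real (cf l) * cis (theta * real l * real_of_int M)) * vip y x0"
      unfolding z(3) by (simp only: sum_distrib_right mult.assoc)
    moreover have "- M < M" using Mn_pos Mn_M by linarith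
    ultimately show ?thesis using filt[of M] by simp
  qed
  have mult1: "\<exists>c. \<forall>A\<in>carrier_mat n n. (\<Sum>l<L. complex_of_real (cf l) * cis (theta * real l * real_of_int (wt q))) * krylov N A q = c * hw A"
    if q: "q \<in> K" for q
  \<comment> \<open>The weight bounds hold only for coordinates that do not vanish identically; the
    others need no projection.\<close>
  proof (cases "\<exists>A0\<in>carrier_mat n n. krylov N A0 q \<noteq> 0")
    case True
    then obtain A0 where A0: "A0 \<in> carrier_mat n n" "krylov N A0 q \<noteq> 0" by blast
    obtain \<tau> \<kappa> where qe: "q = (\<tau>, \<kappa>)" "\<tau> \<in> index_fun N n" "\<kappa> \<in> index_fun N n" using q by auto
    note W = krylov_weights[OF qe(2,3) A0(1), folded qe(1), OF A0(2)]
    show ?thesis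
    proof (cases "wt q = M")
      case True
      thus ?thesis using W(3) filt[OF W(1,2)] by auto
    next
      case False
      thus ?thesis using filt[OF W(1,2)] by (intro exI[of _ 0]) auto
    qed
  next
    case False
    thus ?thesis by (intro exI[of _ 0]) auto
  qed
  have "\<forall>q\<in>K. \<exists>c. \<forall>A\<in>carrier_mat n n.
    (\<Sum>l<L. complex_of_real (cf l) * cis (theta * real l * real_of_int (wt q))) * krylov N A q = c * hw A"
    by (intro ballI mult1)
  from bchoice[OF this] obtain cq where cq: "\<And>q A. q \<in> K \<Longrightarrow> A \<in> carrier_mat n n \<Longrightarrow>
    (\<Sum>l<L. complex_of_real (cf l) * cis (theta * real l * real_of_int (wt q))) * krylov N A q = cq q * hw A"
    by blast
  define d where "d q = (\<Sum>i<m. y $ i * cnj (u i q))" for q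
  define c where "c = (\<Sum>q\<in>K. d q * cq q)"
  have "z = c \<cdot>\<^sub>v x0"
  proof (rule form_inject)
    fix A :: "complex mat" assume A: "A \<in> carrier_mat n n"
    have "form z A = (\<Sum>l<L. complex_of_real (cf l) * (\<Sum>q\<in>K. d q * krylov N (mat_adjoint (torus l) * A * torus l) q))"
      using z(2) A unfolding form_krylov d_def by simp
    also have "\<dots> = (\<Sum>l<L. \<Sum>q\<in>K. d q * (complex_of_real (cf l) * cis (theta * real l * real_of_int (wt q)) * krylov N A q))"
      unfolding sum_distrib_left by (intro sum.cong refl) (simp only: krylov_torus(1)[OF A] mult_ac)
    also have "\<dots> = (\<Sum>q\<in>K. \<Sum>l<L. d q * (complex_of_real (cf l) * cis (theta * real l * real_of_int (wt q)) * krylov N A q))"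
      by (rule sum.swap)
    also have "\<dots> = (\<Sum>q\<in>K. d q * ((\<Sum>l<L. complex_of_real (cf l) * cis (theta * real l * real_of_int (wt q))) * krylov N A q))"
      by (simp only: sum_distrib_left sum_distrib_right)
    also have "\<dots> = (\<Sum>q\<in>K. d q * (cq q * hw A))" by (intro sum.cong refl) (simp only: cq[OF _ A])
    also have "\<dots> = c * hw A" unfolding c_def sum_distrib_right by (simp only: mult.assoc)
    also have "\<dots> = form (c \<cdot>\<^sub>v x0) A" using A by (simp add: form_smult form_kvec)
    finally show "form z A = form (c \<cdot>\<^sub>v x0) A" .
  qed (use zc in auto)
  thus ?thesis using z(1) v by blast
qed

text \<open>A translate of \<open>x\<close> has nonzero inner product with \<open>x0\<close>, and
  projecting it puts a nonzero multiple of \<open>x0\<close> into \<open>X\<close>. The torus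
  generator multiplies this by a non-real scalar, so \<open>X\<close> contains the whole complex
  line, which generates everything.\<close>

theorem real_irreducible:
  assumes X: "inv_sub X" and x: "x \<in> X" "x \<noteq> 0\<^sub>v m"
  shows "X = carrier_vec m"
proof -
  note X' = inv_subD[OF X]
  have xc: "x \<in> carrier_vec m" using X' x by blast
  obtain U where U: "U \<in> SUn n" "vip x (rho U *\<^sub>v x0) \<noteq> 0" using not_orthogonal_orbit[OF xc x(2)] by blast
  define y where "y = rho (mat_adjoint U) *\<^sub>v x"
  have yX: "y \<in> X" unfolding y_def by (rule X'(5)[OF SUn_adjoint[OF U(1)] x(1)])
  have "vip y x0 \<noteq> 0" unfolding y_def using vip_rho_right[OF U(1) xc kvec_carrier] U(2) by simp
  with real_projection[OF X yX] obtain p where p: "p \<cdot>\<^sub>v x0 \<in> X" "vip (p \<cdot>\<^sub>v x0) x0 \<noteq> 0" by auto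
  have p0: "p \<noteq> 0" using p(2) by (auto simp: vip_smult_left)
  \<comment> \<open>The eigenvalue of the generator on \<open>x0\<close>. Together 1 and
    \<open>w\<close> span the complex numbers over the reals.\<close>
  define w where "w = cis (theta * real Mn)"
  have sw: "Im w \<noteq> 0" unfolding w_def using sin_filter_nonzero[OF L_def Mn_pos] by simp
  have line: "c \<cdot>\<^sub>v x0 \<in> X" for c
  proof -
    define s where "s = Im (c / p) / Im w"
    define r where "r = Re (c / p) - s * Re w"
    have "complex_of_real r + complex_of_real s * w = c / p"
      using sw by (simp add: complex_eq_iff r_def s_def)
    hence e: "complex_of_real r * p + complex_of_real s * (p * w) = c" using p0 by (simp add: field_simps)
    have rt: "rho (torus 1) *\<^sub>v (p \<cdot>\<^sub>v x0) = (p * w) \<cdot>\<^sub>v x0"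
      using rho_torus_x0(1)[of 1] by (simp add: mult_mat_vec[of _ m m] smult_smult_assoc w_def)
    have "complex_of_real r \<cdot>\<^sub>v (p \<cdot>\<^sub>v x0) + complex_of_real s \<cdot>\<^sub>v (rho (torus 1) *\<^sub>v (p \<cdot>\<^sub>v x0)) \<in> X"
      by (intro X'(3) X'(4) X'(5) p(1) torus_SUn)
    also have "complex_of_real r \<cdot>\<^sub>v (p \<cdot>\<^sub>v x0) + complex_of_real s \<cdot>\<^sub>v (rho (torus 1) *\<^sub>v (p \<cdot>\<^sub>v x0)) = c \<cdot>\<^sub>v x0"
      unfolding rt smult_smult_assoc add_smult_distrib_vec[symmetric] e ..
    finally show ?thesis .
  qed
  \<comment> \<open>The largest complex subspace of \<open>X\<close>; it is again invariant, so
    \<open>cyclic\<close> applies to it.\<close>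
  define Q where "Q = {y \<in> carrier_vec m. \<forall>c. c \<cdot>\<^sub>v y \<in> X}"
  have "Q = carrier_vec m"
  proof (rule cyclic)
    show "Q \<subseteq> carrier_vec m" by (auto simp: Q_def)
    show "x0 \<in> Q" using line by (auto simp: Q_def)
    show "y + z \<in> Q" if "y \<in> Q" "z \<in> Q" for y z
      using that X'(3) by (auto simp: Q_def smult_add_distrib_vec)
    show "c \<cdot>\<^sub>v y \<in> Q" if "y \<in> Q" for c y
      using that by (auto simp: Q_def smult_smult_assoc)
    show "rho V *\<^sub>v y \<in> Q" if V: "V \<in> SUn n" and y: "y \<in> Q" for V y
    proof -
      have "c \<cdot>\<^sub>v (rho V *\<^sub>v y) \<in> X" for c
        using X'(5)[OF V, of "c \<cdot>\<^sub>v y"] y mult_mat_vec[of "rho V" m m y c] by (auto simp: Q_def)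
      thus ?thesis by (simp add: Q_def)
    qed
  qed
  moreover have "y \<in> X" if "y \<in> Q" for y
  proof -
    have "1 \<cdot>\<^sub>v y \<in> X" using that unfolding Q_def by blast
    thus ?thesis by simp
  qed
  ultimately show ?thesis using X'(1) by blast
qed

text \<open>The diagonal matrix with entries 0, ..., n - 1 has distinct eigenvalues, so a
  Vandermonde product survives. The witness is Hermitian because it is also used after restriction
  to Hermitian matrices.\<close>

lemma krylov_nonzero: "\<exists>A\<in>Her n. \<exists>l\<in>K. krylov N A l \<noteq> 0"
proof -
  define a :: "nat \<Rightarrow> complex" where "a = (\<lambda>i. complex_of_real (real i))"
  have one: "1\<^sub>m n \<in> unitaries n" using one_SUn by (rule SUn_unitaries)
  have "diag_of n a = 1\<^sub>m n * diag_of n a * mat_adjoint (1\<^sub>m n)" by simp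
  also have "\<dots> \<in> Her n" unfolding a_def by (rule conj_real_diag_Her[OF one])
  finally have H: "diag_of n a \<in> Her n" .
  define \<kappa> where "\<kappa> = restrict id {..<N}"
  have k: "\<kappa> \<in> index_fun N n" using nkN by (auto simp: \<kappa>_def index_fun_def)
  have "inj_on (a \<circ> \<kappa>) {..<N}" by (auto simp: inj_on_def a_def \<kappa>_def)
  hence "vdm N (a \<circ> \<kappa>) \<noteq> 0" by (simp add: vdm_eq_0_iff)
  hence "(\<Sum>\<tau>\<in>index_fun N n. (cmod (krylov N (diag_of n a) (\<tau>, \<kappa>)))\<^sup>2) \<noteq> 0"
    unfolding krylov_diag_sum[OF k] by simp
  then obtain \<tau> where "\<tau> \<in> index_fun N n" "krylov N (diag_of n a) (\<tau>, \<kappa>) \<noteq> 0"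
    by (elim sum.not_neutral_contains_not_neutral) simp
  thus ?thesis using H k by blast
qed

lemma x0_nonzero: "x0 \<noteq> 0\<^sub>v m"
proof
  assume z: "x0 = 0\<^sub>v m"
  have "{0\<^sub>v m :: complex vec} = carrier_vec m"
  proof (rule cyclic)
    show "x0 \<in> {0\<^sub>v m}" using z by simp
    show "rho U *\<^sub>v x \<in> {0\<^sub>v m}" if "x \<in> {0\<^sub>v m}" for U x
      using that by (auto intro!: eq_vecI)
  qed auto
  moreover obtain A l where A: "A \<in> Her n" "l \<in> K" "krylov N A l \<noteq> 0" using krylov_nonzero by blast
  ultimately have "kvec l = 0\<^sub>v m" using kvec_carrier[of l] by blast
  moreover have "form (kvec l) A \<noteq> 0" using A Her_carrier form_kvec by simp
  ultimately show False by (simp add: form_def)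
qed

end

section \<open>Polynomiality\<close>

lemma cpoly_sum: "finite I \<Longrightarrow> (\<And>i. i \<in> I \<Longrightarrow> cpoly n (f i)) \<Longrightarrow> cpoly n (\<lambda>g. \<Sum>i\<in>I. f i g)"
  by (induction I rule: finite_induct) (auto intro: cconst cadd)

lemma cpoly_prod: "finite I \<Longrightarrow> (\<And>i. i \<in> I \<Longrightarrow> cpoly n (f i)) \<Longrightarrow> cpoly n (\<lambda>g. \<Prod>i\<in>I. f i g)"
  by (induction I rule: finite_induct) (auto intro: cconst cmult)

lemma adj_mat_cpoly:
  assumes i: "i < n" and j: "j < n"
  shows "\<exists>p. cpoly n p \<and> (\<forall>g\<in>carrier_mat n n. adj_mat g $$ (i, j) = p g)"
proof -
  \<comment> \<open>\<open>r\<close> and \<open>c\<close> skip row \<open>j\<close> and column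
    \<open>i\<close>: the entry (i, j) of the adjugate is the cofactor at (j, i).\<close>
  define r where "r a = (if a < j then a else Suc a)" for a
  define c where "c b = (if b < i then b else Suc b)" for b
  define p where "p g = (-1) ^ (j + i) * (\<Sum>\<sigma> | \<sigma> permutes {0..<n - 1}. of_int (sign \<sigma>) *
      (\<Prod>a\<in>{0..<n - 1}. g $$ (r a, c (\<sigma> a))))" for g :: "complex mat"
  have rc: "r a < n" "c a < n" if "a < n - 1" for a using that by (auto simp: r_def c_def)
  have "cpoly n p"
    unfolding p_def
  proof (intro cmult cconst cpoly_sum cpoly_prod)
    show "finite {\<sigma>. \<sigma> permutes {0..<n - 1}}" by (rule finite_permutations) simp
    fix \<sigma> a assume "\<sigma> \<in> {\<sigma>. \<sigma> permutes {0..<n - 1}}" "a \<in> {0..<n - 1}"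
    hence "a < n - 1" "\<sigma> a < n - 1" using permutes_in_image[of \<sigma> "{0..<n - 1}" a] by auto
    thus "cpoly n (\<lambda>g. g $$ (r a, c (\<sigma> a)))" using rc by (intro centry) auto
  qed simp
  moreover have "adj_mat g $$ (i, j) = p g" if g: "g \<in> carrier_mat n n" for g
  proof -
    have md: "mat_delete g j i \<in> carrier_mat (n - 1) (n - 1)" using mat_delete_carrier[OF g] .
    have "adj_mat g $$ (i, j) = (-1) ^ (j + i) * det (mat_delete g j i)"
      using g i j by (simp add: adj_mat_def cofactor_def)
    also have "det (mat_delete g j i) = (\<Sum>\<sigma> | \<sigma> permutes {0..<n - 1}. of_int (sign \<sigma>) *
      (\<Prod>a\<in>{0..<n - 1}. mat_delete g j i $$ (a, \<sigma> a)))" by (rule det_def'[OF md])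
    also have "\<dots> = (\<Sum>\<sigma> | \<sigma> permutes {0..<n - 1}. of_int (sign \<sigma>) * (\<Prod>a\<in>{0..<n - 1}. g $$ (r a, c (\<sigma> a))))"
    proof (intro sum.cong refl arg_cong2[of _ _ _ _ "(*)"] prod.cong)
      fix \<sigma> a assume "\<sigma> \<in> {\<sigma>. \<sigma> permutes {0..<n - 1}}" "a \<in> {0..<n - 1}"
      hence "a < n - 1" "\<sigma> a < n - 1" using permutes_in_image[of \<sigma> "{0..<n - 1}" a] by auto
      thus "mat_delete g j i $$ (a, \<sigma> a) = g $$ (r a, c (\<sigma> a))"
        using g by (simp add: mat_delete_def r_def c_def)
    qed
    finally show ?thesis by (simp add: p_def)
  qed
  ultimately show ?thesis by blast
qed

lemma hpoly_rpoly: "hpoly n d f \<Longrightarrow> rpoly n f"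
  by (induction rule: hpoly.induct) (auto intro: rpoly.intros)

lemma hpoly_scale: "hpoly n d f \<Longrightarrow> hpoly n d (\<lambda>A. c * f A)"
  using hmult[OF hconst, of n d f c] by simp

text \<open>A complex-valued function whose real and imaginary parts are homogeneous of one common
  degree in the real coordinates.\<close>

definition chpoly :: "nat \<Rightarrow> nat \<Rightarrow> (complex mat \<Rightarrow> complex) \<Rightarrow> bool" where
  "chpoly n d f \<longleftrightarrow> (\<exists>p q. hpoly n d p \<and> hpoly n d q \<and> (\<forall>A\<in>carrier_mat n n. f A = Complex (p A) (q A)))"

lemma chpoly_add: "chpoly n d f \<Longrightarrow> chpoly n d g \<Longrightarrow> chpoly n d (\<lambda>A. f A + g A)"
proof -
  assume "chpoly n d f" "chpoly n d g"
  then obtain p q p' q' where pq: "hpoly n d p" "hpoly n d q" "\<forall>A\<in>carrier_mat n n. f A = Complex (p A) (q A)"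
    "hpoly n d p'" "hpoly n d q'" "\<forall>A\<in>carrier_mat n n. g A = Complex (p' A) (q' A)"
    unfolding chpoly_def by metis
  show ?thesis unfolding chpoly_def
    by (rule exI[of _ "\<lambda>A. p A + p' A"], rule exI[of _ "\<lambda>A. q A + q' A"])
       (use pq in \<open>auto intro: hadd simp: complex_eq_iff\<close>)
qed

lemma chpoly_mult: "chpoly n d f \<Longrightarrow> chpoly n e g \<Longrightarrow> chpoly n (d + e) (\<lambda>A. f A * g A)"
proof -
  assume "chpoly n d f" "chpoly n e g"
  then obtain p q p' q' where pq: "hpoly n d p" "hpoly n d q" "\<forall>A\<in>carrier_mat n n. f A = Complex (p A) (q A)"
    "hpoly n e p'" "hpoly n e q'" "\<forall>A\<in>carrier_mat n n. g A = Complex (p' A) (q' A)"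
    unfolding chpoly_def by metis
  have "hpoly n (d + e) (\<lambda>A. p A * p' A + (-1) * (q A * q' A))"
    "hpoly n (d + e) (\<lambda>A. p A * q' A + q A * p' A)"
    by (intro hadd hpoly_scale hmult pq)+
  thus ?thesis unfolding chpoly_def using pq(3,6)
    by (intro exI[of _ "\<lambda>A. p A * p' A + (-1) * (q A * q' A)"] exI[of _ "\<lambda>A. p A * q' A + q A * p' A"])
       (auto simp: complex_eq_iff)
qed

lemma chpoly_const: "n > 0 \<Longrightarrow> chpoly n 0 (\<lambda>A. c)"
  unfolding chpoly_def by (intro exI[of _ "\<lambda>A. Re c"] exI[of _ "\<lambda>A. Im c"]) (auto intro: hconst)

lemma chpoly_zero: "n > 0 \<Longrightarrow> chpoly n d (\<lambda>A. 0)"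
  unfolding chpoly_def using hpoly_zero[of n d]
  by (intro exI[of _ "\<lambda>A. 0"]) (auto simp: complex_eq_iff)

lemma chpoly_scale: "n > 0 \<Longrightarrow> chpoly n d f \<Longrightarrow> chpoly n d (\<lambda>A. c * f A)"
  using chpoly_mult[OF chpoly_const, of n d f c] by simp

lemma chpoly_sum:
  assumes "n > 0"
  shows "finite I \<Longrightarrow> (\<And>i. i \<in> I \<Longrightarrow> chpoly n d (f i)) \<Longrightarrow> chpoly n d (\<lambda>A. \<Sum>i\<in>I. f i A)"
  by (induction I rule: finite_induct) (auto intro: chpoly_zero chpoly_add assms)

lemma chpoly_prod:
  assumes "n > 0"
  shows "finite I \<Longrightarrow> (\<And>i. i \<in> I \<Longrightarrow> chpoly n (d i) (f i)) \<Longrightarrow> chpoly n (\<Sum>i\<in>I. d i) (\<lambda>A. \<Prod>i\<in>I. f i A)"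
  by (induction I rule: finite_induct) (auto intro: chpoly_const chpoly_mult assms)

lemma chpoly_cong:
  assumes "chpoly n d f" "\<And>A. A \<in> carrier_mat n n \<Longrightarrow> f A = g A"
  shows "chpoly n d g"
proof -
  obtain p q where "hpoly n d p" "hpoly n d q" "\<forall>A\<in>carrier_mat n n. f A = Complex (p A) (q A)"
    using assms(1) unfolding chpoly_def by blast
  thus ?thesis unfolding chpoly_def using assms(2)
    by (intro exI[of _ p] exI[of _ q]) simp
qed

lemma chpoly_pow:
  assumes n: "n > 0" and ab: "a < n" "b < n"
  shows "chpoly n j (\<lambda>A. (A ^\<^sub>m j) $$ (a, b))"
  using ab
proof (induction j arbitrary: b)
  case 0
  show ?case by (rule chpoly_cong[OF chpoly_const[OF n, of "if a = b then 1 else 0"]]) (use 0 in auto)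
next
  case (Suc j)
  have e: "chpoly n 1 (\<lambda>A. A $$ (c, b))" if "c < n" for c
    unfolding chpoly_def
    by (rule exI[of _ "\<lambda>A. Re (A $$ (c, b))"], rule exI[of _ "\<lambda>A. Im (A $$ (c, b))"])
       (use hre[OF that Suc.prems(2)] him[OF that Suc.prems(2)] in \<open>simp add: complex_eq_iff\<close>)
  have "chpoly n (j + 1) (\<lambda>A. \<Sum>c<n. (A ^\<^sub>m j) $$ (a, c) * A $$ (c, b))"
    by (intro chpoly_sum[OF n] chpoly_mult e Suc.IH) (use Suc.prems in auto)
  hence "chpoly n (Suc j) (\<lambda>A. \<Sum>c<n. (A ^\<^sub>m j) $$ (a, c) * A $$ (c, b))" by simp
  thus ?case
  proof (rule chpoly_cong)
    fix A :: "complex mat" assume A: "A \<in> carrier_mat n n"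
    have "A ^\<^sub>m j \<in> carrier_mat n n" using A by simp
    thus "(\<Sum>c<n. (A ^\<^sub>m j) $$ (a, c) * A $$ (c, b)) = (A ^\<^sub>m Suc j) $$ (a, b)"
      using A Suc.prems by (simp add: scalar_prod_def atLeast0LessThan)
  qed
qed

lemma sum_lessThan_choose: "(\<Sum>j<N. j) = N choose 2"
  by (induction N) (auto simp: numeral_2_eq_2)

lemma chpoly_krylov:
  assumes n: "n > 0" and l: "l \<in> index_fun N n \<times> index_fun N n"
  shows "chpoly n (N choose 2) (\<lambda>A. krylov N A l)"
proof -
  obtain \<tau> \<kappa> where le: "l = (\<tau>, \<kappa>)" "\<tau> \<in> index_fun N n" "\<kappa> \<in> index_fun N n" using l by auto
  show ?thesis
    unfolding krylov_def le(1) split sum_lessThan_choose[symmetric]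
    by (intro chpoly_sum[OF n] chpoly_scale[OF n] chpoly_prod[OF n] chpoly_pow[OF n] finite_Perms finite_lessThan)
       (use le Perms_less index_fun_less in auto)
qed

lemma sum_lessThan_double:
  fixes h :: "nat \<Rightarrow> 'a :: comm_monoid_add"
  shows "(\<Sum>i<2 * m. h i) = (\<Sum>j<m. h (2 * j) + h (2 * j + 1))"
  by (induction m) (auto simp: add.assoc)

section \<open>The representation as highest weight module of SL(n)\<close>

context hook_basis
begin

lemma chpoly_form: "chpoly n (N choose 2) (form x)"
proof -
  have "chpoly n (N choose 2) (\<lambda>A. \<Sum>l\<in>K. (\<Sum>i<m. x $ i * cnj (u i l)) * krylov N A l)"
    by (intro chpoly_sum[OF n_pos finite_K] chpoly_scale[OF n_pos] chpoly_krylov[OF n_pos])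
  thus ?thesis unfolding form_krylov[symmetric] .
qed

lemma rho_cpoly:
  assumes ij: "i < m" "j < m"
  shows "\<exists>p. cpoly n p \<and> (\<forall>g\<in>SLn n. rho g $$ (i, j) = p g)"
proof -
  have "\<forall>a b. \<exists>p. a < n \<and> b < n \<longrightarrow> cpoly n p \<and> (\<forall>g\<in>carrier_mat n n. adj_mat g $$ (a, b) = p g)"
    using adj_mat_cpoly by blast
  then obtain P where P: "\<And>a b. a < n \<Longrightarrow> b < n \<Longrightarrow> cpoly n (P a b)"
    "\<And>a b g. a < n \<Longrightarrow> b < n \<Longrightarrow> g \<in> carrier_mat n n \<Longrightarrow> adj_mat g $$ (a, b) = P a b g"
    by metis
  define p where "p g = (\<Sum>l\<in>K. \<Sum>l'\<in>K. (\<Prod>s<N. P (fst l s) (fst l' s) g * g $$ (snd l' s, snd l s)) * u i l' * cnj (u j l))"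
    for g
  have "cpoly n p" unfolding p_def
    by (intro cpoly_sum finite_K cmult cconst cpoly_prod finite_lessThan P centry) (auto simp: index_fun_less)
  moreover have "rho g $$ (i, j) = p g" if g: "g \<in> SLn n" for g
  proof -
    have gc: "g \<in> carrier_mat n n" using g by (simp add: SLn_def)
    have "tensor_act N g (adj_mat g) l l' = (\<Prod>s<N. P (fst l s) (fst l' s) g * g $$ (snd l' s, snd l s))"
      if "l \<in> K" "l' \<in> K" for l l'
    proof -
      have "fst l s < n" "fst l' s < n" if "s < N" for s
        using \<open>l \<in> K\<close> \<open>l' \<in> K\<close> that by (auto simp: index_fun_less)
      thus ?thesis unfolding tensor_act_def split_def
        by (intro prod.cong refl arg_cong2[of _ _ _ _ "(*)"] P(2) gc) auto
    qed
    thus ?thesis using ij unfolding p_def by (simp add: rho_def cong: sum.cong)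
  qed
  ultimately show ?thesis by blast
qed

text \<open>The complex span of the SL(n) orbit is in particular a real subspace invariant under
  SU(n), so real irreducibility makes it everything. Lists of pairs encode the linear combinations
  until the end.\<close>

lemma orbit_span:
  assumes v: "v \<in> carrier_vec m" "v \<noteq> 0\<^sub>v m" and w: "w \<in> carrier_vec m"
  shows "\<exists>I gs (cs :: nat \<Rightarrow> complex). (\<forall>i < I. gs i \<in> SLn n) \<and>
    (\<forall>l < m. w $ l = (\<Sum>i < I. cs i * (rho (gs i) *\<^sub>v v) $ l))"
proof -
  define X where "X = {w \<in> carrier_vec m. \<exists>ps. (\<forall>p\<in>set ps. fst p \<in> SLn n) \<and>
    (\<forall>l<m. w $ l = (\<Sum>p\<leftarrow>ps. snd p * (rho (fst p) *\<^sub>v v) $ l))}"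
  have "inv_sub X"
    unfolding inv_sub_def
  proof (intro conjI ballI allI)
    show "X \<subseteq> carrier_vec m" by (auto simp: X_def)
    show "0\<^sub>v m \<in> X" by (auto simp: X_def intro!: exI[of _ "[]"])
    show "x + y \<in> X" if "x \<in> X" "y \<in> X" for x y
    proof -
      obtain ps qs where pq: "\<forall>p\<in>set ps. fst p \<in> SLn n" "\<forall>l<m. x $ l = (\<Sum>p\<leftarrow>ps. snd p * (rho (fst p) *\<^sub>v v) $ l)"
        "\<forall>p\<in>set qs. fst p \<in> SLn n" "\<forall>l<m. y $ l = (\<Sum>p\<leftarrow>qs. snd p * (rho (fst p) *\<^sub>v v) $ l)"
        "x \<in> carrier_vec m" "y \<in> carrier_vec m"
        using \<open>x \<in> X\<close> \<open>y \<in> X\<close> unfolding X_def by blast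
      have "\<forall>p\<in>set (ps @ qs). fst p \<in> SLn n" using pq(1,3) unfolding set_append by blast
      moreover have "\<forall>l<m. (x + y) $ l = (\<Sum>p\<leftarrow>ps @ qs. snd p * (rho (fst p) *\<^sub>v v) $ l)"
        using pq by simp
      moreover have "x + y \<in> carrier_vec m" using pq(5,6) by simp
      ultimately show ?thesis unfolding X_def by blast
    qed
    show "complex_of_real r \<cdot>\<^sub>v x \<in> X" if "x \<in> X" for r x
    proof -
      obtain ps where ps: "\<forall>p\<in>set ps. fst p \<in> SLn n" "\<forall>l<m. x $ l = (\<Sum>p\<leftarrow>ps. snd p * (rho (fst p) *\<^sub>v v) $ l)"
        "x \<in> carrier_vec m" using \<open>x \<in> X\<close> unfolding X_def by blast
      let ?qs = "map (\<lambda>p. (fst p, complex_of_real r * snd p)) ps"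
      have "(complex_of_real r \<cdot>\<^sub>v x) $ l = (\<Sum>p\<leftarrow>?qs. snd p * (rho (fst p) *\<^sub>v v) $ l)" if "l < m" for l
      proof -
        have "(\<Sum>p\<leftarrow>?qs. snd p * (rho (fst p) *\<^sub>v v) $ l) = complex_of_real r * (\<Sum>p\<leftarrow>ps. snd p * (rho (fst p) *\<^sub>v v) $ l)"
          by (simp add: sum_list_const_mult o_def mult.assoc)
        thus ?thesis using ps that by simp
      qed
      moreover have "\<forall>p\<in>set ?qs. fst p \<in> SLn n" using ps(1) by auto
      ultimately show ?thesis unfolding X_def using ps(3) by (intro CollectI conjI exI[of _ ?qs]) auto
    qed
    show "rho U *\<^sub>v x \<in> X" if U: "U \<in> SUn n" and x: "x \<in> X" for U x
    proof -
      obtain ps where ps: "\<forall>p\<in>set ps. fst p \<in> SLn n" "\<forall>l<m. x $ l = (\<Sum>p\<leftarrow>ps. snd p * (rho (fst p) *\<^sub>v v) $ l)"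
        "x \<in> carrier_vec m" using x unfolding X_def by blast
      let ?qs = "map (\<lambda>p. (U * fst p, snd p)) ps"
      have "(rho U *\<^sub>v x) $ l = (\<Sum>p\<leftarrow>?qs. snd p * (rho (fst p) *\<^sub>v v) $ l)" if l: "l < m" for l
      proof -
        have "(rho U *\<^sub>v x) $ l = (\<Sum>i<m. rho U $$ (l, i) * (\<Sum>p\<leftarrow>ps. snd p * (rho (fst p) *\<^sub>v v) $ i))"
          unfolding rho_vec_index[OF ps(3) l] by (intro sum.cong refl) (use ps(2) in auto)
        also have "\<dots> = (\<Sum>i<m. \<Sum>p\<leftarrow>ps. rho U $$ (l, i) * (snd p * (rho (fst p) *\<^sub>v v) $ i))"
          by (simp only: sum_list_const_mult)
        also have "\<dots> = (\<Sum>p\<leftarrow>ps. \<Sum>i<m. rho U $$ (l, i) * (snd p * (rho (fst p) *\<^sub>v v) $ i))"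
          by (induction ps) (simp_all add: sum.distrib)
        also have "\<dots> = (\<Sum>p\<leftarrow>ps. snd p * (rho (U * fst p) *\<^sub>v v) $ l)"
        proof (rule arg_cong[of _ _ sum_list], rule map_cong[OF refl])
          fix p assume "p \<in> set ps"
          hence p: "fst p \<in> SLn n" using ps(1) by blast
          have "(rho (U * fst p) *\<^sub>v v) $ l = (\<Sum>i<m. rho U $$ (l, i) * (rho (fst p) *\<^sub>v v) $ i)"
            unfolding rho_mult_vec[OF SUn_SLn[OF U] p v(1)] by (rule rho_vec_index[OF rho_vec l])
          thus "(\<Sum>i<m. rho U $$ (l, i) * (snd p * (rho (fst p) *\<^sub>v v) $ i)) = snd p * (rho (U * fst p) *\<^sub>v v) $ l"
            by (simp only: sum_distrib_left mult.left_commute)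
        qed
        finally show ?thesis by (simp add: o_def)
      qed
      moreover have "\<forall>p\<in>set ?qs. fst p \<in> SLn n" using ps(1) SLn_mult[OF SUn_SLn[OF U]] by auto
      ultimately show ?thesis unfolding X_def by (intro CollectI conjI exI[of _ ?qs]) auto
    qed
  qed
  moreover have "v \<in> X"
    unfolding X_def using v(1) one_SLn
    by (intro CollectI conjI exI[of _ "[(1\<^sub>m n, 1)]"]) (auto simp: rho_one)
  ultimately have "X = carrier_vec m" using v(2) by (intro real_irreducible)
  then obtain ps where ps: "\<forall>p\<in>set ps. fst p \<in> SLn n" "\<forall>l<m. w $ l = (\<Sum>p\<leftarrow>ps. snd p * (rho (fst p) *\<^sub>v v) $ l)"
    using w unfolding X_def by blast
  show ?thesis
    by (rule exI[of _ "length ps"], rule exI[of _ "\<lambda>i. fst (ps ! i)"], rule exI[of _ "\<lambda>i. snd (ps ! i)"])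
       (use ps in \<open>auto simp: sum_list_sum_nth atLeast0LessThan\<close>)
qed

lemma is_V_hw_rho: "is_V_hw n (hook_wt n k) m rho"
  unfolding is_V_hw_def
proof (intro conjI ballI allI impI)
  show "rho g \<in> carrier_mat m m" for g by simp
  show "rho (1\<^sub>m n) = 1\<^sub>m m" by (rule rho_one)
  show "rho (g * h) = rho g * rho h" if "g \<in> SLn n" "h \<in> SLn n" for g h by (rule rho_mult[OF that])
  show "\<exists>p. cpoly n p \<and> (\<forall>g\<in>SLn n. rho g $$ (i, j) = p g)" if "i < m" "j < m" for i j
    by (rule rho_cpoly[OF that])
  show "\<exists>I gs (cs :: nat \<Rightarrow> complex). (\<forall>i < I. gs i \<in> SLn n) \<and> (\<forall>l < m. w $ l = (\<Sum>i < I. cs i * (rho (gs i) *\<^sub>v v) $ l))"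
    if "v \<in> carrier_vec m" "v \<noteq> 0\<^sub>v m" "w \<in> carrier_vec m" for v w
    by (rule orbit_span[OF that])
  show "\<exists>v\<in>carrier_vec m. v \<noteq> 0\<^sub>v m \<and>
      (\<forall>t\<in>SLn n. diagonal_mat t \<longrightarrow> rho t *\<^sub>v v = torus_char n (hook_wt n k) t \<cdot>\<^sub>v v) \<and>
      (\<forall>g. upper_unitriangular n g \<longrightarrow> rho g *\<^sub>v v = v)"
  proof (rule bexI[of _ x0], intro conjI ballI allI impI)
    show "x0 \<noteq> 0\<^sub>v m" by (rule x0_nonzero)
    show "rho t *\<^sub>v x0 = torus_char n (hook_wt n k) t \<cdot>\<^sub>v x0" if t: "t \<in> SLn n" "diagonal_mat t" for t
    proof (rule form_inject)
      fix A :: "complex mat" assume A: "A \<in> carrier_mat n n"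
      note t' = SLn_adj[OF t(1)]
      have "form (rho t *\<^sub>v x0) A = hw (adj_mat t * A * t)"
        using A t' t by (simp add: form_rho form_kvec)
      also have "\<dots> = torus_char n (hook_wt n k) t * hw A" by (rule hw_torus[OF A t t'(2,3)])
      finally show "form (rho t *\<^sub>v x0) A = form (torus_char n (hook_wt n k) t \<cdot>\<^sub>v x0) A"
        using A by (simp add: form_smult form_kvec)
    qed auto
    show "rho g *\<^sub>v x0 = x0" if g: "upper_unitriangular n g" for g
    proof (rule form_inject)
      fix A :: "complex mat" assume A: "A \<in> carrier_mat n n"
      have gc: "g \<in> carrier_mat n n" using g by (simp add: upper_unitriangular_def)
      have "det g = prod_list (diag_mat g)"
        by (rule det_upper_triangular[OF _ gc]) (use g gc in \<open>auto simp: upper_unitriangular_def upper_triangular_def\<close>)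
      also have "diag_mat g = map (\<lambda>_. 1) [0..<n]"
        using g gc by (auto simp: diag_mat_def upper_unitriangular_def)
      finally have "g \<in> SLn n" using gc by (simp add: SLn_def map_replicate_const)
      note g' = this SLn_adj[OF this]
      have "form (rho g *\<^sub>v x0) A = hw (adj_mat g * A * g)"
        using A g' by (simp add: form_rho form_kvec)
      also have "\<dots> = hw A" by (rule hw_unitriangular[OF A g g'(3,4)])
      finally show "form (rho g *\<^sub>v x0) A = form x0 A" using A by (simp add: form_kvec)
    qed auto
  qed simp
qed

section \<open>Real parts on Hermitian matrices\<close>

definition re_form :: "complex vec \<Rightarrow> complex mat \<Rightarrow> real" where
  "re_form x = (\<lambda>A. if A \<in> Her n then Re (form x A) else 0)"

lemma re_form_add:
  "x \<in> carrier_vec m \<Longrightarrow> y \<in> carrier_vec m \<Longrightarrow> (\<lambda>A. re_form x A + re_form y A) = re_form (x + y)"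
  by (auto simp: re_form_def form_add)

lemma re_form_scale:
  "x \<in> carrier_vec m \<Longrightarrow> (\<lambda>A. r * re_form x A) = re_form (complex_of_real r \<cdot>\<^sub>v x)"
  by (auto simp: re_form_def form_smult)

lemma re_form_zero: "re_form (0\<^sub>v m) = (\<lambda>A. 0)"
  by (auto simp: re_form_def form_def)

lemma re_form_act:
  assumes U: "U \<in> SUn n" and x: "x \<in> carrier_vec m"
  shows "su_act n U (re_form x) = re_form (rho U *\<^sub>v x)"
proof
  fix A
  have "U \<in> carrier_mat n n" using U by (simp add: SUn_def)
  thus "su_act n U (re_form x) A = re_form (rho U *\<^sub>v x) A"
    using Her_conj[of A n U] by (simp add: su_act_def re_form_def form_rho_SU[OF x Her_carrier U])
qed

text \<open>The kernel of taking real parts is a real invariant subspace. If nonzero it is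
  everything, hence contains a coordinate together with its multiple by i; that coordinate would
  vanish on all Hermitian matrices, against \<open>krylov_nonzero\<close>.\<close>

lemma re_form_eq_0:
  assumes x: "x \<in> carrier_vec m" and z: "re_form x = (\<lambda>A. 0)"
  shows "x = 0\<^sub>v m"
proof (rule ccontr)
  assume nz: "x \<noteq> 0\<^sub>v m"
  define X where "X = {x \<in> carrier_vec m. re_form x = (\<lambda>A. 0)}"
  have "inv_sub X"
    unfolding inv_sub_def
  proof (intro conjI ballI allI)
    show "X \<subseteq> carrier_vec m" by (auto simp: X_def)
    show "0\<^sub>v m \<in> X" by (simp add: X_def re_form_zero)
    show "x + y \<in> X" if "x \<in> X" "y \<in> X" for x y
      using that by (simp add: X_def re_form_add[symmetric])
    show "complex_of_real r \<cdot>\<^sub>v x \<in> X" if "x \<in> X" for r x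
      using that by (simp add: X_def re_form_scale[symmetric])
    show "rho U *\<^sub>v x \<in> X" if "U \<in> SUn n" "x \<in> X" for U x
      using that by (simp add: X_def re_form_act[symmetric]) (simp add: su_act_def fun_eq_iff)
  qed
  moreover have "x \<in> X" using x z by (simp add: X_def)
  ultimately have X: "X = carrier_vec m" using nz by (intro real_irreducible)
  obtain A l where A: "A \<in> Her n" "l \<in> K" "krylov N A l \<noteq> 0" using krylov_nonzero by blast
  have "re_form (kvec l) A = 0" "re_form (\<i> \<cdot>\<^sub>v kvec l) A = 0"
  proof -
    have "kvec l \<in> X" "\<i> \<cdot>\<^sub>v kvec l \<in> X" unfolding X by simp_all
    thus "re_form (kvec l) A = 0" "re_form (\<i> \<cdot>\<^sub>v kvec l) A = 0" unfolding X_def by simp_all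
  qed
  hence "form (kvec l) A = 0" using A by (simp add: re_form_def form_smult complex_eq_iff)
  thus False using A form_kvec[OF Her_carrier] by simp
qed

lemma inj_re_form: "inj_on re_form (carrier_vec m)"
proof (rule inj_onI)
  fix x y assume xy: "x \<in> carrier_vec m" "y \<in> carrier_vec m" "re_form x = re_form y"
  have "re_form (x + complex_of_real (-1) \<cdot>\<^sub>v y) = (\<lambda>A. 0)"
    using xy by (simp add: re_form_add[symmetric] re_form_scale[symmetric] del: of_real_minus)
  hence "x + complex_of_real (-1) \<cdot>\<^sub>v y = 0\<^sub>v m" using xy by (intro re_form_eq_0) auto
  hence "(x + complex_of_real (-1) \<cdot>\<^sub>v y) $ i = 0" if "i < m" for i using that by simp
  thus "x = y" using xy by (intro eq_vecI) auto
qed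

lemma re_form_vanish_comp:
  assumes x: "x \<in> carrier_vec m"
  shows "re_form x \<in> vanish_comp n (Her_strat n k) ((n - k) choose 2)"
proof -
  obtain p q where pq: "hpoly n (N choose 2) p" "\<forall>A\<in>carrier_mat n n. form x A = Complex (p A) (q A)"
    using chpoly_form[of x] unfolding chpoly_def by blast
  have "re_form x \<in> hom_comp n ((n - k) choose 2)"
    unfolding hom_comp_def N_def[symmetric] using pq Her_carrier by (auto simp: re_form_def intro!: exI[of _ p])
  moreover have "re_form x A = 0" if A: "A \<in> Her_strat n k" for A
    using krylov_vanish_strat[OF A n_pos N_def N_pos] by (simp add: re_form_def form_krylov)
  ultimately show ?thesis by (simp add: vanish_comp_def)
qed

text \<open>Taking real parts is real linear and equivariant, so submodules pull back to real
  invariant subspaces of the coefficient vectors.\<close>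

lemma irreducible_re_form: "irreducible_real_submodule n (re_form ` carrier_vec m)"
  unfolding irreducible_real_submodule_def
proof (intro conjI allI impI)
  show "real_subspace (re_form ` carrier_vec m)"
    unfolding real_subspace_def
  proof (intro conjI ballI allI)
    show "(\<lambda>A. 0) \<in> re_form ` carrier_vec m" using re_form_zero by (metis imageI zero_carrier_vec)
    show "(\<lambda>A. f A + g A) \<in> re_form ` carrier_vec m" if "f \<in> re_form ` carrier_vec m" "g \<in> re_form ` carrier_vec m" for f g
      using that by (auto simp: re_form_add)
    show "(\<lambda>A. r * f A) \<in> re_form ` carrier_vec m" if "f \<in> re_form ` carrier_vec m" for r f
      using that by (auto simp: re_form_scale)
  qed
  show "su_invariant n (re_form ` carrier_vec m)"
    unfolding su_invariant_def by (auto simp: re_form_act)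
  show "re_form ` carrier_vec m \<noteq> {\<lambda>A. 0}"
  proof
    assume "re_form ` carrier_vec m = {\<lambda>A. 0}"
    hence "re_form x0 = (\<lambda>A. 0)" using kvec_carrier by blast
    thus False using re_form_eq_0[OF kvec_carrier] x0_nonzero by blast
  qed
  fix Y assume Y: "Y \<subseteq> re_form ` carrier_vec m" and sub: "real_subspace Y \<and> su_invariant n Y"
  define X where "X = {x \<in> carrier_vec m. re_form x \<in> Y}"
  have YX: "Y = re_form ` X" using Y by (auto simp: X_def)
  have "inv_sub X"
    unfolding inv_sub_def
  proof (intro conjI ballI allI)
    show "X \<subseteq> carrier_vec m" by (auto simp: X_def)
    show "0\<^sub>v m \<in> X" using sub by (simp add: X_def re_form_zero real_subspace_def)
    show "x + y \<in> X" if "x \<in> X" "y \<in> X" for x y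
      using that sub by (simp add: X_def re_form_add[symmetric] real_subspace_def)
    show "complex_of_real r \<cdot>\<^sub>v x \<in> X" if "x \<in> X" for r x
      using that sub by (simp add: X_def re_form_scale[symmetric] real_subspace_def)
    show "rho U *\<^sub>v x \<in> X" if "U \<in> SUn n" "x \<in> X" for U x
      using that sub by (simp add: X_def re_form_act[symmetric] su_invariant_def)
  qed
  show "Y = {\<lambda>A. 0} \<or> Y = re_form ` carrier_vec m"
  proof (cases "\<exists>x\<in>X. x \<noteq> 0\<^sub>v m")
    case True
    then obtain x where "x \<in> X" "x \<noteq> 0\<^sub>v m" by blast
    hence "X = carrier_vec m" using real_irreducible[OF \<open>inv_sub X\<close>] by blast
    thus ?thesis using YX by blast
  next
    case False
    hence "X = {0\<^sub>v m}" using inv_subD(2)[OF \<open>inv_sub X\<close>] by blast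
    thus ?thesis using YX re_form_zero by simp
  qed
qed

lemma iso_re_form: "iso_realification n (re_form ` carrier_vec m) m rho"
  unfolding iso_realification_def
proof (intro exI[of _ "inv_into (carrier_vec m) re_form"] conjI ballI allI)
  let ?phi = "inv_into (carrier_vec m) re_form"
  have phi: "?phi (re_form x) = x" if "x \<in> carrier_vec m" for x by (rule inv_into_f_f[OF inj_re_form that])
  show "bij_betw ?phi (re_form ` carrier_vec m) (carrier_vec m)"
    by (rule bij_betw_inv_into) (simp add: bij_betw_def inj_re_form)
  show "?phi (\<lambda>A. f A + g A) = ?phi f + ?phi g"
    if "f \<in> re_form ` carrier_vec m" "g \<in> re_form ` carrier_vec m" for f g
    using that by (auto simp: re_form_add phi)
  show "?phi (\<lambda>A. r * f A) = complex_of_real r \<cdot>\<^sub>v ?phi f" if "f \<in> re_form ` carrier_vec m" for r f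
    using that by (auto simp: re_form_scale phi)
  show "?phi (su_act n U f) = rho U *\<^sub>v ?phi f" if "U \<in> SUn n" "f \<in> re_form ` carrier_vec m" for U f
    using that by (auto simp: re_form_act phi)
qed

section \<open>The subdiscriminant as a sum of squares\<close>

lemma sum_coord_eq_sDisc:
  assumes A: "A \<in> Her n"
  shows "complex_of_real (\<Sum>i<m. (cmod (coord i A))\<^sup>2) = (fact N)\<^sup>2 * sDisc n k A"
proof -
  note Ac = Her_carrier[OF A]
  have "ip K (krylov N A) (krylov N A) = ip K (\<lambda>l. \<Sum>i<m. coord i A * u i l) (krylov N A)"
    by (rule ip_cong) (simp_all only: krylov_coord[OF Ac])
  also have "\<dots> = (\<Sum>i<m. coord i A * ip K (u i) (krylov N A))"
    unfolding ip_sum_left ip_scale_left ..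
  also have "\<dots> = (\<Sum>i<m. coord i A * cnj (coord i A))"
    unfolding coord_def by (intro sum.cong refl) (simp only: ip_commute[of K "u _"])
  also have "\<dots> = complex_of_real (\<Sum>i<m. (cmod (coord i A))\<^sup>2)"
    by (simp only: complex_norm_square of_real_sum)
  finally have "complex_of_real (\<Sum>i<m. (cmod (coord i A))\<^sup>2) =
    complex_of_real (\<Sum>l\<in>K. (cmod (krylov N A l))\<^sup>2)" unfolding ip_self by simp
  thus ?thesis using sum_krylov_eq_sDisc[OF A n_pos N_def] by simp
qed

lemma sDisc_sum_of_squares:
  "\<exists>q. (\<forall>i < 2 * m. rpoly n (q i)) \<and> (\<forall>A\<in>Her n. sDisc n k A = complex_of_real (\<Sum>i < 2 * m. (q i A)\<^sup>2))"
proof -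
  have "\<exists>p. rpoly n (fst p) \<and> rpoly n (snd p) \<and> (\<forall>A\<in>carrier_mat n n. coord i A = Complex (fst p A) (snd p A))"
    if i: "i < m" for i
  proof -
    have e: "form (unit_vec m i) A = coord i A" for A
      using i unfolding form_def by (subst sum_single[of _ i]) auto
    obtain p q where "hpoly n (N choose 2) p" "hpoly n (N choose 2) q"
      "\<forall>A\<in>carrier_mat n n. form (unit_vec m i) A = Complex (p A) (q A)"
      using chpoly_form[of "unit_vec m i"] unfolding chpoly_def by blast
    thus ?thesis unfolding e by (intro exI[of _ "(p, q)"]) (auto intro: hpoly_rpoly)
  qed
  hence "\<forall>i\<in>{..<m}. \<exists>p. rpoly n (fst p) \<and> rpoly n (snd p) \<and> (\<forall>A\<in>carrier_mat n n. coord i A = Complex (fst p A) (snd p A))"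
    by blast
  from bchoice[OF this] obtain P where P: "\<And>i. i < m \<Longrightarrow> rpoly n (fst (P i))" "\<And>i. i < m \<Longrightarrow> rpoly n (snd (P i))"
    "\<And>i A. i < m \<Longrightarrow> A \<in> carrier_mat n n \<Longrightarrow> coord i A = Complex (fst (P i) A) (snd (P i) A)" by blast
  \<comment> \<open>Even indices carry real parts, odd indices imaginary parts; the factor 1 / N!
    absorbs the constant from \<open>sum_coord_eq_sDisc\<close>.\<close>
  define q where "q i A = (1 / fact N) * (if even i then fst (P (i div 2)) A else snd (P (i div 2)) A)" for i :: nat and A
  have "rpoly n (q i)" if "i < 2 * m" for i
  proof (cases "even i")
    case True
    have "rpoly n (\<lambda>A. (1 / fact N) * fst (P (i div 2)) A)" by (intro rmult rconst P) (use that in auto)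
    moreover have "q i = (\<lambda>A. (1 / fact N) * fst (P (i div 2)) A)" using True by (intro ext) (simp add: q_def)
    ultimately show ?thesis by simp
  next
    case False
    have "rpoly n (\<lambda>A. (1 / fact N) * snd (P (i div 2)) A)" by (intro rmult rconst P) (use that in auto)
    moreover have "q i = (\<lambda>A. (1 / fact N) * snd (P (i div 2)) A)" using False by (intro ext) (simp add: q_def)
    ultimately show ?thesis by simp
  qed
  moreover have "sDisc n k A = complex_of_real (\<Sum>i < 2 * m. (q i A)\<^sup>2)" if A: "A \<in> Her n" for A
  proof -
    have "(\<Sum>i < 2 * m. (q i A)\<^sup>2) = (\<Sum>j<m. (q (2 * j) A)\<^sup>2 + (q (2 * j + 1) A)\<^sup>2)"
      by (rule sum_lessThan_double)
    also have "\<dots> = (\<Sum>j<m. (1 / fact N)\<^sup>2 * (cmod (coord j A))\<^sup>2)"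
    proof (rule sum.cong[OF refl])
      fix j assume "j \<in> {..<m}"
      hence "(cmod (coord j A))\<^sup>2 = (fst (P j) A)\<^sup>2 + (snd (P j) A)\<^sup>2"
        using P(3)[OF _ Her_carrier[OF A], of j] by (simp add: cmod_power2)
      thus "(q (2 * j) A)\<^sup>2 + (q (2 * j + 1) A)\<^sup>2 = (1 / fact N)\<^sup>2 * (cmod (coord j A))\<^sup>2"
        by (simp add: q_def power_mult_distrib distrib_left power_divide add_divide_distrib)
    qed
    finally have "complex_of_real (\<Sum>i < 2 * m. (q i A)\<^sup>2) =
      complex_of_real ((1 / fact N)\<^sup>2) * complex_of_real (\<Sum>j<m. (cmod (coord j A))\<^sup>2)"
      by (simp only: sum_distrib_left[symmetric] of_real_mult)
    also have "\<dots> = sDisc n k A"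
      unfolding sum_coord_eq_sDisc[OF A] by (simp add: power_divide)
    finally show ?thesis by simp
  qed
  ultimately show ?thesis by blast
qed

end

lemma (in hook) exists_basis: "\<exists>m u. hook_basis n k N m u"
proof -
  have "orthonormal K 0 (\<lambda>_ _. 0)" by (simp add: orthonormal_def)
  then obtain m v where "orthonormal K m v" "\<And>i. i < m \<Longrightarrow> v i \<in> kspan n N"
    "\<And>x l. x \<in> kspan n N \<Longrightarrow> l \<in> K \<Longrightarrow> x l = (\<Sum>i<m. ip K x (v i) * v i l)"
    using orthonormal_basis_extend[of K 0 "\<lambda>_ _. 0" "kspan n N"] kspan.lin by (auto elim: meta_mp)
  hence "hook_basis n k N m v"
    by (intro hook_basis.intro hook_axioms hook_basis_axioms.intro)
  thus ?thesis by blast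
qed

theorem theorem8p1:
  fixes n k :: nat
  assumes "n \<ge> 3" and "k \<le> n - 3"
  shows "(\<forall>d < (n - k) choose 2. vanish_comp n (Her_strat n k) d = {\<lambda>A. 0})
    \<and> (\<exists>M m rho. M \<subseteq> vanish_comp n (Her_strat n k) ((n - k) choose 2)
          \<and> irreducible_real_submodule n M
          \<and> is_V_hw n (hook_wt n k) m rho \<and> iso_realification n M m rho)
    \<and> (\<exists>m rho q. is_V_hw n (hook_wt n k) m rho
          \<and> (\<forall>i < 2 * m. rpoly n (q i))
          \<and> (\<forall>A \<in> Her n. sDisc n k A = complex_of_real (\<Sum>i < 2 * m. (q i A)^2)))"
proof -
  interpret hook n k "n - k" by unfold_locales (use assms in auto)
  obtain m u where "hook_basis n k (n - k) m u" using exists_basis by blast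
  then interpret hook_basis n k "n - k" m u .
  have "\<forall>d < (n - k) choose 2. vanish_comp n (Her_strat n k) d = {\<lambda>A. 0}"
    using vanish_comp_low_degree[OF n_pos] by blast
  moreover have "re_form ` carrier_vec m \<subseteq> vanish_comp n (Her_strat n k) ((n - k) choose 2)"
    using re_form_vanish_comp by blast
  ultimately show ?thesis
    using irreducible_re_form is_V_hw_rho iso_re_form sDisc_sum_of_squares by blast
qed

end
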